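(* Let $(\mathsf{T},\mathsf{U},Q,D)$ be an Auslander--Gruson--Jensen (AGJ) duality triple, and define the contravariant functor $\delta\colon(\mathsf{T}^{\mathrm{c}},\mathbf{Ab})^{\mathrm{op}}\to(\mathsf{U}^{\mathrm{c}},\mathbf{Ab})$ by $(\delta G)(Y)=\mathrm{Hom}_{(\mathsf{T}^{\mathrm{c}},\mathbf{Ab})}(G,\mathrm{Hom}_{\mathsf{T}}(DY,-))$, and analogously $\delta\colon(\mathsf{U}^{\mathrm{c}},\mathbf{Ab})^{\mathrm{op}}\to(\mathsf{T}^{\mathrm{c}},\mathbf{Ab})$. Then: (1) There is a natural isomorphism $\delta\,\mathrm{Hom}_{\mathsf{T}}(X,-)\cong\mathrm{Hom}_{\mathsf{U}}(DX,-)$ for any $X\in\mathsf{T}^{\mathrm{c}}$. In particular, $\delta^{2}\,\mathrm{Hom}_{\mathsf{T}}(X,-)\cong\mathrm{Hom}_{\mathsf{T}}(X,-)$. (2) The functor $\delta$ restricts to an exact contravariant equivalence $(\mathsf{T}^{\mathrm{c}},\mathbf{Ab})^{\mathrm{fp}}\to(\mathsf{U}^{\mathrm{c}},\mathbf{Ab})^{\mathrm{fp}}$.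
   Context: For a compactly generated triangulated category $\mathsf{T}$ with compact objects $\mathsf{T}^{\mathrm{c}}$, $(\mathsf{T}^{\mathrm{c}},\mathbf{Ab})$ is the category of additive functors $\mathsf{T}^{\mathrm{c}}\to\mathbf{Ab}$ and $(\mathsf{T}^{\mathrm{c}},\mathbf{Ab})^{\mathrm{fp}}$ the full (abelian) subcategory of finitely presented functors, i.e. cokernels of maps $\mathrm{Hom}_{\mathsf{T}}(f,-)\colon\mathrm{Hom}_{\mathsf{T}}(B,-)\to\mathrm{Hom}_{\mathsf{T}}(A,-)$ with $f\colon A\to B$ in $\mathsf{T}^{\mathrm{c}}$. $\mathrm{Mod}(\mathsf{T}^{\mathrm{c}})$ is the category of additive functors $(\mathsf{T}^{\mathrm{c}})^{\mathrm{op}}\to\mathbf{Ab}$ and $\mathbf{y}X=\mathrm{Hom}_{\mathsf{T}}(-,X)|_{\mathsf{T}^{\mathrm{c}}}$. A morphism $X\to Y$ is a pure monomorphism if it sits in a triangle $X\to Y\to Z\to\Sigma X$ with $0\to\mathbf{y}X\to\mathbf{y}Y\to\mathbf{y}Z\to0$ exact; $X$ is pure injective if $\mathbf{y}X$ is injective. A duality triple $(\mathsf{T},\mathsf{U},Q)$ consists of two compactly generated triangulated categories $\mathsf{T},\mathsf{U}$ and exact functors $Q\colon\mathsf{T}^{\mathrm{op}}\to\mathsf{U}$ and $Q\colon\mathsf{U}^{\mathrm{op}}\to\mathsf{T}$ (both denoted $Q$) such that: (1) $Q(X)$ is pure injective for every $X$ in $\mathsf{T}$ or $\mathsf{U}$;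 (2) for every $X$ in $\mathsf{T}$ or $\mathsf{U}$ there is a natural map $i_X\colon X\to Q^2(X)$ which is a pure monomorphism; (3) $Q(i_X)\circ i_{Q(X)}$ is the identity for every $X$ in $\mathsf{T}$ or $\mathsf{U}$; (4) $Q(\bigoplus_I X_i)\simeq\prod_I Q(X_i)$ for every set of objects $\{X_i\}_I$ in $\mathsf{T}$ or in $\mathsf{U}$. An AGJ duality triple $(\mathsf{T},\mathsf{U},Q,D)$ is a duality triple $(\mathsf{T},\mathsf{U},Q)$ together with functors $D\colon(\mathsf{T}^{\mathrm{c}})^{\mathrm{op}}\to\mathsf{U}^{\mathrm{c}}$ and $D\colon(\mathsf{U}^{\mathrm{c}})^{\mathrm{op}}\to\mathsf{T}^{\mathrm{c}}$ such that: (1) they form an adjoint equivalence between $\mathsf{T}^{\mathrm{c}}$ and $(\mathsf{U}^{\mathrm{c}})^{\mathrm{op}}$ (so $D^2\cong\mathrm{id}$ and $\mathrm{Hom}_{\mathsf{T}}(DY,X)\cong\mathrm{Hom}_{\mathsf{U}}(DX,Y)$ naturally in $X\in\mathsf{T}^{\mathrm{c}}$, $Y\in\mathsf{U}^{\mathrm{c}}$); (2) for all $C\in\mathsf{T}^{\mathrm{c}}$, $X\in\mathsf{T}$, $C'\in\mathsf{U}^{\mathrm{c}}$, $Y\in\mathsf{U}$ there are isomorphisms $\mathrm{Hom}_{\mathbb{Z}}(\mathrm{Hom}_{\mathsf{T}}(C,X),\mathbb{Q}/\mathbb{Z})\cong\mathrm{Hom}_{\mathsf{U}}(DC,QX)$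 and $\mathrm{Hom}_{\mathbb{Z}}(\mathrm{Hom}_{\mathsf{U}}(C',Y),\mathbb{Q}/\mathbb{Z})\cong\mathrm{Hom}_{\mathsf{T}}(DC',QY)$, natural in both variables. *)

theory Defs
  imports "HOL-Algebra.Free_Abelian_Groups" "HOL-Library.Equipollence"
begin

section \<open>The universe\<close>

text \<open>A type \<open>'u\<close> plays the role of a Grothendieck universe of sets: subsets of \<open>'u\<close> are the classes,
  and those of cardinality strictly below that of \<open>'u\<close> are the (small) sets.  The closure conditions
  say that the cardinality of \<open>'u\<close> is a regular strong limit.  They do not force an infinite small set;
  adding that requirement (inaccessibility) would only be a further hypothesis.\<close>

definition small :: "'u itself \<Rightarrow> 'x set \<Rightarrow> bool" where
  "small _ A \<longleftrightarrow> A \<prec> (UNIV :: 'u set)"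

definition universe :: "'u itself \<Rightarrow> bool" where
  "universe U \<longleftrightarrow>
     (\<forall>A :: 'u set. small U A \<longrightarrow> small U (Pow A)) \<and>
     (\<forall>(I :: 'u set) (A :: 'u \<Rightarrow> 'u set).
        small U I \<and> (\<forall>i\<in>I. small U (A i)) \<longrightarrow> small U (\<Union>i\<in>I. A i))"


section \<open>Preadditive categories and functors\<close>

record ('o, 'a) cat =
  Obj :: "'o set"
  Arr :: "'a set"
  Dom :: "'a \<Rightarrow> 'o"
  Cod :: "'a \<Rightarrow> 'o"
  Ident :: "'o \<Rightarrow> 'a"
  Comp :: "'a \<Rightarrow> 'a \<Rightarrow> 'a" (infixr "\<cdot>\<index>" 75)
  Add :: "'a \<Rightarrow> 'a \<Rightarrow> 'a" (infixl "\<boxplus>\<index>" 65)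
  Zero :: "'o \<Rightarrow> 'o \<Rightarrow> 'a"

text \<open>Abelian groups are written as HOL-Algebra \<open>comm_group\<close>s, i.e. with multiplicative syntax.\<close>

definition Hom :: "('o, 'a, 'm) cat_scheme \<Rightarrow> 'o \<Rightarrow> 'o \<Rightarrow> 'a monoid" where
  "Hom C X Y = \<lparr>carrier = {f \<in> Arr C. Dom C f = X \<and> Cod C f = Y}, monoid.mult = Add C, one = Zero C X Y\<rparr>"

abbreviation in_hom :: "('o, 'a, 'm) cat_scheme \<Rightarrow> 'a \<Rightarrow> 'o \<Rightarrow> 'o \<Rightarrow> bool"
    ("\<guillemotleft>_ : _ \<rightarrow>\<index> _\<guillemotright>") where
  "in_hom C f X Y \<equiv> f \<in> carrier (Hom C X Y)"

definition neg :: "('o, 'a, 'm) cat_scheme \<Rightarrow> 'a \<Rightarrow> 'a" where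
  "neg C f = inv\<^bsub>Hom C (Dom C f) (Cod C f)\<^esub> f"

locale preadditive =
  fixes C :: "('o, 'a, 'm) cat_scheme" (structure)
  assumes dom_cod: "f \<in> Arr C \<Longrightarrow> Dom C f \<in> Obj C \<and> Cod C f \<in> Obj C"
    and ident: "X \<in> Obj C \<Longrightarrow> \<guillemotleft>Ident C X : X \<rightarrow> X\<guillemotright>"
    and comp: "\<lbrakk>\<guillemotleft>f : X \<rightarrow> Y\<guillemotright>; \<guillemotleft>g : Y \<rightarrow> Z\<guillemotright>\<rbrakk> \<Longrightarrow> \<guillemotleft>g \<cdot> f : X \<rightarrow> Z\<guillemotright>"
    and ident_left: "\<guillemotleft>f : X \<rightarrow> Y\<guillemotright> \<Longrightarrow> Ident C Y \<cdot> f = f"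
    and ident_right: "\<guillemotleft>f : X \<rightarrow> Y\<guillemotright> \<Longrightarrow> f \<cdot> Ident C X = f"
    and assoc: "\<lbrakk>\<guillemotleft>f : W \<rightarrow> X\<guillemotright>; \<guillemotleft>g : X \<rightarrow> Y\<guillemotright>; \<guillemotleft>h : Y \<rightarrow> Z\<guillemotright>\<rbrakk> \<Longrightarrow> (h \<cdot> g) \<cdot> f = h \<cdot> (g \<cdot> f)"
    and hom_group: "\<lbrakk>X \<in> Obj C; Y \<in> Obj C\<rbrakk> \<Longrightarrow> comm_group (Hom C X Y)"
    and distrib_left: "\<lbrakk>\<guillemotleft>f : X \<rightarrow> Y\<guillemotright>; \<guillemotleft>f' : X \<rightarrow> Y\<guillemotright>; \<guillemotleft>g : Y \<rightarrow> Z\<guillemotright>\<rbrakk> \<Longrightarrow> g \<cdot> (f \<boxplus> f') = (g \<cdot> f) \<boxplus> (g \<cdot> f')"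
    and distrib_right: "\<lbrakk>\<guillemotleft>f : X \<rightarrow> Y\<guillemotright>; \<guillemotleft>g : Y \<rightarrow> Z\<guillemotright>; \<guillemotleft>g' : Y \<rightarrow> Z\<guillemotright>\<rbrakk> \<Longrightarrow> (g \<boxplus> g') \<cdot> f = (g \<cdot> f) \<boxplus> (g' \<cdot> f)"

definition op :: "('o, 'a, 'm) cat_scheme \<Rightarrow> ('o, 'a) cat" where
  "op C = \<lparr>Obj = Obj C, Arr = Arr C, Dom = Cod C, Cod = Dom C, Ident = Ident C,
           Comp = (\<lambda>g f. f \<cdot>\<^bsub>C\<^esub> g), Add = Add C, Zero = (\<lambda>X Y. Zero C Y X)\<rparr>"

definition full_sub :: "('o, 'a, 'm) cat_scheme \<Rightarrow> 'o set \<Rightarrow> ('o, 'a) cat" where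
  "full_sub C S = \<lparr>Obj = Obj C \<inter> S, Arr = {f \<in> Arr C. Dom C f \<in> S \<and> Cod C f \<in> S},
                   Dom = Dom C, Cod = Cod C, Ident = Ident C, Comp = Comp C, Add = Add C, Zero = Zero C\<rparr>"

definition is_iso :: "('o, 'a, 'm) cat_scheme \<Rightarrow> 'a \<Rightarrow> 'o \<Rightarrow> 'o \<Rightarrow> bool" where
  "is_iso C f X Y \<longleftrightarrow> \<guillemotleft>f : X \<rightarrow>\<^bsub>C\<^esub> Y\<guillemotright> \<and>
     (\<exists>g. \<guillemotleft>g : Y \<rightarrow>\<^bsub>C\<^esub> X\<guillemotright> \<and> g \<cdot>\<^bsub>C\<^esub> f = Ident C X \<and> f \<cdot>\<^bsub>C\<^esub> g = Ident C Y)"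

definition isomorphic :: "('o, 'a, 'm) cat_scheme \<Rightarrow> 'o \<Rightarrow> 'o \<Rightarrow> bool" where
  "isomorphic C X Y \<longleftrightarrow> (\<exists>f. is_iso C f X Y)"

definition is_mono :: "('o, 'a, 'm) cat_scheme \<Rightarrow> 'a \<Rightarrow> bool" where
  "is_mono C m \<longleftrightarrow> m \<in> Arr C \<and>
     (\<forall>X f g. \<guillemotleft>f : X \<rightarrow>\<^bsub>C\<^esub> Dom C m\<guillemotright> \<and> \<guillemotleft>g : X \<rightarrow>\<^bsub>C\<^esub> Dom C m\<guillemotright> \<and> m \<cdot>\<^bsub>C\<^esub> f = m \<cdot>\<^bsub>C\<^esub> g \<longrightarrow> f = g)"

definition is_injective :: "('o, 'a, 'm) cat_scheme \<Rightarrow> 'o \<Rightarrow> bool" where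
  "is_injective C E \<longleftrightarrow> E \<in> Obj C \<and>
     (\<forall>A B m f. \<guillemotleft>m : A \<rightarrow>\<^bsub>C\<^esub> B\<guillemotright> \<and> is_mono C m \<and> \<guillemotleft>f : A \<rightarrow>\<^bsub>C\<^esub> E\<guillemotright> \<longrightarrow>
        (\<exists>g. \<guillemotleft>g : B \<rightarrow>\<^bsub>C\<^esub> E\<guillemotright> \<and> g \<cdot>\<^bsub>C\<^esub> m = f))"

definition is_zero :: "('o, 'a, 'm) cat_scheme \<Rightarrow> 'o \<Rightarrow> bool" where
  "is_zero C Z \<longleftrightarrow> Z \<in> Obj C \<and>
     (\<forall>X\<in>Obj C. (\<exists>!f. \<guillemotleft>f : X \<rightarrow>\<^bsub>C\<^esub> Z\<guillemotright>) \<and> (\<exists>!f. \<guillemotleft>f : Z \<rightarrow>\<^bsub>C\<^esub> X\<guillemotright>))"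

definition is_kernel :: "('o, 'a, 'm) cat_scheme \<Rightarrow> 'a \<Rightarrow> 'a \<Rightarrow> bool" where
  "is_kernel C k g \<longleftrightarrow> k \<in> Arr C \<and> g \<in> Arr C \<and> Cod C k = Dom C g \<and>
     g \<cdot>\<^bsub>C\<^esub> k = Zero C (Dom C k) (Cod C g) \<and>
     (\<forall>X h. \<guillemotleft>h : X \<rightarrow>\<^bsub>C\<^esub> Dom C g\<guillemotright> \<and> g \<cdot>\<^bsub>C\<^esub> h = Zero C X (Cod C g) \<longrightarrow>
        (\<exists>!l. \<guillemotleft>l : X \<rightarrow>\<^bsub>C\<^esub> Dom C k\<guillemotright> \<and> k \<cdot>\<^bsub>C\<^esub> l = h))"

definition is_cokernel :: "('o, 'a, 'm) cat_scheme \<Rightarrow> 'a \<Rightarrow> 'a \<Rightarrow> bool" where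
  "is_cokernel C p f \<longleftrightarrow> is_kernel (op C) p f"

text \<open>Exactness of \<open>0 \<rightarrow> \<bullet> \<rightarrow> \<bullet> \<rightarrow> \<bullet> \<rightarrow> 0\<close> with maps \<open>f\<close>, \<open>g\<close>, in an abelian category \<open>C\<close>.\<close>

definition short_exact :: "('o, 'a, 'm) cat_scheme \<Rightarrow> 'a \<Rightarrow> 'a \<Rightarrow> bool" where
  "short_exact C f g \<longleftrightarrow> is_kernel C f g \<and> is_cokernel C g f"

definition is_biproduct :: "('o, 'a, 'm) cat_scheme \<Rightarrow> 'o \<Rightarrow> 'o \<Rightarrow> 'o \<Rightarrow> bool" where
  "is_biproduct C X Y P \<longleftrightarrow> (\<exists>i j p q.
     \<guillemotleft>i : X \<rightarrow>\<^bsub>C\<^esub> P\<guillemotright> \<and> \<guillemotleft>j : Y \<rightarrow>\<^bsub>C\<^esub> P\<guillemotright> \<and> \<guillemotleft>p : P \<rightarrow>\<^bsub>C\<^esub> X\<guillemotright> \<and> \<guillemotleft>q : P \<rightarrow>\<^bsub>C\<^esub> Y\<guillemotright> \<and>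
     p \<cdot>\<^bsub>C\<^esub> i = Ident C X \<and> q \<cdot>\<^bsub>C\<^esub> j = Ident C Y \<and> q \<cdot>\<^bsub>C\<^esub> i = Zero C X Y \<and> p \<cdot>\<^bsub>C\<^esub> j = Zero C Y X \<and>
     (i \<cdot>\<^bsub>C\<^esub> p) \<boxplus>\<^bsub>C\<^esub> (j \<cdot>\<^bsub>C\<^esub> q) = Ident C P)"

definition is_coproduct ::
    "('o, 'a, 'm) cat_scheme \<Rightarrow> 'i set \<Rightarrow> ('i \<Rightarrow> 'o) \<Rightarrow> 'o \<Rightarrow> ('i \<Rightarrow> 'a) \<Rightarrow> bool" where
  "is_coproduct C I X P \<iota> \<longleftrightarrow> P \<in> Obj C \<and> (\<forall>i\<in>I. \<guillemotleft>\<iota> i : X i \<rightarrow>\<^bsub>C\<^esub> P\<guillemotright>) \<and>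
     (\<forall>Y\<in>Obj C. \<forall>f. (\<forall>i\<in>I. \<guillemotleft>f i : X i \<rightarrow>\<^bsub>C\<^esub> Y\<guillemotright>) \<longrightarrow>
        (\<exists>!h. \<guillemotleft>h : P \<rightarrow>\<^bsub>C\<^esub> Y\<guillemotright> \<and> (\<forall>i\<in>I. h \<cdot>\<^bsub>C\<^esub> \<iota> i = f i)))"

definition is_product ::
    "('o, 'a, 'm) cat_scheme \<Rightarrow> 'i set \<Rightarrow> ('i \<Rightarrow> 'o) \<Rightarrow> 'o \<Rightarrow> ('i \<Rightarrow> 'a) \<Rightarrow> bool" where
  "is_product C I X P \<pi> \<longleftrightarrow> is_coproduct (op C) I X P \<pi>"

locale additive_category = preadditive +
  assumes zero_object: "\<exists>Z. is_zero C Z"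
    and biproducts: "\<lbrakk>X \<in> Obj C; Y \<in> Obj C\<rbrakk> \<Longrightarrow> \<exists>P. is_biproduct C X Y P"

record ('o, 'a, 'p, 'b) ftor =
  omap :: "'o \<Rightarrow> 'p"
  amap :: "'a \<Rightarrow> 'b"

definition is_functor ::
    "('o, 'a, 'm) cat_scheme \<Rightarrow> ('p, 'b, 'n) cat_scheme \<Rightarrow> ('o, 'a, 'p, 'b) ftor \<Rightarrow> bool" where
  "is_functor C D F \<longleftrightarrow>
     (\<forall>X\<in>Obj C. omap F X \<in> Obj D) \<and>
     (\<forall>X Y f. \<guillemotleft>f : X \<rightarrow>\<^bsub>C\<^esub> Y\<guillemotright> \<longrightarrow> \<guillemotleft>amap F f : omap F X \<rightarrow>\<^bsub>D\<^esub> omap F Y\<guillemotright>) \<and>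
     (\<forall>X\<in>Obj C. amap F (Ident C X) = Ident D (omap F X)) \<and>
     (\<forall>X Y Z f g. \<guillemotleft>f : X \<rightarrow>\<^bsub>C\<^esub> Y\<guillemotright> \<and> \<guillemotleft>g : Y \<rightarrow>\<^bsub>C\<^esub> Z\<guillemotright> \<longrightarrow> amap F (g \<cdot>\<^bsub>C\<^esub> f) = amap F g \<cdot>\<^bsub>D\<^esub> amap F f)"

definition is_additive_functor ::
    "('o, 'a, 'm) cat_scheme \<Rightarrow> ('p, 'b, 'n) cat_scheme \<Rightarrow> ('o, 'a, 'p, 'b) ftor \<Rightarrow> bool" where
  "is_additive_functor C D F \<longleftrightarrow> is_functor C D F \<and>
     (\<forall>X Y f g. \<guillemotleft>f : X \<rightarrow>\<^bsub>C\<^esub> Y\<guillemotright> \<and> \<guillemotleft>g : X \<rightarrow>\<^bsub>C\<^esub> Y\<guillemotright> \<longrightarrow> amap F (f \<boxplus>\<^bsub>C\<^esub> g) = amap F f \<boxplus>\<^bsub>D\<^esub> amap F g)"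

definition is_exact_functor ::
    "('o, 'a, 'm) cat_scheme \<Rightarrow> ('p, 'b, 'n) cat_scheme \<Rightarrow> ('o, 'a, 'p, 'b) ftor \<Rightarrow> bool" where
  "is_exact_functor C D F \<longleftrightarrow> is_additive_functor C D F \<and>
     (\<forall>f g. short_exact C f g \<longrightarrow> short_exact D (amap F f) (amap F g))"

definition id_ftor :: "('o, 'a, 'o, 'a) ftor" where
  "id_ftor = \<lparr>omap = (\<lambda>X. X), amap = (\<lambda>f. f)\<rparr>"

definition comp_ftor ::
    "('p, 'b, 'q, 'c) ftor \<Rightarrow> ('o, 'a, 'p, 'b) ftor \<Rightarrow> ('o, 'a, 'q, 'c) ftor" (infixr "\<circ>\<^sub>F" 75) where
  "G \<circ>\<^sub>F F = \<lparr>omap = omap G \<circ> omap F, amap = amap G \<circ> amap F\<rparr>"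

definition nat_trans :: "('o, 'a, 'm) cat_scheme \<Rightarrow> ('p, 'b, 'n) cat_scheme \<Rightarrow>
    ('o, 'a, 'p, 'b) ftor \<Rightarrow> ('o, 'a, 'p, 'b) ftor \<Rightarrow> ('o \<Rightarrow> 'b) \<Rightarrow> bool" where
  "nat_trans C D F G \<tau> \<longleftrightarrow>
     (\<forall>X\<in>Obj C. \<guillemotleft>\<tau> X : omap F X \<rightarrow>\<^bsub>D\<^esub> omap G X\<guillemotright>) \<and>
     (\<forall>X Y f. \<guillemotleft>f : X \<rightarrow>\<^bsub>C\<^esub> Y\<guillemotright> \<longrightarrow> amap G f \<cdot>\<^bsub>D\<^esub> \<tau> X = \<tau> Y \<cdot>\<^bsub>D\<^esub> amap F f)"

definition nat_iso :: "('o, 'a, 'm) cat_scheme \<Rightarrow> ('p, 'b, 'n) cat_scheme \<Rightarrow>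
    ('o, 'a, 'p, 'b) ftor \<Rightarrow> ('o, 'a, 'p, 'b) ftor \<Rightarrow> ('o \<Rightarrow> 'b) \<Rightarrow> bool" where
  "nat_iso C D F G \<tau> \<longleftrightarrow> nat_trans C D F G \<tau> \<and> (\<forall>X\<in>Obj C. is_iso D (\<tau> X) (omap F X) (omap G X))"

definition is_equivalence ::
    "('o, 'a, 'm) cat_scheme \<Rightarrow> ('p, 'b, 'n) cat_scheme \<Rightarrow> ('o, 'a, 'p, 'b) ftor \<Rightarrow> bool" where
  "is_equivalence C D F \<longleftrightarrow> is_functor C D F \<and>
     (\<exists>G \<eta> \<epsilon>. is_functor D C G \<and> nat_iso C C id_ftor (G \<circ>\<^sub>F F) \<eta> \<and> nat_iso D D (F \<circ>\<^sub>F G) id_ftor \<epsilon>)"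


section \<open>Abelian groups and functor categories\<close>

datatype ('o, 'f) arrow = Arrow (source: 'o) (target: 'o) (body: 'f)

definition hom_group :: "('x, 'm) monoid_scheme \<Rightarrow> ('y, 'n) monoid_scheme \<Rightarrow> ('x \<Rightarrow> 'y) monoid" where
  "hom_group A B = \<lparr>carrier = hom A B \<inter> extensional (carrier A),
                    monoid.mult = (\<lambda>f g. \<lambda>x\<in>carrier A. f x \<otimes>\<^bsub>B\<^esub> g x),
                    one = (\<lambda>x\<in>carrier A. \<one>\<^bsub>B\<^esub>)\<rparr>"

definition Ab :: "('u monoid, ('u monoid, 'u \<Rightarrow> 'u) arrow) cat" where
  "Ab = \<lparr>Obj = {A. comm_group A \<and> small TYPE('u) (carrier A)},
         Arr = {Arrow A B f | A B f. comm_group A \<and> small TYPE('u) (carrier A) \<and>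
                  comm_group B \<and> small TYPE('u) (carrier B) \<and> f \<in> carrier (hom_group A B)},
         Dom = source, Cod = target,
         Ident = (\<lambda>A. Arrow A A (\<lambda>x\<in>carrier A. x)),
         Comp = (\<lambda>g f. Arrow (source f) (target g) (compose (carrier (source f)) (body g) (body f))),
         Add = (\<lambda>f g. Arrow (source f) (target f) (body f \<otimes>\<^bsub>hom_group (source f) (target f)\<^esub> body g)),
         Zero = (\<lambda>A B. Arrow A B \<one>\<^bsub>hom_group A B\<^esub>)\<rparr>"

text \<open>The category of additive functors from \<open>C\<close> to \<open>D\<close>.\<close>

definition fun_cat :: "('o, 'a, 'm) cat_scheme \<Rightarrow> ('p, 'b, 'n) cat_scheme \<Rightarrow>
    (('o, 'a, 'p, 'b) ftor, (('o, 'a, 'p, 'b) ftor, 'o \<Rightarrow> 'b) arrow) cat" where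
  "fun_cat C D =
    \<lparr>Obj = {F. is_additive_functor C D F},
     Arr = {Arrow F G \<tau> | F G \<tau>. is_additive_functor C D F \<and> is_additive_functor C D G \<and>
              nat_trans C D F G \<tau> \<and> \<tau> \<in> extensional (Obj C)},
     Dom = source, Cod = target,
     Ident = (\<lambda>F. Arrow F F (\<lambda>X\<in>Obj C. Ident D (omap F X))),
     Comp = (\<lambda>\<tau> \<sigma>. Arrow (source \<sigma>) (target \<tau>) (\<lambda>X\<in>Obj C. body \<tau> X \<cdot>\<^bsub>D\<^esub> body \<sigma> X)),
     Add = (\<lambda>\<sigma> \<tau>. Arrow (source \<sigma>) (target \<sigma>) (\<lambda>X\<in>Obj C. body \<sigma> X \<boxplus>\<^bsub>D\<^esub> body \<tau> X)),
     Zero = (\<lambda>F G. Arrow F G (\<lambda>X\<in>Obj C. Zero D (omap F X) (omap G X)))\<rparr>"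

type_synonym ('o, 'u) abftor = "('o, 'u, 'u monoid, ('u monoid, 'u \<Rightarrow> 'u) arrow) ftor"
type_synonym ('o, 'u) abtrans = "(('o, 'u) abftor, 'o \<Rightarrow> ('u monoid, 'u \<Rightarrow> 'u) arrow) arrow"

abbreviation AbFun :: "('o, 'u, 'm) cat_scheme \<Rightarrow> (('o, 'u) abftor, ('o, 'u) abtrans) cat" where
  "AbFun C \<equiv> fun_cat C Ab"

abbreviation Mod_cat :: "('o, 'u, 'm) cat_scheme \<Rightarrow> (('o, 'u) abftor, ('o, 'u) abtrans) cat" where
  "Mod_cat C \<equiv> fun_cat (op C) Ab"

text \<open>\<open>hom_ftor C X\<close> is the functor \<open>Hom\<^sub>C(X,-)\<close> and \<open>hom_trans C K f\<close> is the transformation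
  \<open>Hom\<^sub>C(f,-)\<close> between restrictions of such functors to a full subcategory with object set \<open>K\<close>
  (the functors themselves need no adjustment, since the values of a functor outside its source
  category are irrelevant).\<close>

definition hom_ftor :: "('o, 'u, 'm) cat_scheme \<Rightarrow> 'o \<Rightarrow> ('o, 'u) abftor" where
  "hom_ftor C X = \<lparr>omap = Hom C X,
     amap = (\<lambda>f. Arrow (Hom C X (Dom C f)) (Hom C X (Cod C f))
                   (\<lambda>g\<in>carrier (Hom C X (Dom C f)). f \<cdot>\<^bsub>C\<^esub> g))\<rparr>"

definition hom_trans :: "('o, 'u, 'm) cat_scheme \<Rightarrow> 'o set \<Rightarrow> 'u \<Rightarrow> ('o, 'u) abtrans" where
  "hom_trans C K f = Arrow (hom_ftor C (Cod C f)) (hom_ftor C (Dom C f))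
     (\<lambda>Y\<in>K. Arrow (Hom C (Cod C f) Y) (Hom C (Dom C f) Y)
        (\<lambda>g\<in>carrier (Hom C (Cod C f) Y). g \<cdot>\<^bsub>C\<^esub> f))"

text \<open>The contravariant functor \<open>X \<mapsto> Hom\<^sub>C(X,-)\<close>.\<close>

definition hom_embed :: "('o, 'u, 'm) cat_scheme \<Rightarrow> ('o, 'u, ('o, 'u) abftor, ('o, 'u) abtrans) ftor" where
  "hom_embed C = \<lparr>omap = hom_ftor C, amap = hom_trans C (Obj C)\<rparr>"

definition finitely_presented :: "('o, 'u, 'm) cat_scheme \<Rightarrow> ('o, 'u) abftor \<Rightarrow> bool" where
  "finitely_presented C F \<longleftrightarrow>
     (\<exists>f\<in>Arr C. \<exists>p. is_cokernel (AbFun C) p (hom_trans C (Obj C) f) \<and> target p = F)"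

definition fp_cat :: "('o, 'u, 'm) cat_scheme \<Rightarrow> (('o, 'u) abftor, ('o, 'u) abtrans) cat" where
  "fp_cat C = full_sub (AbFun C) {F. finitely_presented C F}"


section \<open>Triangulated categories\<close>

text \<open>A triangle \<open>X \<rightarrow> Y \<rightarrow> Z \<rightarrow> \<Sigma>X\<close> is recorded by its three maps.\<close>

record ('o, 'a) tricat = "('o, 'a) cat" +
  Shift :: "('o, 'a, 'o, 'a) ftor" ("\<Sigma>\<index>")
  Tri :: "('a \<times> 'a \<times> 'a) set"

locale triangulated = additive_category T for T :: "('o, 'a, 'm) tricat_scheme" (structure) +
  assumes shift_additive: "is_additive_functor T T \<Sigma>"
    and shift_equivalence: "is_equivalence T T \<Sigma>"
    and tri_shape: "(f, g, h) \<in> Tri T \<Longrightarrow>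
       \<exists>X Y Z. \<guillemotleft>f : X \<rightarrow> Y\<guillemotright> \<and> \<guillemotleft>g : Y \<rightarrow> Z\<guillemotright> \<and> \<guillemotleft>h : Z \<rightarrow> omap \<Sigma> X\<guillemotright>"
    and tri_ident: "\<lbrakk>X \<in> Obj T; is_zero T Z\<rbrakk> \<Longrightarrow> (Ident T X, Zero T X Z, Zero T Z (omap \<Sigma> X)) \<in> Tri T"
    and tri_iso: "\<lbrakk>(f, g, h) \<in> Tri T; is_iso T a (Dom T f) X; is_iso T b (Dom T g) Y; is_iso T c (Dom T h) Z;
       \<guillemotleft>f' : X \<rightarrow> Y\<guillemotright>; \<guillemotleft>g' : Y \<rightarrow> Z\<guillemotright>; \<guillemotleft>h' : Z \<rightarrow> omap \<Sigma> X\<guillemotright>;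
       f' \<cdot> a = b \<cdot> f; g' \<cdot> b = c \<cdot> g; h' \<cdot> c = amap \<Sigma> a \<cdot> h\<rbrakk> \<Longrightarrow> (f', g', h') \<in> Tri T"
    and tri_complete: "f \<in> Arr T \<Longrightarrow> \<exists>g h. (f, g, h) \<in> Tri T"
    and tri_rotate: "\<lbrakk>\<guillemotleft>f : X \<rightarrow> Y\<guillemotright>; \<guillemotleft>g : Y \<rightarrow> Z\<guillemotright>; \<guillemotleft>h : Z \<rightarrow> omap \<Sigma> X\<guillemotright>\<rbrakk> \<Longrightarrow>
       (f, g, h) \<in> Tri T \<longleftrightarrow> (g, h, neg T (amap \<Sigma> f)) \<in> Tri T"
    and tri_morphism: "\<lbrakk>(f, g, h) \<in> Tri T; (f', g', h') \<in> Tri T;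
       \<guillemotleft>a : Dom T f \<rightarrow> Dom T f'\<guillemotright>; \<guillemotleft>b : Dom T g \<rightarrow> Dom T g'\<guillemotright>; b \<cdot> f = f' \<cdot> a\<rbrakk> \<Longrightarrow>
       \<exists>c. \<guillemotleft>c : Dom T h \<rightarrow> Dom T h'\<guillemotright> \<and> c \<cdot> g = g' \<cdot> b \<and> amap \<Sigma> a \<cdot> h = h' \<cdot> c"
    and octahedral: "\<lbrakk>\<guillemotleft>f : X \<rightarrow> Y\<guillemotright>; \<guillemotleft>g : Y \<rightarrow> Z\<guillemotright>;
       (f, f', f'') \<in> Tri T; (g \<cdot> f, h', h'') \<in> Tri T; (g, g', g'') \<in> Tri T\<rbrakk> \<Longrightarrow>
       \<exists>u v. (u, v, amap \<Sigma> f' \<cdot> g'') \<in> Tri T \<and>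
          \<guillemotleft>u : Dom T f'' \<rightarrow> Dom T h''\<guillemotright> \<and> \<guillemotleft>v : Dom T h'' \<rightarrow> Dom T g''\<guillemotright> \<and>
          u \<cdot> f' = h' \<cdot> g \<and> v \<cdot> h' = g' \<and> h'' \<cdot> u = f'' \<and> g'' \<cdot> v = amap \<Sigma> f \<cdot> h''"

text \<open>An object is compact if \<open>\<Oplus>\<^sub>i Hom(K, X\<^sub>i) \<rightarrow> Hom(K, \<Oplus>\<^sub>i X\<^sub>i)\<close> is always an isomorphism.
  Index sets are small subsets of \<open>'u\<close>, which up to bijection are all small sets.\<close>

definition is_compact :: "('o, 'u, 'm) cat_scheme \<Rightarrow> 'o \<Rightarrow> bool" where
  "is_compact T K \<longleftrightarrow> K \<in> Obj T \<and>
     (\<forall>(I :: 'u set) X P \<iota>. small TYPE('u) I \<and> (\<forall>i\<in>I. X i \<in> Obj T) \<and> is_coproduct T I X P \<iota> \<longrightarrow>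
        (\<lambda>x. gfinprod (Hom T K P) (\<lambda>i. \<iota> i \<cdot>\<^bsub>T\<^esub> x i) I)
          \<in> iso (sum_group I (\<lambda>i. Hom T K (X i))) (Hom T K P))"

definition compacts :: "('o, 'u, 'm) cat_scheme \<Rightarrow> ('o, 'u) cat" where
  "compacts T = full_sub T {K. is_compact T K}"

text \<open>Compact generation: the compact objects are essentially small and detect zero objects.\<close>

locale compactly_generated = triangulated T for T :: "('o, 'u, 'm) tricat_scheme" (structure) +
  assumes locally_small: "\<lbrakk>X \<in> Obj T; Y \<in> Obj T\<rbrakk> \<Longrightarrow> small TYPE('u) (carrier (Hom T X Y))"
    and coproducts: "\<lbrakk>small TYPE('u) (I :: 'u set); \<And>i. i \<in> I \<Longrightarrow> F i \<in> Obj T\<rbrakk> \<Longrightarrow> \<exists>P \<iota>. is_coproduct T I F P \<iota>"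
    and compacts_essentially_small:
      "\<exists>S \<subseteq> Obj (compacts T). small TYPE('u) S \<and> (\<forall>K\<in>Obj (compacts T). \<exists>K'\<in>S. isomorphic T K K')"
    and compacts_generate:
      "\<lbrakk>X \<in> Obj T; \<And>K. K \<in> Obj (compacts T) \<Longrightarrow> carrier (Hom T K X) = {Zero T K X}\<rbrakk> \<Longrightarrow> is_zero T X"

text \<open>\<open>restricted_yoneda T X\<close> is \<open>Hom\<^sub>T(-,X)\<close> restricted to the compact objects, and
  \<open>restricted_yoneda_map T f\<close> is the induced transformation; they live in \<open>Mod_cat (compacts T)\<close>.\<close>

abbreviation restricted_yoneda :: "('o, 'u, 'm) cat_scheme \<Rightarrow> 'o \<Rightarrow> ('o, 'u) abftor" where
  "restricted_yoneda T X \<equiv> hom_ftor (op T) X"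

abbreviation restricted_yoneda_map :: "('o, 'u, 'm) cat_scheme \<Rightarrow> 'u \<Rightarrow> ('o, 'u) abtrans" where
  "restricted_yoneda_map T f \<equiv> hom_trans (op T) (Obj (compacts T)) f"

definition pure_mono :: "('o, 'u, 'm) tricat_scheme \<Rightarrow> 'u \<Rightarrow> bool" where
  "pure_mono T f \<longleftrightarrow> (\<exists>g h. (f, g, h) \<in> Tri T \<and>
     short_exact (Mod_cat (compacts T)) (restricted_yoneda_map T f) (restricted_yoneda_map T g))"

definition pure_injective :: "('o, 'u, 'm) tricat_scheme \<Rightarrow> 'o \<Rightarrow> bool" where
  "pure_injective T X \<longleftrightarrow> X \<in> Obj T \<and> is_injective (Mod_cat (compacts T)) (restricted_yoneda T X)"

text \<open>Exact (triangulated) contravariant functors.  The shift of the opposite category is inverse to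
  \<open>\<Sigma>\<close>, so compatibility with shifts is a natural isomorphism \<open>\<theta>\<^sub>X : QX \<cong> \<Sigma>Q\<Sigma>X\<close>.  As \<open>\<theta>\<close> may be replaced by
  its negative, the sign convention for triangles in the opposite category does not matter.\<close>

definition is_contra_exact ::
    "('t, 'a, 'm) tricat_scheme \<Rightarrow> ('s, 'b, 'n) tricat_scheme \<Rightarrow> ('t, 'a, 's, 'b) ftor \<Rightarrow> bool" where
  "is_contra_exact T U Q \<longleftrightarrow> is_additive_functor (op T) U Q \<and>
     (\<exists>\<theta>. nat_iso (op T) U Q (\<Sigma>\<^bsub>U\<^esub> \<circ>\<^sub>F Q \<circ>\<^sub>F \<Sigma>\<^bsub>T\<^esub>) \<theta> \<and>
        (\<forall>f g h. (f, g, h) \<in> Tri T \<longrightarrow>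
           (amap Q g, amap Q f, amap \<Sigma>\<^bsub>U\<^esub> (amap Q h) \<cdot>\<^bsub>U\<^esub> \<theta> (Dom T f)) \<in> Tri U))"


section \<open>Duality triples\<close>

definition coproducts_to_products ::
    "('t, 'u, 'm) cat_scheme \<Rightarrow> ('s, 'u, 'n) cat_scheme \<Rightarrow> ('t, 'u, 's, 'u) ftor \<Rightarrow> bool" where
  "coproducts_to_products T U Q \<longleftrightarrow>
     (\<forall>(I :: 'u set) X P \<iota>. small TYPE('u) I \<and> (\<forall>i\<in>I. X i \<in> Obj T) \<and> is_coproduct T I X P \<iota> \<longrightarrow>
        (\<exists>\<pi>. is_product U I (\<lambda>i. omap Q (X i)) (omap Q P) \<pi>))"

locale duality_triple =
  T: compactly_generated T + U: compactly_generated U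
  for T :: "('t, 'u, 'm) tricat_scheme" and U :: "('s, 'u, 'n) tricat_scheme" +
  fixes Q\<^sub>T :: "('t, 'u, 's, 'u) ftor" and Q\<^sub>U :: "('s, 'u, 't, 'u) ftor"
  assumes Q_exact: "is_contra_exact T U Q\<^sub>T" "is_contra_exact U T Q\<^sub>U"
    and Q_pure_injective: "X \<in> Obj T \<Longrightarrow> pure_injective U (omap Q\<^sub>T X)"
      "Y \<in> Obj U \<Longrightarrow> pure_injective T (omap Q\<^sub>U Y)"
    and Q_unit: "\<exists>i\<^sub>T i\<^sub>U.
       nat_trans T T id_ftor (Q\<^sub>U \<circ>\<^sub>F Q\<^sub>T) i\<^sub>T \<and> (\<forall>X\<in>Obj T. pure_mono T (i\<^sub>T X)) \<and>
       nat_trans U U id_ftor (Q\<^sub>T \<circ>\<^sub>F Q\<^sub>U) i\<^sub>U \<and> (\<forall>Y\<in>Obj U. pure_mono U (i\<^sub>U Y)) \<and>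
       (\<forall>X\<in>Obj T. amap Q\<^sub>T (i\<^sub>T X) \<cdot>\<^bsub>U\<^esub> i\<^sub>U (omap Q\<^sub>T X) = Ident U (omap Q\<^sub>T X)) \<and>
       (\<forall>Y\<in>Obj U. amap Q\<^sub>U (i\<^sub>U Y) \<cdot>\<^bsub>T\<^esub> i\<^sub>T (omap Q\<^sub>U Y) = Ident T (omap Q\<^sub>U Y))"
    and Q_coproducts: "coproducts_to_products T U Q\<^sub>T" "coproducts_to_products U T Q\<^sub>U"

definition QZ :: "rat set monoid" where
  "QZ = \<lparr>carrier = UNIV, monoid.mult = (+), one = 0\<rparr> Mod \<int>"

text \<open>Isomorphisms \<open>Hom\<^sub>\<int>(Hom\<^sub>T(K,X), \<rat>/\<int>) \<cong> Hom\<^sub>U(DK, QX)\<close>, natural in \<open>K\<close> compact and in \<open>X\<close>.\<close>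

definition character_duality :: "('t, 'u, 'm) cat_scheme \<Rightarrow> ('s, 'u, 'n) cat_scheme \<Rightarrow>
    ('t, 'u, 's, 'u) ftor \<Rightarrow> ('t, 'u, 's, 'u) ftor \<Rightarrow> bool" where
  "character_duality T U Q D \<longleftrightarrow> (\<exists>\<Phi>.
     (\<forall>K\<in>Obj (compacts T). \<forall>X\<in>Obj T.
        \<Phi> K X \<in> iso (hom_group (Hom T K X) QZ) (Hom U (omap D K) (omap Q X))) \<and>
     (\<forall>K K' u. \<guillemotleft>u : K \<rightarrow>\<^bsub>compacts T\<^esub> K'\<guillemotright> \<longrightarrow> (\<forall>X\<in>Obj T. \<forall>\<chi>\<in>carrier (hom_group (Hom T K X) QZ).
        \<Phi> K' X (\<lambda>f\<in>carrier (Hom T K' X). \<chi> (f \<cdot>\<^bsub>T\<^esub> u)) = \<Phi> K X \<chi> \<cdot>\<^bsub>U\<^esub> amap D u)) \<and>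
     (\<forall>X X' v. \<guillemotleft>v : X \<rightarrow>\<^bsub>T\<^esub> X'\<guillemotright> \<longrightarrow> (\<forall>K\<in>Obj (compacts T). \<forall>\<chi>\<in>carrier (hom_group (Hom T K X') QZ).
        \<Phi> K X (\<lambda>f\<in>carrier (Hom T K X). \<chi> (v \<cdot>\<^bsub>T\<^esub> f)) = amap Q v \<cdot>\<^bsub>U\<^esub> \<Phi> K X' \<chi>)))"

locale agj_duality_triple = duality_triple T U Q\<^sub>T Q\<^sub>U
  for T :: "('t, 'u, 'm) tricat_scheme" and U :: "('s, 'u, 'n) tricat_scheme" and Q\<^sub>T and Q\<^sub>U +
  fixes D\<^sub>T :: "('t, 'u, 's, 'u) ftor" and D\<^sub>U :: "('s, 'u, 't, 'u) ftor"
  assumes D_functor: "is_functor (op (compacts T)) (compacts U) D\<^sub>T"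
      "is_functor (op (compacts U)) (compacts T) D\<^sub>U"
    and D_adjoint_equivalence: "\<exists>\<eta> \<epsilon>.
       nat_iso (compacts T) (compacts T) id_ftor (D\<^sub>U \<circ>\<^sub>F D\<^sub>T) \<eta> \<and>
       nat_iso (compacts U) (compacts U) id_ftor (D\<^sub>T \<circ>\<^sub>F D\<^sub>U) \<epsilon> \<and>
       (\<forall>X\<in>Obj (compacts T). amap D\<^sub>T (\<eta> X) \<cdot>\<^bsub>U\<^esub> \<epsilon> (omap D\<^sub>T X) = Ident U (omap D\<^sub>T X)) \<and>
       (\<forall>Y\<in>Obj (compacts U). amap D\<^sub>U (\<epsilon> Y) \<cdot>\<^bsub>T\<^esub> \<eta> (omap D\<^sub>U Y) = Ident T (omap D\<^sub>U Y))"
    and character_dualities: "character_duality T U Q\<^sub>T D\<^sub>T" "character_duality U T Q\<^sub>U D\<^sub>U"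


section \<open>The functor \<open>\<delta>\<close>\<close>

text \<open>A group of natural transformations is not literally carried by a subset of \<open>'u\<close>; it is small
  when the source is essentially small, and is then moved into \<open>'u\<close> along a chosen
  injection \<open>encode A\<close> of its carrier.  If no injection exists, these constants are meaningless.\<close>

definition encode :: "('x, 'm) monoid_scheme \<Rightarrow> 'x \<Rightarrow> 'u" where
  "encode A = (SOME e. inj_on e (carrier A))"

definition decode :: "('x, 'm) monoid_scheme \<Rightarrow> 'u \<Rightarrow> 'x" where
  "decode A = inv_into (carrier A) (encode A)"

definition small_copy :: "('x, 'm) monoid_scheme \<Rightarrow> 'u monoid" where
  "small_copy A = \<lparr>carrier = encode A ` carrier A,
                   monoid.mult = (\<lambda>x y. encode A (decode A x \<otimes>\<^bsub>A\<^esub> decode A y)),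
                   one = encode A \<one>\<^bsub>A\<^esub>\<rparr>"

definition small_copy_map :: "('x, 'm) monoid_scheme \<Rightarrow> ('y, 'n) monoid_scheme \<Rightarrow> ('x \<Rightarrow> 'y) \<Rightarrow>
    ('u monoid, 'u \<Rightarrow> 'u) arrow" where
  "small_copy_map A B f = Arrow (small_copy A) (small_copy B)
     (\<lambda>x\<in>carrier (small_copy A). encode B (f (decode A x)))"

text \<open>For categories \<open>C\<close>, \<open>C'\<close> (to be \<open>T\<^sup>c\<close>, \<open>U\<^sup>c\<close>) and \<open>D\<close> a contravariant functor from \<open>C'\<close> to \<open>C\<close>,
  \<open>(\<delta> G)(Y) = Hom(G, Hom\<^sub>C(D Y, -))\<close>.\<close>

definition delta_obj :: "('t, 'u, 'm) cat_scheme \<Rightarrow> ('s, 'u, 'n) cat_scheme \<Rightarrow> ('s, 'u, 't, 'u) ftor \<Rightarrow>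
    ('t, 'u) abftor \<Rightarrow> ('s, 'u) abftor" where
  "delta_obj C C' D G = \<lparr>
     omap = (\<lambda>Y. small_copy (Hom (AbFun C) G (hom_ftor C (omap D Y)))),
     amap = (\<lambda>v. small_copy_map
        (Hom (AbFun C) G (hom_ftor C (omap D (Dom C' v))))
        (Hom (AbFun C) G (hom_ftor C (omap D (Cod C' v))))
        (\<lambda>\<sigma>. hom_trans C (Obj C) (amap D v) \<cdot>\<^bsub>AbFun C\<^esub> \<sigma>))\<rparr>"

definition delta :: "('t, 'u, 'm) cat_scheme \<Rightarrow> ('s, 'u, 'n) cat_scheme \<Rightarrow> ('s, 'u, 't, 'u) ftor \<Rightarrow>
    (('t, 'u) abftor, ('t, 'u) abtrans, ('s, 'u) abftor, ('s, 'u) abtrans) ftor" where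
  "delta C C' D = \<lparr>
     omap = (\<lambda>G. delta_obj C C' D G),
     amap = (\<lambda>\<tau>. Arrow (delta_obj C C' D (target \<tau>)) (delta_obj C C' D (source \<tau>))
        (\<lambda>Y\<in>Obj C'. small_copy_map
           (Hom (AbFun C) (target \<tau>) (hom_ftor C (omap D Y)))
           (Hom (AbFun C) (source \<tau>) (hom_ftor C (omap D Y)))
           (\<lambda>\<sigma>. \<sigma> \<cdot>\<^bsub>AbFun C\<^esub> \<tau>)))\<rparr>"

end

theory Submission
  imports Defs
begin

text \<open>Write \<open>C\<close>, \<open>C'\<close> for the categories of compact objects.  By the adjunction \<open>Hom(D'Y, X) \<cong> Hom(DX, Y)\<close> and
  Yoneda, \<open>\<delta> Hom(X,-) \<cong> Hom(DX,-)\<close>.  There is a natural evaluation \<open>F \<rightarrow> \<delta>\<^sup>2 F\<close>, sending \<open>x \<in> F(X)\<close> to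
  \<open>\<sigma> \<mapsto> \<sigma>(x)\<close> up to this adjunction.  If \<open>F\<close> is the cokernel of \<open>Hom(f,-)\<close>, complete \<open>Df\<close> to a triangle
  \<open>DB \<rightarrow> DA \<rightarrow> Z \<rightarrow> \<Sigma>DB\<close> with maps \<open>Df\<close>, \<open>g\<close>, \<open>h\<close>, which lies in \<open>C'\<close> because compact objects are closed under
  shifts and cones.  As \<open>Hom(-,Y)\<close> is cohomological, \<open>\<delta> F\<close> is the kernel of \<open>Hom(Df,-)\<close> and hence the cokernel
  of \<open>Hom(h,-)\<close>; as \<open>Hom(DX,-)\<close> is homological, evaluation is bijective: it turns \<open>u : A \<rightarrow> X\<close> into
  \<open>g \<circ> Du\<close>, and the maps \<open>DX \<rightarrow> Z\<close> killed by \<open>h\<close> are exactly those factoring through \<open>g\<close>.  So \<open>\<delta>\<close> is an additive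
  equivalence on finitely presented functors, and these preserve kernels and cokernels.\<close>

section \<open>Small sets\<close>

text \<open>The group (\<delta> F)(Y) consists of natural transformations and has to be recoded
  inside \<open>'u\<close>; bounding the set of transformations between two functors is where the
  skeleton of the compact objects and the closure of the universe under powers and unions enter. A
  cokernel in the functor category is known only by its universal property, while the argument works
  with elements; quotient functors serve as test objects showing that such cokernels are formed
  objectwise. \<open>D\<close> is given as a mere functor, so its additivity is derived from
  fullness, faithfulness and biproducts. Compactness is defined by infinite direct sums of groups,
  which are awkward to combine with triangles; a finite support condition on single maps replaces
  it. Of a triangle only the weak kernel and weak cokernel properties are kept: they do not mention
  the shift and pass to the full subcategory of compact objects. The dual pair formed by
  \<open>C\<close> and \<open>C'\<close> is symmetric, so each statement about \<delta> is proved
  once and used in both directions.\<close>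

lemma small_lepoll:
  assumes "small U A" "B \<lesssim> A" shows "small U B"
  using assms unfolding small_def by (meson lesspoll_trans1)

lemma small_image: "small U A \<Longrightarrow> small U (f ` A)"
  by (rule small_lepoll[OF _ image_lepoll])

lemma small_inj:
  assumes "small TYPE('u) A"
  obtains e :: "'x \<Rightarrow> 'u" where "inj_on e A"
  using assms unfolding small_def lesspoll_def lepoll_def by blast

text \<open>The closure axiom speaks of subsets of \<open>'u\<close> only. An injection moves
  \<open>A\<close> there and induces an injection of power sets, which brings the bound
  back.\<close>

lemma small_Pow:
  fixes A :: "'x set"
  assumes "universe TYPE('u)" "small TYPE('u) A"
  shows "small TYPE('u) (Pow A)"
proof -
  obtain e :: "'x \<Rightarrow> 'u" where e: "inj_on e A" by (rule small_inj[OF assms(2)])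
  have "small TYPE('u) (Pow (e ` A))"
    using assms small_image[OF assms(2)] unfolding universe_def by blast
  moreover have "inj_on ((`) e) (Pow A)"
    using e by (rule inj_on_image_Pow)
  then have "Pow A \<lesssim> Pow (e ` A)"
    unfolding lepoll_def by (intro exI[of _ "(`) e"]) auto
  ultimately show ?thesis by (rule small_lepoll)
qed

text \<open>A finite type with \<open>n\<close> elements is no strong limit, since \<open>n \<le> 2 ^ (n - 1)\<close>.\<close>

lemma universe_infinite:
  assumes "universe TYPE('u)"
  shows "infinite (UNIV :: 'u set)"
proof
  assume fin: "finite (UNIV :: 'u set)"
  \<comment> \<open>\<open>undefined\<close> is just some point. What remains has one element less,
    hence is small, yet its power set is not smaller than the universe.\<close>
  let ?A = "UNIV - {undefined} :: 'u set"
  have "card ?A < card (UNIV :: 'u set)"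
    using fin by (intro psubset_card_mono) auto
  then have "\<not> ?A \<approx> (UNIV :: 'u set)"
    using fin by (auto simp: eqpoll_iff_card)
  then have "small TYPE('u) ?A"
    unfolding small_def lesspoll_def by (simp add: subset_imp_lepoll)
  then have "small TYPE('u) (Pow ?A)"
    using assms by (simp add: universe_def)
  then have le: "Pow ?A \<lesssim> (UNIV :: 'u set)" and ne: "\<not> Pow ?A \<approx> (UNIV :: 'u set)"
    unfolding small_def lesspoll_def by auto
  have "card (Pow ?A) \<le> card (UNIV :: 'u set)"
    using le fin lepoll_iff_card_le[of "Pow ?A" "UNIV :: 'u set"] by auto
  moreover have "card (Pow ?A) \<noteq> card (UNIV :: 'u set)"
    using ne fin eqpoll_iff_card[of "Pow ?A" "UNIV :: 'u set"] by auto
  moreover have "card (UNIV :: 'u set) = Suc (card ?A)"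
    using fin by (metis UNIV_I card.remove)
  moreover have "card (Pow ?A) = 2 ^ card ?A"
    using fin by (simp add: card_Pow)
  moreover have "Suc (card ?A) \<le> 2 ^ card ?A"
    by (simp add: Suc_leI)
  ultimately show False by linarith
qed

text \<open>Since \<open>'u\<close> is infinite, pairs of its elements can be coded in
  \<open>'u\<close>. The disjoint union becomes an ordinary union of small subsets of
  \<open>'u\<close> over a small index set, which regularity covers.\<close>

lemma small_Sigma:
  fixes S :: "'s set" and F :: "'s \<Rightarrow> 'x set"
  assumes U: "universe TYPE('u)" and S: "small TYPE('u) S"
    and F: "\<And>s. s \<in> S \<Longrightarrow> small TYPE('u) (F s)"
  shows "small TYPE('u) (Sigma S F)"
proof -
  obtain e :: "'s \<Rightarrow> 'u" where e: "inj_on e S" by (rule small_inj[OF S])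
  have "\<forall>s\<in>S. \<exists>k :: 'x \<Rightarrow> 'u. inj_on k (F s)" by (meson F small_inj)
  then obtain k :: "'s \<Rightarrow> 'x \<Rightarrow> 'u" where k: "\<And>s. s \<in> S \<Longrightarrow> inj_on (k s) (F s)" by metis
  have "(UNIV :: 'u set) \<times> (UNIV :: 'u set) \<approx> (UNIV :: 'u set)"
    unfolding eqpoll_iff_card_of_ordIso
    by (rule card_of_Times_same_infinite[OF universe_infinite[OF U]])
  then obtain j :: "'u \<times> 'u \<Rightarrow> 'u" where "bij_betw j (UNIV \<times> UNIV) UNIV"
    unfolding eqpoll_def by blast
  then have j: "inj j" by (simp add: bij_betw_def)
  \<comment> \<open>The fibre over s is indexed by the code \<open>e s\<close>, and tagging each
    element with this code keeps distinct fibres disjoint.\<close>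
  define A where "A i = (\<lambda>x. j (i, k (inv_into S e i) x)) ` F (inv_into S e i)" for i
  have "small TYPE('u) (\<Union>i\<in>e ` S. A i)"
  proof -
    have "small TYPE('u) (A i)" if "i \<in> e ` S" for i
      unfolding A_def using that by (intro small_image F) (rule inv_into_into)
    then show ?thesis
      using U small_image[OF S, of e] unfolding universe_def by blast
  qed
  moreover have "Sigma S F \<lesssim> (\<Union>i\<in>e ` S. A i)"
    unfolding lepoll_def
  proof (intro exI conjI)
    show "inj_on (\<lambda>(s, x). j (e s, k s x)) (Sigma S F)"
      using e k by (auto simp: inj_on_def inj_eq[OF j])
    show "(\<lambda>(s, x). j (e s, k s x)) ` Sigma S F \<subseteq> (\<Union>i\<in>e ` S. A i)"
      using e by (auto simp: A_def)
  qed
  ultimately show ?thesis by (rule small_lepoll)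
qed


section \<open>Preadditive categories\<close>

lemma in_hom_iff: "f \<in> carrier (Hom C X Y) \<longleftrightarrow> f \<in> Arr C \<and> Dom C f = X \<and> Cod C f = Y"
  by (simp add: Hom_def)

lemma mult_Hom [simp]: "monoid.mult (Hom C X Y) = Add C"
  and one_Hom [simp]: "one (Hom C X Y) = Zero C X Y"
  by (simp_all add: Hom_def)

lemma op_simps [simp]:
  "Obj (op C) = Obj C" "Arr (op C) = Arr C" "Dom (op C) = Cod C" "Cod (op C) = Dom C"
  "Ident (op C) = Ident C" "Comp (op C) g f = Comp C f g" "Add (op C) = Add C"
  "Zero (op C) X Y = Zero C Y X"
  by (simp_all add: op_def)

lemma Hom_op [simp]: "Hom (op C) X Y = Hom C Y X"
  by (auto simp: Hom_def)

text \<open>Restricted to bare \<open>cat\<close> records, since \<open>op\<close> drops record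
  extensions such as the shift and the triangles.\<close>

lemma op_op [simp]: "op (op C) = C" for C :: "('o, 'a) cat"
  by (simp add: op_def)

lemma full_sub_simps [simp]:
  "Obj (full_sub C S) = Obj C \<inter> S" "Dom (full_sub C S) = Dom C" "Cod (full_sub C S) = Cod C"
  "Ident (full_sub C S) = Ident C" "Comp (full_sub C S) = Comp C" "Add (full_sub C S) = Add C"
  "Zero (full_sub C S) = Zero C"
  by (simp_all add: full_sub_def)

lemma in_hom_full_sub:
  "f \<in> carrier (Hom (full_sub C S) X Y) \<longleftrightarrow> \<guillemotleft>f : X \<rightarrow>\<^bsub>C\<^esub> Y\<guillemotright> \<and> X \<in> S \<and> Y \<in> S"
  by (auto simp: in_hom_iff full_sub_def)

lemma Hom_full_sub: "X \<in> S \<Longrightarrow> Y \<in> S \<Longrightarrow> Hom (full_sub C S) X Y = Hom C X Y"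
  by (auto simp: Hom_def full_sub_def)

context preadditive
begin

lemma hom_objs: "\<guillemotleft>f : X \<rightarrow> Y\<guillemotright> \<Longrightarrow> X \<in> Obj C \<and> Y \<in> Obj C"
  using dom_cod by (auto simp: in_hom_iff)

lemma arr_in_hom: "f \<in> Arr C \<Longrightarrow> \<guillemotleft>f : Dom C f \<rightarrow> Cod C f\<guillemotright>"
  by (simp add: in_hom_iff)

lemma comm_group_Hom: "\<guillemotleft>f : X \<rightarrow> Y\<guillemotright> \<Longrightarrow> comm_group (Hom C X Y)"
  using hom_group hom_objs by blast

lemma zero_in_hom: "X \<in> Obj C \<Longrightarrow> Y \<in> Obj C \<Longrightarrow> \<guillemotleft>Zero C X Y : X \<rightarrow> Y\<guillemotright>"
  using monoid.one_closed[OF comm_monoid.axioms(1)[OF comm_group.axioms(1)[OF hom_group]]] by simp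

lemma add_in_hom:
  assumes "\<guillemotleft>f : X \<rightarrow> Y\<guillemotright>" "\<guillemotleft>g : X \<rightarrow> Y\<guillemotright>" shows "\<guillemotleft>f \<boxplus> g : X \<rightarrow> Y\<guillemotright>"
proof -
  interpret comm_group "Hom C X Y" by (rule comm_group_Hom[OF assms(1)])
  show ?thesis using m_closed[OF assms] by simp
qed

lemma comp_left_hom:
  assumes "\<guillemotleft>g : Y \<rightarrow> Z\<guillemotright>" "X \<in> Obj C"
  shows "group_hom (Hom C X Y) (Hom C X Z) (\<lambda>f. g \<cdot> f)"
proof -
  have "comm_group (Hom C X Y)" "comm_group (Hom C X Z)"
    using assms hom_objs hom_group by blast+
  then show ?thesis
    unfolding group_hom_def group_hom_axioms_def comm_group_def
    using assms by (auto intro!: homI comp distrib_left)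
qed

lemma comp_right_hom:
  assumes "\<guillemotleft>f : X \<rightarrow> Y\<guillemotright>" "Z \<in> Obj C"
  shows "group_hom (Hom C Y Z) (Hom C X Z) (\<lambda>g. g \<cdot> f)"
proof -
  have "comm_group (Hom C Y Z)" "comm_group (Hom C X Z)"
    using assms hom_objs hom_group by blast+
  then show ?thesis
    unfolding group_hom_def group_hom_axioms_def comm_group_def
    using assms by (auto intro!: homI comp distrib_right)
qed

lemma comp_zero:
  assumes "\<guillemotleft>g : Y \<rightarrow> Z\<guillemotright>" "X \<in> Obj C" shows "g \<cdot> Zero C X Y = Zero C X Z"
  using group_hom.hom_one[OF comp_left_hom[OF assms]] by simp

lemma zero_comp:
  assumes "\<guillemotleft>f : X \<rightarrow> Y\<guillemotright>" "Z \<in> Obj C" shows "Zero C Y Z \<cdot> f = Zero C X Z"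
  using group_hom.hom_one[OF comp_right_hom[OF assms]] by simp

lemma add_zero:
  assumes "\<guillemotleft>f : X \<rightarrow> Y\<guillemotright>" shows "f \<boxplus> Zero C X Y = f" "Zero C X Y \<boxplus> f = f"
proof -
  interpret comm_group "Hom C X Y" by (rule comm_group_Hom[OF assms])
  show "f \<boxplus> Zero C X Y = f" "Zero C X Y \<boxplus> f = f"
    using r_one[OF assms] l_one[OF assms] by simp_all
qed

lemma preadditive_op: "preadditive (op C)"
proof (rule preadditive.intro)
  fix f g h W X Y Z
  assume "\<guillemotleft>f : W \<rightarrow>\<^bsub>op C\<^esub> X\<guillemotright>" "\<guillemotleft>g : X \<rightarrow>\<^bsub>op C\<^esub> Y\<guillemotright>" "\<guillemotleft>h : Y \<rightarrow>\<^bsub>op C\<^esub> Z\<guillemotright>"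
  then show "(h \<cdot>\<^bsub>op C\<^esub> g) \<cdot>\<^bsub>op C\<^esub> f = h \<cdot>\<^bsub>op C\<^esub> g \<cdot>\<^bsub>op C\<^esub> f"
    using assoc by simp
qed (use dom_cod ident comp ident_left ident_right hom_group distrib_left distrib_right in auto)

lemma preadditive_full_sub: "preadditive (full_sub C S)"
proof (rule preadditive.intro)
  show "comm_group (Hom (full_sub C S) X Y)"
    if "X \<in> Obj (full_sub C S)" "Y \<in> Obj (full_sub C S)" for X Y
    using that hom_group by (simp add: Hom_full_sub)
  show "Dom (full_sub C S) f \<in> Obj (full_sub C S) \<and> Cod (full_sub C S) f \<in> Obj (full_sub C S)"
    if "f \<in> Arr (full_sub C S)" for f
    using that dom_cod by (auto simp: full_sub_def)
  show "(h \<cdot>\<^bsub>full_sub C S\<^esub> g) \<cdot>\<^bsub>full_sub C S\<^esub> f = h \<cdot>\<^bsub>full_sub C S\<^esub> g \<cdot>\<^bsub>full_sub C S\<^esub> f"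
    if "\<guillemotleft>f : W \<rightarrow>\<^bsub>full_sub C S\<^esub> X\<guillemotright>" "\<guillemotleft>g : X \<rightarrow>\<^bsub>full_sub C S\<^esub> Y\<guillemotright>" "\<guillemotleft>h : Y \<rightarrow>\<^bsub>full_sub C S\<^esub> Z\<guillemotright>"
    for W X Y Z f g h
    using that assoc[of f W X g Y h Z] by (simp add: in_hom_full_sub)
qed (use ident comp ident_left ident_right distrib_left distrib_right
      in \<open>auto simp: in_hom_full_sub\<close>)

lemma iso_cancel_right:
  assumes "is_iso C f X Y" "\<guillemotleft>g : Y \<rightarrow> Z\<guillemotright>" "\<guillemotleft>h : Y \<rightarrow> Z\<guillemotright>" "g \<cdot> f = h \<cdot> f"
  shows "g = h"
proof -
  obtain k where k: "\<guillemotleft>f : X \<rightarrow> Y\<guillemotright>" "\<guillemotleft>k : Y \<rightarrow> X\<guillemotright>" "f \<cdot> k = Ident C Y"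
    using assms(1) unfolding is_iso_def by blast
  then show ?thesis
    using assms assoc[OF k(2,1)] ident_right by metis
qed

lemma iso_cancel_left:
  assumes "is_iso C f X Y" "\<guillemotleft>g : Z \<rightarrow> X\<guillemotright>" "\<guillemotleft>h : Z \<rightarrow> X\<guillemotright>" "f \<cdot> g = f \<cdot> h"
  shows "g = h"
proof -
  obtain k where k: "\<guillemotleft>f : X \<rightarrow> Y\<guillemotright>" "\<guillemotleft>k : Y \<rightarrow> X\<guillemotright>" "k \<cdot> f = Ident C X"
    using assms(1) unfolding is_iso_def by blast
  then show ?thesis
    using assms assoc[OF _ k(1,2)] ident_left by metis
qed

end

section \<open>Functors, natural isomorphisms and equivalences\<close>

lemma functor_obj: "is_functor C D F \<Longrightarrow> X \<in> Obj C \<Longrightarrow> omap F X \<in> Obj D"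
  and functor_arr: "is_functor C D F \<Longrightarrow> \<guillemotleft>f : X \<rightarrow>\<^bsub>C\<^esub> Y\<guillemotright> \<Longrightarrow> \<guillemotleft>amap F f : omap F X \<rightarrow>\<^bsub>D\<^esub> omap F Y\<guillemotright>"
  and functor_ident: "is_functor C D F \<Longrightarrow> X \<in> Obj C \<Longrightarrow> amap F (Ident C X) = Ident D (omap F X)"
  and functor_comp: "is_functor C D F \<Longrightarrow> \<guillemotleft>f : X \<rightarrow>\<^bsub>C\<^esub> Y\<guillemotright> \<Longrightarrow> \<guillemotleft>g : Y \<rightarrow>\<^bsub>C\<^esub> Z\<guillemotright> \<Longrightarrow>
     amap F (g \<cdot>\<^bsub>C\<^esub> f) = amap F g \<cdot>\<^bsub>D\<^esub> amap F f"
  unfolding is_functor_def by blast+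

lemma nat_trans_arr: "nat_trans C D F G \<tau> \<Longrightarrow> X \<in> Obj C \<Longrightarrow> \<guillemotleft>\<tau> X : omap F X \<rightarrow>\<^bsub>D\<^esub> omap G X\<guillemotright>"
  and nat_trans_square: "nat_trans C D F G \<tau> \<Longrightarrow> \<guillemotleft>f : X \<rightarrow>\<^bsub>C\<^esub> Y\<guillemotright> \<Longrightarrow>
     amap G f \<cdot>\<^bsub>D\<^esub> \<tau> X = \<tau> Y \<cdot>\<^bsub>D\<^esub> amap F f"
  unfolding nat_trans_def by blast+

definition inv_arr :: "('o, 'a, 'm) cat_scheme \<Rightarrow> 'a \<Rightarrow> 'a" where
  "inv_arr C f = (SOME g. \<guillemotleft>g : Cod C f \<rightarrow>\<^bsub>C\<^esub> Dom C f\<guillemotright> \<and>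
     g \<cdot>\<^bsub>C\<^esub> f = Ident C (Dom C f) \<and> f \<cdot>\<^bsub>C\<^esub> g = Ident C (Cod C f))"

lemma inv_arr:
  assumes "is_iso C f X Y"
  shows "\<guillemotleft>inv_arr C f : Y \<rightarrow>\<^bsub>C\<^esub> X\<guillemotright>" "inv_arr C f \<cdot>\<^bsub>C\<^esub> f = Ident C X" "f \<cdot>\<^bsub>C\<^esub> inv_arr C f = Ident C Y"
proof -
  have "\<exists>g. \<guillemotleft>g : Cod C f \<rightarrow>\<^bsub>C\<^esub> Dom C f\<guillemotright> \<and> g \<cdot>\<^bsub>C\<^esub> f = Ident C (Dom C f) \<and> f \<cdot>\<^bsub>C\<^esub> g = Ident C (Cod C f)"
    using assms by (auto simp: is_iso_def in_hom_iff)
  from someI_ex[OF this]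
  show "\<guillemotleft>inv_arr C f : Y \<rightarrow>\<^bsub>C\<^esub> X\<guillemotright>" "inv_arr C f \<cdot>\<^bsub>C\<^esub> f = Ident C X" "f \<cdot>\<^bsub>C\<^esub> inv_arr C f = Ident C Y"
    using assms by (auto simp: is_iso_def in_hom_iff inv_arr_def)
qed

lemma (in preadditive) inv_arr_unique:
  assumes "is_iso C f X Y" "\<guillemotleft>g : Y \<rightarrow> X\<guillemotright>" "g \<cdot> f = Ident C X"
  shows "inv_arr C f = g"
  using iso_cancel_right[OF assms(1) inv_arr(1)[OF assms(1)] assms(2)] inv_arr(2)[OF assms(1)] assms(3) by simp

lemma nat_iso_inverse:
  assumes "preadditive C" "preadditive D" "is_functor C D F" "is_functor C D G" "nat_iso C D F G \<tau>"
  shows "nat_iso C D G F (\<lambda>X. inv_arr D (\<tau> X))"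
proof -
  interpret C: preadditive C by fact
  interpret D: preadditive D by fact
  have tau: "nat_trans C D F G \<tau>" using assms(5) by (simp add: nat_iso_def)
  define \<sigma> where "\<sigma> X = inv_arr D (\<tau> X)" for X
  have s: "\<guillemotleft>\<sigma> X : omap G X \<rightarrow>\<^bsub>D\<^esub> omap F X\<guillemotright>" "\<sigma> X \<cdot>\<^bsub>D\<^esub> \<tau> X = Ident D (omap F X)"
    "\<tau> X \<cdot>\<^bsub>D\<^esub> \<sigma> X = Ident D (omap G X)" if "X \<in> Obj C" for X
    using inv_arr[of D "\<tau> X" "omap F X" "omap G X"] assms(5) that by (auto simp: \<sigma>_def nat_iso_def)
  have "nat_iso C D G F \<sigma>"
    unfolding nat_iso_def nat_trans_def
  proof (intro conjI allI impI ballI)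
    fix X assume X: "X \<in> Obj C"
    show "\<guillemotleft>\<sigma> X : omap G X \<rightarrow>\<^bsub>D\<^esub> omap F X\<guillemotright>" by (rule s(1)[OF X])
    show "is_iso D (\<sigma> X) (omap G X) (omap F X)"
      unfolding is_iso_def using s[OF X] nat_trans_arr[OF tau X] by blast
  next
    fix X Y f assume f: "\<guillemotleft>f : X \<rightarrow>\<^bsub>C\<^esub> Y\<guillemotright>"
    have X: "X \<in> Obj C" and Y: "Y \<in> Obj C" using C.hom_objs[OF f] by auto
    note t = nat_trans_arr[OF tau X] nat_trans_arr[OF tau Y] functor_arr[OF assms(3) f] functor_arr[OF assms(4) f]
      s(1)[OF X] s(1)[OF Y]
    \<comment> \<open>Insert \<open>\<sigma> Y \<cdot> \<tau> Y\<close> in front, move \<tau> across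
      by naturality, and cancel \<open>\<tau> X\<close> against \<open>\<sigma> X\<close>.\<close>
    have "amap F f \<cdot>\<^bsub>D\<^esub> \<sigma> X = (\<sigma> Y \<cdot>\<^bsub>D\<^esub> \<tau> Y) \<cdot>\<^bsub>D\<^esub> (amap F f \<cdot>\<^bsub>D\<^esub> \<sigma> X)"
      by (simp add: s(2)[OF Y] D.ident_left[OF D.comp[OF t(5,3)]])
    also have "\<dots> = \<sigma> Y \<cdot>\<^bsub>D\<^esub> ((\<tau> Y \<cdot>\<^bsub>D\<^esub> amap F f) \<cdot>\<^bsub>D\<^esub> \<sigma> X)"
      by (simp add: D.assoc[OF D.comp[OF t(5,3)] t(2,6)] D.assoc[OF t(5,3,2)])
    also have "\<dots> = \<sigma> Y \<cdot>\<^bsub>D\<^esub> (amap G f \<cdot>\<^bsub>D\<^esub> (\<tau> X \<cdot>\<^bsub>D\<^esub> \<sigma> X))"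
      by (simp add: nat_trans_square[OF tau f, symmetric] D.assoc[OF t(5,1,4)])
    also have "\<dots> = \<sigma> Y \<cdot>\<^bsub>D\<^esub> amap G f"
      by (simp add: s(3)[OF X] D.ident_right[OF t(4)])
    finally show "amap F f \<cdot>\<^bsub>D\<^esub> \<sigma> X = \<sigma> Y \<cdot>\<^bsub>D\<^esub> amap G f" .
  qed
  then show ?thesis by (simp add: \<sigma>_def[abs_def])
qed

lemma is_functor_op: "is_functor C D F \<Longrightarrow> is_functor (op C) (op D) F"
  unfolding is_functor_def by auto

lemma is_functor_id: "is_functor C C id_ftor"
  by (simp add: is_functor_def id_ftor_def)

lemma id_ftor_simps [simp]: "omap id_ftor X = X" "amap id_ftor f = f"
  by (simp_all add: id_ftor_def)

lemma comp_ftor_simps [simp]: "omap (G \<circ>\<^sub>F F) X = omap G (omap F X)" "amap (G \<circ>\<^sub>F F) f = amap G (amap F f)"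
  by (simp_all add: comp_ftor_def)

lemma is_functor_comp: "is_functor C D F \<Longrightarrow> is_functor D E G \<Longrightarrow> is_functor C E (G \<circ>\<^sub>F F)"
  unfolding is_functor_def by simp blast

text \<open>An arrow is recovered from its image:
  \<open>\<eta> Y \<cdot> f = G (F f) \<cdot> \<eta> X\<close>, and the isomorphism
  \<open>\<eta> Y\<close> can be cancelled.\<close>

lemma faithful_if_nat_iso:
  assumes "preadditive C" "nat_iso C C id_ftor (G \<circ>\<^sub>F F) \<eta>"
    and "\<guillemotleft>f : X \<rightarrow>\<^bsub>C\<^esub> Y\<guillemotright>" "\<guillemotleft>g : X \<rightarrow>\<^bsub>C\<^esub> Y\<guillemotright>" "amap F f = amap F g"
  shows "f = g"
proof -
  interpret preadditive C by fact
  have n: "nat_trans C C id_ftor (G \<circ>\<^sub>F F) \<eta>" and i: "is_iso C (\<eta> Y) Y (omap (G \<circ>\<^sub>F F) Y)"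
    using assms(2) hom_objs[OF assms(3)] by (auto simp: nat_iso_def)
  show ?thesis
    using nat_trans_square[OF n assms(3)] nat_trans_square[OF n assms(4)] assms(5)
    by (intro iso_cancel_left[OF i assms(3,4)]) simp
qed

text \<open>Equivalences are defined with isomorphisms from the identity to GF and from FG to the
  identity. Passing to opposite categories reverses both, so the inverse isomorphisms are supplied
  here.\<close>

lemma equivalence_inverse:
  assumes "preadditive C" "preadditive D" "is_equivalence C D F"
  obtains G \<eta> \<epsilon> where "is_functor D C G"
    "nat_iso C C (G \<circ>\<^sub>F F) id_ftor \<eta>" "nat_iso D D id_ftor (F \<circ>\<^sub>F G) \<epsilon>"
proof -
  obtain G \<eta> \<epsilon> where G: "is_functor C D F" "is_functor D C G" "nat_iso C C id_ftor (G \<circ>\<^sub>F F) \<eta>"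
    "nat_iso D D (F \<circ>\<^sub>F G) id_ftor \<epsilon>"
    using assms(3) unfolding is_equivalence_def by blast
  then show thesis
    using that nat_iso_inverse[OF assms(1,1) is_functor_id is_functor_comp[OF G(1,2)] G(3)]
      nat_iso_inverse[OF assms(2,2) is_functor_comp[OF G(2,1)] is_functor_id G(4)] by blast
qed

lemma equivalence_sym:
  assumes "preadditive C" "preadditive D" "is_functor C D F" "is_functor D C G"
    "nat_iso C C id_ftor (G \<circ>\<^sub>F F) \<eta>" "nat_iso D D (F \<circ>\<^sub>F G) id_ftor \<epsilon>"
  shows "is_equivalence D C G"
  unfolding is_equivalence_def
  using assms(3,4) nat_iso_inverse[OF assms(1,1) is_functor_id is_functor_comp[OF assms(3,4)] assms(5)]
    nat_iso_inverse[OF assms(2,2) is_functor_comp[OF assms(4,3)] is_functor_id assms(6)] by blast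

lemma equivalence_faithful:
  assumes "preadditive C" "is_equivalence C D F"
    "\<guillemotleft>f : X \<rightarrow>\<^bsub>C\<^esub> Y\<guillemotright>" "\<guillemotleft>g : X \<rightarrow>\<^bsub>C\<^esub> Y\<guillemotright>" "amap F f = amap F g"
  shows "f = g"
  using assms(2) faithful_if_nat_iso[OF assms(1) _ assms(3-5)] unfolding is_equivalence_def by blast

text \<open>The preimage is the inverse of \<open>\<eta> Y\<close> after \<open>G h\<close> after
  \<open>\<eta> X\<close>. Its image agrees with \<open>h\<close> after applying \<open>G\<close>,
  which is faithful because it is an equivalence as well.\<close>

lemma equivalence_full:
  assumes C: "preadditive C" and D: "preadditive D" and F: "is_equivalence C D F"
    and X: "X \<in> Obj C" and Y: "Y \<in> Obj C" and h: "\<guillemotleft>h : omap F X \<rightarrow>\<^bsub>D\<^esub> omap F Y\<guillemotright>"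
  obtains f where "\<guillemotleft>f : X \<rightarrow>\<^bsub>C\<^esub> Y\<guillemotright>" "amap F f = h"
proof -
  interpret C: preadditive C by fact
  interpret D: preadditive D by fact
  obtain G \<eta> \<epsilon> where G: "is_functor C D F" "is_functor D C G" "nat_iso C C id_ftor (G \<circ>\<^sub>F F) \<eta>"
    "nat_iso D D (F \<circ>\<^sub>F G) id_ftor \<epsilon>"
    using F unfolding is_equivalence_def by blast
  obtain k where k: "\<guillemotleft>k : omap G (omap F Y) \<rightarrow>\<^bsub>C\<^esub> Y\<guillemotright>" "\<eta> Y \<cdot>\<^bsub>C\<^esub> k = Ident C (omap G (omap F Y))"
    using G(3) Y unfolding nat_iso_def is_iso_def by auto
  have n: "nat_trans C C id_ftor (G \<circ>\<^sub>F F) \<eta>" using G(3) by (simp add: nat_iso_def)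
  have e: "\<guillemotleft>\<eta> X : X \<rightarrow>\<^bsub>C\<^esub> omap G (omap F X)\<guillemotright>" "\<guillemotleft>\<eta> Y : Y \<rightarrow>\<^bsub>C\<^esub> omap G (omap F Y)\<guillemotright>"
    using nat_trans_arr[OF n] X Y by auto
  have Gh: "\<guillemotleft>amap G h : omap G (omap F X) \<rightarrow>\<^bsub>C\<^esub> omap G (omap F Y)\<guillemotright>" by (rule functor_arr[OF G(2) h])
  let ?f = "k \<cdot>\<^bsub>C\<^esub> (amap G h \<cdot>\<^bsub>C\<^esub> \<eta> X)"
  have f: "\<guillemotleft>?f : X \<rightarrow>\<^bsub>C\<^esub> Y\<guillemotright>" by (intro C.comp[OF C.comp[OF e(1) Gh] k(1)])
  have Ff: "\<guillemotleft>amap F ?f : omap F X \<rightarrow>\<^bsub>D\<^esub> omap F Y\<guillemotright>" by (rule functor_arr[OF G(1) f])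
  have "amap G (amap F ?f) \<cdot>\<^bsub>C\<^esub> \<eta> X = \<eta> Y \<cdot>\<^bsub>C\<^esub> ?f"
    using nat_trans_square[OF n f] by simp
  also have "\<dots> = amap G h \<cdot>\<^bsub>C\<^esub> \<eta> X"
    using C.assoc[OF C.comp[OF e(1) Gh] k(1) e(2)] k(2) C.ident_left[OF C.comp[OF e(1) Gh]] by simp
  finally have "amap G (amap F ?f) = amap G h"
    using G(3) X by (intro C.iso_cancel_right[OF _ functor_arr[OF G(2) Ff] Gh]) (auto simp: nat_iso_def)
  then have "amap F ?f = h"
    by (rule equivalence_faithful[OF D equivalence_sym[OF C D G] Ff h])
  then show thesis using that f by blast
qed

lemma nat_iso_op: "nat_iso (op A) (op B) P R \<tau> \<longleftrightarrow> nat_iso A B R P \<tau>"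
proof -
  have "is_iso (op B) f X Y \<longleftrightarrow> is_iso B f Y X" for f X Y by (auto simp: is_iso_def)
  then show ?thesis by (auto simp: nat_iso_def nat_trans_def)
qed

text \<open>The two natural isomorphisms change places in the opposite categories.\<close>

lemma is_equivalence_op:
  assumes "preadditive C" "preadditive D" "is_equivalence C D F"
  shows "is_equivalence (op C) (op D) F"
proof -
  obtain G \<eta>' \<epsilon>' where "is_functor D C G"
    "nat_iso C C (G \<circ>\<^sub>F F) id_ftor \<eta>'" "nat_iso D D id_ftor (F \<circ>\<^sub>F G) \<epsilon>'"
    by (rule equivalence_inverse[OF assms])
  moreover have "is_functor C D F" using assms(3) by (simp add: is_equivalence_def)
  ultimately show ?thesis
    unfolding is_equivalence_def
    by (intro conjI exI[of _ G] exI[of _ \<eta>'] exI[of _ \<epsilon>'] is_functor_op) (auto simp: nat_iso_op)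
qed

text \<open>F(0) + F(0) = F(0), and in a group only the unit satisfies this.\<close>

lemma additive_functor_zero:
  assumes "preadditive C" "preadditive D" "is_additive_functor C D F" "X \<in> Obj C" "Y \<in> Obj C"
  shows "amap F (Zero C X Y) = Zero D (omap F X) (omap F Y)"
proof -
  interpret C: preadditive C by fact
  interpret D: preadditive D by fact
  have F: "is_functor C D F" using assms(3) by (simp add: is_additive_functor_def)
  let ?z = "Zero C X Y"
  have z: "\<guillemotleft>?z : X \<rightarrow>\<^bsub>C\<^esub> Y\<guillemotright>" using C.zero_in_hom assms(4,5) .
  have Fz: "\<guillemotleft>amap F ?z : omap F X \<rightarrow>\<^bsub>D\<^esub> omap F Y\<guillemotright>" by (rule functor_arr[OF F z])
  interpret G: comm_group "Hom D (omap F X) (omap F Y)" by (rule D.comm_group_Hom[OF Fz])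
  have "amap F ?z \<boxplus>\<^bsub>D\<^esub> amap F ?z = amap F ?z"
    using assms(3) z C.add_zero(1)[OF z] unfolding is_additive_functor_def by metis
  then show ?thesis using G.l_cancel_one[OF Fz Fz] by simp
qed

text \<open>Fullness and faithfulness carry the universal property to test objects in the image of
  \<open>F\<close>, and every object of \<open>D\<close> is isomorphic to one of these.
  Compatibility with addition enters as preservation of zero morphisms, a condition that reads the
  same for the opposite functor, so that cokernels are covered too.\<close>

lemma equivalence_preserves_kernel:
  assumes C: "preadditive C" and D: "preadditive D" and F: "is_equivalence C D F"
    and zero: "\<And>X Y. X \<in> Obj C \<Longrightarrow> Y \<in> Obj C \<Longrightarrow> amap F (Zero C X Y) = Zero D (omap F X) (omap F Y)"
    and k: "is_kernel C k g"
  shows "is_kernel D (amap F k) (amap F g)"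
proof -
  interpret C: preadditive C by fact
  interpret D: preadditive D by fact
  define K A B where "K = Dom C k" and "A = Dom C g" and "B = Cod C g"
  have kK: "\<guillemotleft>k : K \<rightarrow>\<^bsub>C\<^esub> A\<guillemotright>" and gA: "\<guillemotleft>g : A \<rightarrow>\<^bsub>C\<^esub> B\<guillemotright>"
    and gk: "g \<cdot>\<^bsub>C\<^esub> k = Zero C K B"
    and ker: "\<And>X h. \<guillemotleft>h : X \<rightarrow>\<^bsub>C\<^esub> A\<guillemotright> \<Longrightarrow> g \<cdot>\<^bsub>C\<^esub> h = Zero C X B \<Longrightarrow>
        \<exists>!l. \<guillemotleft>l : X \<rightarrow>\<^bsub>C\<^esub> K\<guillemotright> \<and> k \<cdot>\<^bsub>C\<^esub> l = h"
    using k unfolding is_kernel_def K_def A_def B_def by (auto simp: in_hom_iff)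
  have KAB: "K \<in> Obj C" "A \<in> Obj C" "B \<in> Obj C" using C.hom_objs kK gA by auto
  obtain G \<epsilon> where G: "is_functor C D F" "is_functor D C G" "nat_iso D D (F \<circ>\<^sub>F G) id_ftor \<epsilon>"
    using F unfolding is_equivalence_def by blast
  have Fk: "\<guillemotleft>amap F k : omap F K \<rightarrow>\<^bsub>D\<^esub> omap F A\<guillemotright>" and Fg: "\<guillemotleft>amap F g : omap F A \<rightarrow>\<^bsub>D\<^esub> omap F B\<guillemotright>"
    using functor_arr[OF G(1)] kK gA by auto
  have Fgk: "amap F g \<cdot>\<^bsub>D\<^esub> amap F k = Zero D (omap F K) (omap F B)"
    using functor_comp[OF G(1) kK gA] gk zero KAB by simp
  have main: "\<exists>!l. \<guillemotleft>l : X \<rightarrow>\<^bsub>D\<^esub> omap F K\<guillemotright> \<and> amap F k \<cdot>\<^bsub>D\<^esub> l = h"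
    if h: "\<guillemotleft>h : X \<rightarrow>\<^bsub>D\<^esub> omap F A\<guillemotright>" and gh: "amap F g \<cdot>\<^bsub>D\<^esub> h = Zero D X (omap F B)" for X h
  proof -
    have X: "X \<in> Obj D" using D.hom_objs[OF h] by simp
    \<comment> \<open>The test object \<open>X\<close> is replaced by F(G X) along the isomorphism
      \<open>\<epsilon> X\<close>.\<close>
    let ?X = "omap G X"
    have GX: "?X \<in> Obj C" by (rule functor_obj[OF G(2) X])
    have iso: "is_iso D (\<epsilon> X) (omap F ?X) X" using G(3) X by (simp add: nat_iso_def)
    then obtain \<epsilon>' where e: "\<guillemotleft>\<epsilon> X : omap F ?X \<rightarrow>\<^bsub>D\<^esub> X\<guillemotright>" "\<guillemotleft>\<epsilon>' : X \<rightarrow>\<^bsub>D\<^esub> omap F ?X\<guillemotright>"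
      "\<epsilon> X \<cdot>\<^bsub>D\<^esub> \<epsilon>' = Ident D X"
      unfolding is_iso_def by blast
    obtain h' where h': "\<guillemotleft>h' : ?X \<rightarrow>\<^bsub>C\<^esub> A\<guillemotright>" "amap F h' = h \<cdot>\<^bsub>D\<^esub> \<epsilon> X"
      by (rule equivalence_full[OF C D F GX KAB(2) D.comp[OF e(1) h]])
    \<comment> \<open>Every preimage of \<open>h \<cdot> \<epsilon> X\<close> is annihilated by
      \<open>g\<close>, because its composite with \<open>g\<close> has the same image as the zero
      map.\<close>
    have lift: "g \<cdot>\<^bsub>C\<^esub> m = Zero C ?X B" if m: "\<guillemotleft>m : ?X \<rightarrow>\<^bsub>C\<^esub> A\<guillemotright>" "amap F m = h \<cdot>\<^bsub>D\<^esub> \<epsilon> X" for m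
    proof (rule equivalence_faithful[OF C F C.comp[OF m(1) gA] C.zero_in_hom[OF GX KAB(3)]])
      show "amap F (g \<cdot>\<^bsub>C\<^esub> m) = amap F (Zero C ?X B)"
        using functor_comp[OF G(1) m(1) gA] m(2) D.assoc[OF e(1) h Fg] gh zero[OF GX KAB(3)]
          D.zero_comp[OF e(1)] D.hom_objs[OF Fg] by simp
    qed
    obtain l where l: "\<guillemotleft>l : ?X \<rightarrow>\<^bsub>C\<^esub> K\<guillemotright>" "k \<cdot>\<^bsub>C\<^esub> l = h'"
      and luniq: "\<And>l'. \<guillemotleft>l' : ?X \<rightarrow>\<^bsub>C\<^esub> K\<guillemotright> \<Longrightarrow> k \<cdot>\<^bsub>C\<^esub> l' = h' \<Longrightarrow> l' = l"
      using ker[OF h'(1) lift[OF h']] by blast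
    have Fl: "\<guillemotleft>amap F l : omap F ?X \<rightarrow>\<^bsub>D\<^esub> omap F K\<guillemotright>" by (rule functor_arr[OF G(1) l(1)])
    show ?thesis
    proof (intro ex1I conjI; (elim conjE)?)
      show "\<guillemotleft>amap F l \<cdot>\<^bsub>D\<^esub> \<epsilon>' : X \<rightarrow>\<^bsub>D\<^esub> omap F K\<guillemotright>" by (rule D.comp[OF e(2) Fl])
      have "amap F k \<cdot>\<^bsub>D\<^esub> (amap F l \<cdot>\<^bsub>D\<^esub> \<epsilon>') = (h \<cdot>\<^bsub>D\<^esub> \<epsilon> X) \<cdot>\<^bsub>D\<^esub> \<epsilon>'"
        using functor_comp[OF G(1) l(1) kK] l(2) h'(2) D.assoc[OF e(2) Fl Fk] by simp
      also have "\<dots> = h"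
        using D.assoc[OF e(2,1) h] e(3) D.ident_right[OF h] by simp
      finally show "amap F k \<cdot>\<^bsub>D\<^esub> (amap F l \<cdot>\<^bsub>D\<^esub> \<epsilon>') = h" .
    next
      fix m assume m: "\<guillemotleft>m : X \<rightarrow>\<^bsub>D\<^esub> omap F K\<guillemotright>" "amap F k \<cdot>\<^bsub>D\<^esub> m = h"
      obtain m' where m': "\<guillemotleft>m' : ?X \<rightarrow>\<^bsub>C\<^esub> K\<guillemotright>" "amap F m' = m \<cdot>\<^bsub>D\<^esub> \<epsilon> X"
        by (rule equivalence_full[OF C D F GX KAB(1) D.comp[OF e(1) m(1)]])
      have "k \<cdot>\<^bsub>C\<^esub> m' = h'"
        by (rule equivalence_faithful[OF C F C.comp[OF m'(1) kK] h'(1)])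
          (use functor_comp[OF G(1) m'(1) kK] m'(2) h'(2) D.assoc[OF e(1) m(1) Fk] m(2) in simp)
      then have "m \<cdot>\<^bsub>D\<^esub> \<epsilon> X = amap F l" using luniq m' by simp
      then show "m = amap F l \<cdot>\<^bsub>D\<^esub> \<epsilon>'"
        using D.assoc[OF e(2,1) m(1)] e(3) D.ident_right[OF m(1)] by simp
    qed
  qed
  then show ?thesis
    unfolding is_kernel_def using Fk Fg Fgk by (auto simp: in_hom_iff)
qed

text \<open>Cokernels are kernels in the opposite category, and the opposite functor is again an
  equivalence, so both halves of exactness follow from the statement on kernels.\<close>

lemma exact_equivalence:
  assumes C: "preadditive C" and D: "preadditive D" and F: "is_equivalence C D F"
    and add: "is_additive_functor C D F"
  shows "is_exact_functor C D F"
  unfolding is_exact_functor_def short_exact_def is_cokernel_def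
proof (intro conjI allI impI; (elim conjE)?)
  fix f g
  note zero = additive_functor_zero[OF C D add]
  assume "is_kernel C f g"
  then show "is_kernel D (amap F f) (amap F g)"
    using zero by (intro equivalence_preserves_kernel[OF C D F]) auto
  assume "is_kernel (op C) g f"
  then show "is_kernel (op D) (amap F g) (amap F f)"
    using zero by (intro equivalence_preserves_kernel[OF preadditive.preadditive_op[OF C]
      preadditive.preadditive_op[OF D] is_equivalence_op[OF C D F]]) auto
qed (fact add)

section \<open>Functors to abelian groups\<close>

lemma arrow_eqI: "source a = source b \<Longrightarrow> target a = target b \<Longrightarrow> body a = body b \<Longrightarrow> a = b"
  by (cases a; cases b) simp

lemma fun_cat_simps [simp]:
  "Obj (fun_cat C D) = {F. is_additive_functor C D F}" "Dom (fun_cat C D) = source" "Cod (fun_cat C D) = target"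
  by (simp_all add: fun_cat_def)

lemma in_hom_fun_cat:
  "\<tau> \<in> carrier (Hom (fun_cat C D) F G) \<longleftrightarrow> is_additive_functor C D F \<and> is_additive_functor C D G \<and>
     source \<tau> = F \<and> target \<tau> = G \<and> nat_trans C D F G (body \<tau>) \<and> body \<tau> \<in> extensional (Obj C)"
  unfolding in_hom_iff by (cases \<tau>) (auto simp: fun_cat_def)

lemma fun_cat_component:
  "\<lbrakk>\<tau> \<in> carrier (Hom (fun_cat C D) F G); X \<in> Obj C\<rbrakk> \<Longrightarrow> \<guillemotleft>body \<tau> X : omap F X \<rightarrow>\<^bsub>D\<^esub> omap G X\<guillemotright>"
  by (auto simp: in_hom_fun_cat nat_trans_def)

lemma fun_cat_eqI:
  assumes "\<sigma> \<in> carrier (Hom (fun_cat C D) F G)" "\<tau> \<in> carrier (Hom (fun_cat C D) F G)"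
    and "\<And>X. X \<in> Obj C \<Longrightarrow> body \<sigma> X = body \<tau> X"
  shows "\<sigma> = \<tau>"
  using assms by (intro arrow_eqI) (auto simp: in_hom_fun_cat intro: extensionalityI)

lemma body_fun_cat [simp]:
  assumes "X \<in> Obj C"
  shows "body (\<tau> \<cdot>\<^bsub>fun_cat C D\<^esub> \<sigma>) X = body \<tau> X \<cdot>\<^bsub>D\<^esub> body \<sigma> X"
    "body (\<sigma> \<boxplus>\<^bsub>fun_cat C D\<^esub> \<tau>) X = body \<sigma> X \<boxplus>\<^bsub>D\<^esub> body \<tau> X"
    "body (Ident (fun_cat C D) F) X = Ident D (omap F X)"
    "body (Zero (fun_cat C D) F G) X = Zero D (omap F X) (omap G X)"
  using assms by (simp_all add: fun_cat_def)

lemma fun_cat_frame [simp]: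
  "source (\<tau> \<cdot>\<^bsub>fun_cat C D\<^esub> \<sigma>) = source \<sigma>" "target (\<tau> \<cdot>\<^bsub>fun_cat C D\<^esub> \<sigma>) = target \<tau>"
  "body (\<tau> \<cdot>\<^bsub>fun_cat C D\<^esub> \<sigma>) \<in> extensional (Obj C)"
  "source (\<sigma> \<boxplus>\<^bsub>fun_cat C D\<^esub> \<tau>) = source \<sigma>" "target (\<sigma> \<boxplus>\<^bsub>fun_cat C D\<^esub> \<tau>) = target \<sigma>"
  "body (\<sigma> \<boxplus>\<^bsub>fun_cat C D\<^esub> \<tau>) \<in> extensional (Obj C)"
  "source (Ident (fun_cat C D) F) = F" "target (Ident (fun_cat C D) F) = F"
  "body (Ident (fun_cat C D) F) \<in> extensional (Obj C)"
  "source (Zero (fun_cat C D) F G) = F" "target (Zero (fun_cat C D) F G) = G"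
  "body (Zero (fun_cat C D) F G) \<in> extensional (Obj C)"
  by (simp_all add: fun_cat_def)

text \<open>All operations are componentwise in \<open>D\<close>, and additivity of composition in
  \<open>D\<close> makes sums, zeros and inverses natural.\<close>

lemma preadditive_fun_cat:
  assumes "preadditive C" "preadditive D"
  shows "preadditive (fun_cat C D)"
proof -
  interpret C: preadditive C by fact
  interpret D: preadditive D by fact
  let ?N = "fun_cat C D"
  have F: "is_functor C D F" if "is_additive_functor C D F" for F
    using that by (simp add: is_additive_functor_def)
  have comp: "\<tau> \<cdot>\<^bsub>?N\<^esub> \<sigma> \<in> carrier (Hom ?N F H)"
    if s: "\<sigma> \<in> carrier (Hom ?N F G)" and t: "\<tau> \<in> carrier (Hom ?N G H)" for \<sigma> \<tau> F G H
  proof -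
    have "amap H f \<cdot>\<^bsub>D\<^esub> (body \<tau> X \<cdot>\<^bsub>D\<^esub> body \<sigma> X) = (body \<tau> Y \<cdot>\<^bsub>D\<^esub> body \<sigma> Y) \<cdot>\<^bsub>D\<^esub> amap F f"
      if f: "\<guillemotleft>f : X \<rightarrow>\<^bsub>C\<^esub> Y\<guillemotright>" for f X Y
    proof -
      have X: "X \<in> Obj C" and Y: "Y \<in> Obj C" using C.hom_objs[OF f] by auto
      have am: "\<guillemotleft>amap F f : omap F X \<rightarrow>\<^bsub>D\<^esub> omap F Y\<guillemotright>" "\<guillemotleft>amap G f : omap G X \<rightarrow>\<^bsub>D\<^esub> omap G Y\<guillemotright>"
        "\<guillemotleft>amap H f : omap H X \<rightarrow>\<^bsub>D\<^esub> omap H Y\<guillemotright>"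
        using s t functor_arr[OF F f] by (auto simp: in_hom_fun_cat)
      have sq: "amap G f \<cdot>\<^bsub>D\<^esub> body \<sigma> X = body \<sigma> Y \<cdot>\<^bsub>D\<^esub> amap F f"
        "amap H f \<cdot>\<^bsub>D\<^esub> body \<tau> X = body \<tau> Y \<cdot>\<^bsub>D\<^esub> amap G f"
        using s t f by (auto simp: in_hom_fun_cat nat_trans_def)
      note c = fun_cat_component[OF s X] fun_cat_component[OF s Y] fun_cat_component[OF t X] fun_cat_component[OF t Y]
      show ?thesis
        using D.assoc[OF c(1,3) am(3)] D.assoc[OF c(1) am(2) c(4)] D.assoc[OF am(1) c(2,4)] sq by simp
    qed
    moreover have "\<guillemotleft>body \<tau> X \<cdot>\<^bsub>D\<^esub> body \<sigma> X : omap F X \<rightarrow>\<^bsub>D\<^esub> omap H X\<guillemotright>" if "X \<in> Obj C" for X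
      by (rule D.comp[OF fun_cat_component[OF s that] fun_cat_component[OF t that]])
    ultimately have "nat_trans C D F H (body (\<tau> \<cdot>\<^bsub>?N\<^esub> \<sigma>))"
      unfolding nat_trans_def using C.hom_objs by (metis body_fun_cat(1))
    then show ?thesis
      using s t by (simp add: in_hom_fun_cat)
  qed
  have add: "\<sigma> \<boxplus>\<^bsub>?N\<^esub> \<tau> \<in> carrier (Hom ?N F G)"
    if s: "\<sigma> \<in> carrier (Hom ?N F G)" and t: "\<tau> \<in> carrier (Hom ?N F G)" for \<sigma> \<tau> F G
  proof -
    have "amap G f \<cdot>\<^bsub>D\<^esub> (body \<sigma> X \<boxplus>\<^bsub>D\<^esub> body \<tau> X) = (body \<sigma> Y \<boxplus>\<^bsub>D\<^esub> body \<tau> Y) \<cdot>\<^bsub>D\<^esub> amap F f"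
      if f: "\<guillemotleft>f : X \<rightarrow>\<^bsub>C\<^esub> Y\<guillemotright>" for f X Y
    proof -
      have X: "X \<in> Obj C" and Y: "Y \<in> Obj C" using C.hom_objs[OF f] by auto
      have am: "\<guillemotleft>amap F f : omap F X \<rightarrow>\<^bsub>D\<^esub> omap F Y\<guillemotright>" "\<guillemotleft>amap G f : omap G X \<rightarrow>\<^bsub>D\<^esub> omap G Y\<guillemotright>"
        using s t functor_arr[OF F f] by (auto simp: in_hom_fun_cat)
      have sq: "amap G f \<cdot>\<^bsub>D\<^esub> body \<sigma> X = body \<sigma> Y \<cdot>\<^bsub>D\<^esub> amap F f"
        "amap G f \<cdot>\<^bsub>D\<^esub> body \<tau> X = body \<tau> Y \<cdot>\<^bsub>D\<^esub> amap F f"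
        using s t f by (auto simp: in_hom_fun_cat nat_trans_def)
      note c = fun_cat_component[OF s X] fun_cat_component[OF s Y] fun_cat_component[OF t X] fun_cat_component[OF t Y]
      show ?thesis
        using D.distrib_left[OF c(1,3) am(2)] D.distrib_right[OF am(1) c(2,4)] sq by simp
    qed
    moreover have "\<guillemotleft>body \<sigma> X \<boxplus>\<^bsub>D\<^esub> body \<tau> X : omap F X \<rightarrow>\<^bsub>D\<^esub> omap G X\<guillemotright>" if "X \<in> Obj C" for X
      by (rule D.add_in_hom[OF fun_cat_component[OF s that] fun_cat_component[OF t that]])
    ultimately have "nat_trans C D F G (body (\<sigma> \<boxplus>\<^bsub>?N\<^esub> \<tau>))"
      unfolding nat_trans_def using C.hom_objs by (metis body_fun_cat(2))
    then show ?thesis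
      using s t by (simp add: in_hom_fun_cat)
  qed
  have zero: "Zero ?N F G \<in> carrier (Hom ?N F G)" if "F \<in> Obj ?N" "G \<in> Obj ?N" for F G
    unfolding in_hom_fun_cat nat_trans_def
  proof (intro conjI allI impI ballI)
    show "\<guillemotleft>body (Zero ?N F G) X : omap F X \<rightarrow>\<^bsub>D\<^esub> omap G X\<guillemotright>" if "X \<in> Obj C" for X
      using that \<open>F \<in> Obj ?N\<close> \<open>G \<in> Obj ?N\<close> functor_obj[OF F] by (auto intro!: D.zero_in_hom)
    show "amap G f \<cdot>\<^bsub>D\<^esub> body (Zero ?N F G) X = body (Zero ?N F G) Y \<cdot>\<^bsub>D\<^esub> amap F f"
      if f: "\<guillemotleft>f : X \<rightarrow>\<^bsub>C\<^esub> Y\<guillemotright>" for f X Y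
    proof -
      have am: "\<guillemotleft>amap F f : omap F X \<rightarrow>\<^bsub>D\<^esub> omap F Y\<guillemotright>" "\<guillemotleft>amap G f : omap G X \<rightarrow>\<^bsub>D\<^esub> omap G Y\<guillemotright>"
        using \<open>F \<in> Obj ?N\<close> \<open>G \<in> Obj ?N\<close> functor_arr[OF F f] by auto
      show ?thesis
        using C.hom_objs[OF f] D.comp_zero[OF am(2)] D.zero_comp[OF am(1)] D.hom_objs am by auto
    qed
  qed (use that in simp_all)
  show ?thesis
  proof (rule preadditive.intro)
    show "Dom ?N f \<in> Obj ?N \<and> Cod ?N f \<in> Obj ?N" if "f \<in> Arr ?N" for f
      using that by (auto simp: fun_cat_def)
    show "Ident ?N F \<in> carrier (Hom ?N F F)" if "F \<in> Obj ?N" for F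
      unfolding in_hom_fun_cat nat_trans_def
    proof (intro conjI allI impI ballI)
      show "\<guillemotleft>body (Ident ?N F) X : omap F X \<rightarrow>\<^bsub>D\<^esub> omap F X\<guillemotright>" if "X \<in> Obj C" for X
        using that \<open>F \<in> Obj ?N\<close> functor_obj[OF F] by (auto intro!: D.ident)
      show "amap F f \<cdot>\<^bsub>D\<^esub> body (Ident ?N F) X = body (Ident ?N F) Y \<cdot>\<^bsub>D\<^esub> amap F f"
        if f: "\<guillemotleft>f : X \<rightarrow>\<^bsub>C\<^esub> Y\<guillemotright>" for f X Y
      proof -
        have "\<guillemotleft>amap F f : omap F X \<rightarrow>\<^bsub>D\<^esub> omap F Y\<guillemotright>"
          using \<open>F \<in> Obj ?N\<close> functor_arr[OF F f] by auto
        then show ?thesis using C.hom_objs[OF f] D.ident_left D.ident_right by simp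
      qed
    qed (use that in simp_all)
    show "\<tau> \<cdot>\<^bsub>?N\<^esub> \<sigma> \<in> carrier (Hom ?N F H)"
      if "\<sigma> \<in> carrier (Hom ?N F G)" "\<tau> \<in> carrier (Hom ?N G H)" for \<sigma> \<tau> F G H
      using comp that .
    show "Ident ?N G \<cdot>\<^bsub>?N\<^esub> \<tau> = \<tau>" "\<tau> \<cdot>\<^bsub>?N\<^esub> Ident ?N F = \<tau>" if t: "\<tau> \<in> carrier (Hom ?N F G)" for \<tau> F G
      using t D.ident_left[OF fun_cat_component[OF t]] D.ident_right[OF fun_cat_component[OF t]]
      by (intro arrow_eqI; auto simp: in_hom_fun_cat intro: extensionalityI[of _ "Obj C"])+
    show "(\<rho> \<cdot>\<^bsub>?N\<^esub> \<tau>) \<cdot>\<^bsub>?N\<^esub> \<sigma> = \<rho> \<cdot>\<^bsub>?N\<^esub> (\<tau> \<cdot>\<^bsub>?N\<^esub> \<sigma>)"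
      if "\<sigma> \<in> carrier (Hom ?N F G)" "\<tau> \<in> carrier (Hom ?N G H)" "\<rho> \<in> carrier (Hom ?N H K)"
      for \<sigma> \<tau> \<rho> F G H K
      using that by (intro fun_cat_eqI[of _ C D F K] comp[of _ F G] comp[of _ F H] comp[of _ G H] comp[of _ H K])
        (auto intro!: D.assoc fun_cat_component)
    show "\<tau> \<cdot>\<^bsub>?N\<^esub> (\<sigma> \<boxplus>\<^bsub>?N\<^esub> \<sigma>') = (\<tau> \<cdot>\<^bsub>?N\<^esub> \<sigma>) \<boxplus>\<^bsub>?N\<^esub> (\<tau> \<cdot>\<^bsub>?N\<^esub> \<sigma>')"
      if "\<sigma> \<in> carrier (Hom ?N F G)" "\<sigma>' \<in> carrier (Hom ?N F G)" "\<tau> \<in> carrier (Hom ?N G H)" for \<sigma> \<sigma>' \<tau> F G H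
      using that by (intro fun_cat_eqI[of _ C D F H] comp[of _ F G] add)
        (auto intro!: D.distrib_left fun_cat_component)
    show "(\<tau> \<boxplus>\<^bsub>?N\<^esub> \<tau>') \<cdot>\<^bsub>?N\<^esub> \<sigma> = (\<tau> \<cdot>\<^bsub>?N\<^esub> \<sigma>) \<boxplus>\<^bsub>?N\<^esub> (\<tau>' \<cdot>\<^bsub>?N\<^esub> \<sigma>)"
      if "\<sigma> \<in> carrier (Hom ?N F G)" "\<tau> \<in> carrier (Hom ?N G H)" "\<tau>' \<in> carrier (Hom ?N G H)" for \<sigma> \<tau> \<tau>' F G H
      using that by (intro fun_cat_eqI[of _ C D F H] comp[of _ F G] add)
        (auto intro!: D.distrib_right fun_cat_component)
    show "comm_group (Hom ?N F G)" if FG: "F \<in> Obj ?N" "G \<in> Obj ?N" for F G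
    proof -
      have grp: "comm_group (Hom D (omap F X) (omap G X))" if "X \<in> Obj C" for X
        using that FG functor_obj[OF F] by (auto intro!: D.hom_group)
      show ?thesis
      proof (rule comm_groupI; (unfold mult_Hom one_Hom)?)
        fix \<sigma> \<tau> \<rho> assume s: "\<sigma> \<in> carrier (Hom ?N F G)" and t: "\<tau> \<in> carrier (Hom ?N F G)" and r: "\<rho> \<in> carrier (Hom ?N F G)"
        have mem: "body \<sigma> X \<in> carrier (Hom D (omap F X) (omap G X))" "body \<tau> X \<in> carrier (Hom D (omap F X) (omap G X))"
            "body \<rho> X \<in> carrier (Hom D (omap F X) (omap G X))" if "X \<in> Obj C" for X
          by (rule fun_cat_component[OF s that] fun_cat_component[OF t that] fun_cat_component[OF r that])+
        show "\<sigma> \<boxplus>\<^bsub>?N\<^esub> \<tau> \<boxplus>\<^bsub>?N\<^esub> \<rho> = \<sigma> \<boxplus>\<^bsub>?N\<^esub> (\<tau> \<boxplus>\<^bsub>?N\<^esub> \<rho>)"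
          using s t r comm_monoid.m_ac(1)[OF comm_group.axioms(1)[OF grp] mem]
          by (intro fun_cat_eqI[of _ C D F G] add) auto
      next
        fix \<sigma> \<tau> assume s: "\<sigma> \<in> carrier (Hom ?N F G)" and t: "\<tau> \<in> carrier (Hom ?N F G)"
        show "\<sigma> \<boxplus>\<^bsub>?N\<^esub> \<tau> = \<tau> \<boxplus>\<^bsub>?N\<^esub> \<sigma>"
          using s t comm_monoid.m_ac(2)[OF comm_group.axioms(1)[OF grp] fun_cat_component[OF s] fun_cat_component[OF t]]
          by (intro fun_cat_eqI[of _ C D F G] add) auto
        show "\<sigma> \<boxplus>\<^bsub>?N\<^esub> \<tau> \<in> carrier (Hom ?N F G)" using add s t .
      next
        show "Zero ?N F G \<in> carrier (Hom ?N F G)" using zero FG .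
      next
        fix \<sigma> assume s: "\<sigma> \<in> carrier (Hom ?N F G)"
        show "Zero ?N F G \<boxplus>\<^bsub>?N\<^esub> \<sigma> = \<sigma>"
          using s D.add_zero(2)[OF fun_cat_component[OF s]]
          by (intro fun_cat_eqI[of _ C D F G] add zero FG) auto
        define i where "i X = inv\<^bsub>Hom D (omap F X) (omap G X)\<^esub> body \<sigma> X" for X
        let ?t = "Arrow F G (\<lambda>X\<in>Obj C. i X)"
        have i: "i X \<in> carrier (Hom D (omap F X) (omap G X))" "i X \<boxplus>\<^bsub>D\<^esub> body \<sigma> X = Zero D (omap F X) (omap G X)"
          if "X \<in> Obj C" for X
          using group.inv_closed[OF comm_group.axioms(2)[OF grp] fun_cat_component[OF s]]
            group.l_inv[OF comm_group.axioms(2)[OF grp] fun_cat_component[OF s]] that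
          by (auto simp: i_def)
        have "amap G f \<cdot>\<^bsub>D\<^esub> i X = i Y \<cdot>\<^bsub>D\<^esub> amap F f" if f: "\<guillemotleft>f : X \<rightarrow>\<^bsub>C\<^esub> Y\<guillemotright>" for f X Y
        proof -
          have X: "X \<in> Obj C" and Y: "Y \<in> Obj C" using C.hom_objs[OF f] by auto
          have am: "\<guillemotleft>amap F f : omap F X \<rightarrow>\<^bsub>D\<^esub> omap F Y\<guillemotright>" "\<guillemotleft>amap G f : omap G X \<rightarrow>\<^bsub>D\<^esub> omap G Y\<guillemotright>"
            using FG functor_arr[OF F f] by auto
          have sq: "amap G f \<cdot>\<^bsub>D\<^esub> body \<sigma> X = body \<sigma> Y \<cdot>\<^bsub>D\<^esub> amap F f"
            using s f by (auto simp: in_hom_fun_cat nat_trans_def)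
          have "amap G f \<cdot>\<^bsub>D\<^esub> i X = inv\<^bsub>Hom D (omap F X) (omap G Y)\<^esub> (amap G f \<cdot>\<^bsub>D\<^esub> body \<sigma> X)"
            unfolding i_def using D.hom_objs[OF am(1)]
            by (intro group_hom.hom_inv[OF D.comp_left_hom[OF am(2)] fun_cat_component[OF s X]]) auto
          moreover have "i Y \<cdot>\<^bsub>D\<^esub> amap F f = inv\<^bsub>Hom D (omap F X) (omap G Y)\<^esub> (body \<sigma> Y \<cdot>\<^bsub>D\<^esub> amap F f)"
            unfolding i_def using D.hom_objs[OF am(2)]
            by (intro group_hom.hom_inv[OF D.comp_right_hom[OF am(1)] fun_cat_component[OF s Y]]) auto
          ultimately show ?thesis using sq by simp
        qed
        then have t: "?t \<in> carrier (Hom ?N F G)"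
          using FG i(1) C.hom_objs by (auto simp: in_hom_fun_cat nat_trans_def)
        moreover have "?t \<boxplus>\<^bsub>?N\<^esub> \<sigma> = Zero ?N F G"
          using i(2) by (intro fun_cat_eqI[of _ C D F G] add t s zero FG) auto
        ultimately show "\<exists>\<tau>\<in>carrier (Hom ?N F G). \<tau> \<boxplus>\<^bsub>?N\<^esub> \<sigma> = Zero ?N F G" by blast
      qed
    qed
  qed
qed

section \<open>The category of small abelian groups\<close>

lemma Obj_Ab [simp]: "A \<in> Obj (Ab :: ('u monoid, _) cat) \<longleftrightarrow> comm_group A \<and> small TYPE('u) (carrier A)"
  and Dom_Ab [simp]: "Dom Ab = source"
  and Cod_Ab [simp]: "Cod Ab = target"
  by (simp_all add: Ab_def)

lemma in_hom_Ab:
  "a \<in> carrier (Hom Ab A B) \<longleftrightarrow> A \<in> Obj Ab \<and> B \<in> Obj Ab \<and> source a = A \<and> target a = B \<and>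
     body a \<in> hom A B \<and> body a \<in> extensional (carrier A)"
  unfolding in_hom_iff by (cases a) (auto simp: Ab_def hom_group_def)

lemma Ab_eqI:
  assumes "a \<in> carrier (Hom Ab A B)" "b \<in> carrier (Hom Ab A B)"
    and "\<And>x. x \<in> carrier A \<Longrightarrow> body a x = body b x"
  shows "a = b"
  using assms by (intro arrow_eqI) (auto simp: in_hom_Ab intro: extensionalityI)

lemma body_Ab:
  assumes "x \<in> carrier A"
  shows "a \<in> carrier (Hom Ab A B) \<Longrightarrow> body (b \<cdot>\<^bsub>Ab\<^esub> a) x = body b (body a x)"
    "a \<in> carrier (Hom Ab A B) \<Longrightarrow> body (a \<boxplus>\<^bsub>Ab\<^esub> b) x = body a x \<otimes>\<^bsub>B\<^esub> body b x"
    "body (Ident Ab A) x = x"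
    "body (Zero Ab A B) x = \<one>\<^bsub>B\<^esub>"
proof -
  show "body (b \<cdot>\<^bsub>Ab\<^esub> a) x = body b (body a x)" "body (a \<boxplus>\<^bsub>Ab\<^esub> b) x = body a x \<otimes>\<^bsub>B\<^esub> body b x"
    if "a \<in> carrier (Hom Ab A B)"
  proof -
    have "source a = A" "target a = B" using that by (auto simp: in_hom_Ab)
    then show "body (b \<cdot>\<^bsub>Ab\<^esub> a) x = body b (body a x)" "body (a \<boxplus>\<^bsub>Ab\<^esub> b) x = body a x \<otimes>\<^bsub>B\<^esub> body b x"
      using assms by (auto simp: Ab_def compose_def hom_group_def)
  qed
qed (use assms in \<open>auto simp: Ab_def hom_group_def\<close>)

lemma Ab_frame [simp]:
  "source (b \<cdot>\<^bsub>Ab\<^esub> a) = source a" "target (b \<cdot>\<^bsub>Ab\<^esub> a) = target b"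
  "body (b \<cdot>\<^bsub>Ab\<^esub> a) \<in> extensional (carrier (source a))"
  "source (a \<boxplus>\<^bsub>Ab\<^esub> b) = source a" "target (a \<boxplus>\<^bsub>Ab\<^esub> b) = target a"
  "body (a \<boxplus>\<^bsub>Ab\<^esub> b) \<in> extensional (carrier (source a))"
  "source (Ident Ab A) = A" "target (Ident Ab A) = A" "body (Ident Ab A) \<in> extensional (carrier A)"
  "source (Zero Ab A B) = A" "target (Zero Ab A B) = B" "body (Zero Ab A B) \<in> extensional (carrier A)"
  by (simp_all add: Ab_def hom_group_def)

lemma Ab_apply:
  assumes "a \<in> carrier (Hom Ab A B)" "x \<in> carrier A"
  shows "body a x \<in> carrier B" "y \<in> carrier A \<Longrightarrow> body a (x \<otimes>\<^bsub>A\<^esub> y) = body a x \<otimes>\<^bsub>B\<^esub> body a y"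
  using assms by (auto simp: in_hom_Ab hom_def)

lemma preadditive_Ab: "preadditive (Ab :: ('u monoid, _) cat)"
proof -
  let ?A = "Ab :: ('u monoid, _) cat"
  have comp: "b \<cdot>\<^bsub>Ab\<^esub> a \<in> carrier (Hom Ab A C)"
    if a: "a \<in> carrier (Hom Ab A B)" and b: "b \<in> carrier (Hom Ab B C)" for A B C :: "'u monoid" and a b
  proof -
    interpret A: comm_group A using a by (simp add: in_hom_Ab)
    have "body (b \<cdot>\<^bsub>Ab\<^esub> a) \<in> hom A C"
      by (rule homI) (simp_all add: body_Ab(1)[OF _ a] Ab_apply[OF a] Ab_apply[OF b])
    then show ?thesis using a b Ab_frame(3)[of b a] by (simp add: in_hom_Ab)
  qed
  have add: "a \<boxplus>\<^bsub>Ab\<^esub> b \<in> carrier (Hom Ab A B)"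
    if a: "a \<in> carrier (Hom Ab A B)" and b: "b \<in> carrier (Hom Ab A B)" for A B :: "'u monoid" and a b
  proof -
    interpret A: comm_group A using a by (simp add: in_hom_Ab)
    interpret B: comm_group B using a by (simp add: in_hom_Ab)
    \<comment> \<open>Commutativity of \<open>B\<close> is what makes the pointwise sum of
      homomorphisms a homomorphism.\<close>
    have "body (a \<boxplus>\<^bsub>Ab\<^esub> b) \<in> hom A B"
      by (rule homI) (simp_all add: body_Ab(2)[OF _ a] Ab_apply[OF a] Ab_apply[OF b] B.m_ac)
    then show ?thesis using a Ab_frame(6)[of a b] by (simp add: in_hom_Ab)
  qed
  have zero: "Zero Ab A B \<in> carrier (Hom Ab A B)" if "A \<in> Obj ?A" "B \<in> Obj ?A" for A B
  proof -
    interpret A: comm_group A using that by simp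
    interpret B: comm_group B using that by simp
    have "body (Zero Ab A B) \<in> hom A B"
      by (rule homI) (simp_all add: body_Ab(4))
    then show ?thesis using that by (simp add: in_hom_Ab)
  qed
  note app = Ab_apply
  show ?thesis
  proof (rule preadditive.intro)
    show "Dom Ab f \<in> Obj ?A \<and> Cod Ab f \<in> Obj ?A" if "f \<in> Arr ?A" for f
      using that by (auto simp: Ab_def)
    show ident: "Ident Ab A \<in> carrier (Hom Ab A A)" if "A \<in> Obj ?A" for A
    proof -
      interpret A: comm_group A using that by simp
      have "body (Ident Ab A) \<in> hom A A"
        by (rule homI) (simp_all add: body_Ab(3))
      then show ?thesis using that by (simp add: in_hom_Ab)
    qed
    show "b \<cdot>\<^bsub>Ab\<^esub> a \<in> carrier (Hom Ab A C)"
      if "a \<in> carrier (Hom Ab A B)" "b \<in> carrier (Hom Ab B C)" for A B C :: "'u monoid" and a b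
      using comp that .
    show "Ident Ab B \<cdot>\<^bsub>Ab\<^esub> a = a" "a \<cdot>\<^bsub>Ab\<^esub> Ident Ab A = a" if a: "a \<in> carrier (Hom Ab A B)" for A B :: "'u monoid" and a
    proof -
      have A: "Ident Ab A \<in> carrier (Hom Ab A A)" and B: "Ident Ab B \<in> carrier (Hom Ab B B)"
        using a ident by (auto simp: in_hom_Ab)
      show "Ident Ab B \<cdot>\<^bsub>Ab\<^esub> a = a"
        by (rule Ab_eqI[OF comp[OF a B] a]) (simp add: body_Ab(1)[OF _ a] body_Ab(3) Ab_apply[OF a])
      show "a \<cdot>\<^bsub>Ab\<^esub> Ident Ab A = a"
        by (rule Ab_eqI[OF comp[OF A a] a]) (simp add: body_Ab(1)[OF _ A] body_Ab(3))
    qed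
    show "(c \<cdot>\<^bsub>Ab\<^esub> b) \<cdot>\<^bsub>Ab\<^esub> a = c \<cdot>\<^bsub>Ab\<^esub> (b \<cdot>\<^bsub>Ab\<^esub> a)"
      if a: "a \<in> carrier (Hom Ab A B)" and b: "b \<in> carrier (Hom Ab B C)" and c: "c \<in> carrier (Hom Ab C D)"
      for A B C D :: "'u monoid" and a b c
      using app(1)[OF a] body_Ab(1)[OF _ a] body_Ab(1)[OF _ b] body_Ab(1)[OF _ comp[OF a b]]
      by (intro Ab_eqI[OF comp[OF a comp[OF b c]] comp[OF comp[OF a b] c]]) simp
    show "b \<cdot>\<^bsub>Ab\<^esub> (a \<boxplus>\<^bsub>Ab\<^esub> a') = (b \<cdot>\<^bsub>Ab\<^esub> a) \<boxplus>\<^bsub>Ab\<^esub> (b \<cdot>\<^bsub>Ab\<^esub> a')"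
      if a: "a \<in> carrier (Hom Ab A B)" "a' \<in> carrier (Hom Ab A B)" and b: "b \<in> carrier (Hom Ab B C)"
      for A B C :: "'u monoid" and a a' b
      using app[OF a(1)] app[OF a(2)] app[OF b] body_Ab(1)[OF _ a(1)] body_Ab(1)[OF _ a(2)] body_Ab(2)[OF _ a(1)]
        body_Ab(1)[OF _ add[OF a]] body_Ab(2)[OF _ comp[OF a(1) b]]
      by (intro Ab_eqI[OF comp[OF add[OF a] b] add[OF comp[OF a(1) b] comp[OF a(2) b]]]) simp
    show "(b \<boxplus>\<^bsub>Ab\<^esub> b') \<cdot>\<^bsub>Ab\<^esub> a = (b \<cdot>\<^bsub>Ab\<^esub> a) \<boxplus>\<^bsub>Ab\<^esub> (b' \<cdot>\<^bsub>Ab\<^esub> a)"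
      if a: "a \<in> carrier (Hom Ab A B)" and b: "b \<in> carrier (Hom Ab B C)" "b' \<in> carrier (Hom Ab B C)"
      for A B C :: "'u monoid" and a b b'
      using app[OF a] body_Ab(1)[OF _ a] body_Ab(2)[OF _ b(1)] body_Ab(2)[OF _ comp[OF a b(1)]]
      by (intro Ab_eqI[OF comp[OF a add[OF b]] add[OF comp[OF a b(1)] comp[OF a b(2)]]]) simp
    show "comm_group (Hom Ab A B)" if AB: "A \<in> Obj ?A" "B \<in> Obj ?A" for A B
    proof -
      interpret A: comm_group A using AB by simp
      interpret B: comm_group B using AB by simp
      note bAdd = body_Ab(2)[of _ A _ B]
      show ?thesis
      proof (rule comm_groupI; (unfold mult_Hom one_Hom)?)
        fix a b c assume a: "a \<in> carrier (Hom Ab A B)" and b: "b \<in> carrier (Hom Ab A B)" and c: "c \<in> carrier (Hom Ab A B)"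
        show "a \<boxplus>\<^bsub>Ab\<^esub> b \<boxplus>\<^bsub>Ab\<^esub> c = a \<boxplus>\<^bsub>Ab\<^esub> (b \<boxplus>\<^bsub>Ab\<^esub> c)"
          using app(1)[OF a] app(1)[OF b] app(1)[OF c]
          by (intro Ab_eqI[OF add[OF add[OF a b] c] add[OF a add[OF b c]]]) (simp add: bAdd a b c add B.m_assoc)
      next
        fix a b assume a: "a \<in> carrier (Hom Ab A B)" and b: "b \<in> carrier (Hom Ab A B)"
        show "a \<boxplus>\<^bsub>Ab\<^esub> b = b \<boxplus>\<^bsub>Ab\<^esub> a"
          using app(1)[OF a] app(1)[OF b]
          by (intro Ab_eqI[OF add[OF a b] add[OF b a]]) (simp add: bAdd a b B.m_comm)
        show "a \<boxplus>\<^bsub>Ab\<^esub> b \<in> carrier (Hom Ab A B)" using add a b .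
      next
        show "Zero Ab A B \<in> carrier (Hom Ab A B)" using zero AB .
      next
        fix a assume a: "a \<in> carrier (Hom Ab A B)"
        show "Zero Ab A B \<boxplus>\<^bsub>Ab\<^esub> a = a"
          using app(1)[OF a]
          by (intro Ab_eqI[OF add[OF zero[OF AB] a] a]) (simp add: bAdd zero[OF AB] body_Ab(4))
        let ?b = "Arrow A B (\<lambda>x\<in>carrier A. inv\<^bsub>B\<^esub> body a x)"
        have "(\<lambda>x\<in>carrier A. inv\<^bsub>B\<^esub> body a x) \<in> hom A B"
          using app[OF a] by (auto simp: hom_def B.inv_mult)
        then have b: "?b \<in> carrier (Hom Ab A B)"
          using AB by (simp add: in_hom_Ab)
        have "?b \<boxplus>\<^bsub>Ab\<^esub> a = Zero Ab A B"
          using app(1)[OF a]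
          by (intro Ab_eqI[OF add[OF b a] zero[OF AB]]) (simp add: bAdd[OF _ b] body_Ab(4))
        then show "\<exists>b\<in>carrier (Hom Ab A B). b \<boxplus>\<^bsub>Ab\<^esub> a = Zero Ab A B" using b by blast
      qed
    qed
  qed
qed

section \<open>Elementwise description of \<open>(C, Ab)\<close>\<close>

definition act :: "('o, 'a, 'u monoid, ('u monoid, 'u \<Rightarrow> 'u) arrow) ftor \<Rightarrow> 'a \<Rightarrow> 'u \<Rightarrow> 'u" where
  "act F f = body (amap F f)"

definition app :: "('f, 'o \<Rightarrow> ('u monoid, 'u \<Rightarrow> 'u) arrow) arrow \<Rightarrow> 'o \<Rightarrow> 'u \<Rightarrow> 'u" where
  "app \<tau> X = body (body \<tau> X)"

text \<open>Restricting to \<open>Obj C\<close> and to the carriers gives the extensional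
  representatives that hom-sets demand, so the values of \<open>t\<close> elsewhere do not
  matter.\<close>

definition trans_of :: "('o, 'a, 'm) cat_scheme \<Rightarrow>
    ('o, 'a, 'u monoid, ('u monoid, 'u \<Rightarrow> 'u) arrow) ftor \<Rightarrow>
    ('o, 'a, 'u monoid, ('u monoid, 'u \<Rightarrow> 'u) arrow) ftor \<Rightarrow> ('o \<Rightarrow> 'u \<Rightarrow> 'u) \<Rightarrow>
    (('o, 'a, 'u monoid, ('u monoid, 'u \<Rightarrow> 'u) arrow) ftor, 'o \<Rightarrow> ('u monoid, 'u \<Rightarrow> 'u) arrow) arrow" where
  "trans_of C F G t = Arrow F G (\<lambda>X\<in>Obj C. Arrow (omap F X) (omap G X) (\<lambda>x\<in>carrier (omap F X). t X x))"

lemma app_trans_of [simp]: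
  "X \<in> Obj C \<Longrightarrow> x \<in> carrier (omap F X) \<Longrightarrow> app (trans_of C F G t) X x = t X x"
  by (simp add: app_def trans_of_def)

lemma hom_restrict:
  assumes "group A" "f \<in> hom A B" shows "(\<lambda>x\<in>carrier A. f x) \<in> hom A B"
proof -
  interpret group A by fact
  show ?thesis using assms(2) by (simp add: hom_def Pi_def)
qed

text \<open>Reduces the functor laws to equations between elements. The map \<open>a f\<close> is an
  unrestricted function; restriction to the carrier of the source occurs only in the arrow of
  \<open>Ab\<close>.\<close>

lemma additive_functorI:
  fixes C :: "('o, 'a, 'm) cat_scheme"
    and F :: "('o, 'a, 'u monoid, ('u monoid, 'u \<Rightarrow> 'u) arrow) ftor"
  assumes C: "preadditive C"
    and grp: "\<And>X. X \<in> Obj C \<Longrightarrow> comm_group (omap F X)"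
    and sm: "\<And>X. X \<in> Obj C \<Longrightarrow> small TYPE('u) (carrier (omap F X))"
    and arr: "\<And>X Y f. \<guillemotleft>f : X \<rightarrow>\<^bsub>C\<^esub> Y\<guillemotright> \<Longrightarrow>
      amap F f = Arrow (omap F X) (omap F Y) (\<lambda>x\<in>carrier (omap F X). a f x)"
    and hom: "\<And>X Y f. \<guillemotleft>f : X \<rightarrow>\<^bsub>C\<^esub> Y\<guillemotright> \<Longrightarrow> a f \<in> hom (omap F X) (omap F Y)"
    and id: "\<And>X x. X \<in> Obj C \<Longrightarrow> x \<in> carrier (omap F X) \<Longrightarrow> a (Ident C X) x = x"
    and comp: "\<And>X Y Z f g x. \<guillemotleft>f : X \<rightarrow>\<^bsub>C\<^esub> Y\<guillemotright> \<Longrightarrow> \<guillemotleft>g : Y \<rightarrow>\<^bsub>C\<^esub> Z\<guillemotright> \<Longrightarrow>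
      x \<in> carrier (omap F X) \<Longrightarrow> a (g \<cdot>\<^bsub>C\<^esub> f) x = a g (a f x)"
    and add: "\<And>X Y f g x. \<guillemotleft>f : X \<rightarrow>\<^bsub>C\<^esub> Y\<guillemotright> \<Longrightarrow> \<guillemotleft>g : X \<rightarrow>\<^bsub>C\<^esub> Y\<guillemotright> \<Longrightarrow>
      x \<in> carrier (omap F X) \<Longrightarrow> a (f \<boxplus>\<^bsub>C\<^esub> g) x = a f x \<otimes>\<^bsub>omap F Y\<^esub> a g x"
  shows "is_additive_functor C Ab F"
proof -
  interpret C: preadditive C by fact
  interpret Ab: preadditive "Ab :: ('u monoid, _) cat" by (rule preadditive_Ab)
  have obj: "omap F X \<in> Obj Ab" if "X \<in> Obj C" for X
    using grp sm that by simp
  have in_hom: "\<guillemotleft>amap F f : omap F X \<rightarrow>\<^bsub>Ab\<^esub> omap F Y\<guillemotright>" if f: "\<guillemotleft>f : X \<rightarrow>\<^bsub>C\<^esub> Y\<guillemotright>" for X Y f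
    unfolding in_hom_Ab arr[OF f]
    using obj C.hom_objs[OF f] hom_restrict[OF comm_group.axioms(2)[OF grp] hom[OF f]] by auto
  have b: "body (amap F f) x = a f x" if "\<guillemotleft>f : X \<rightarrow>\<^bsub>C\<^esub> Y\<guillemotright>" "x \<in> carrier (omap F X)" for X Y f x
    using arr[OF that(1)] that(2) by simp
  have closed: "a f x \<in> carrier (omap F Y)" if "\<guillemotleft>f : X \<rightarrow>\<^bsub>C\<^esub> Y\<guillemotright>" "x \<in> carrier (omap F X)" for X Y f x
    using hom[OF that(1)] that(2) by (auto simp: hom_def)
  show ?thesis
    unfolding is_additive_functor_def is_functor_def
  proof (intro conjI allI impI ballI; (elim conjE)?)
    show "omap F X \<in> Obj Ab" if "X \<in> Obj C" for X using obj that .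
    show "\<guillemotleft>amap F f : omap F X \<rightarrow>\<^bsub>Ab\<^esub> omap F Y\<guillemotright>" if "\<guillemotleft>f : X \<rightarrow>\<^bsub>C\<^esub> Y\<guillemotright>" for X Y f using in_hom that .
    show "amap F (Ident C X) = Ident Ab (omap F X)" if X: "X \<in> Obj C" for X
      by (rule Ab_eqI[OF in_hom[OF C.ident[OF X]] Ab.ident[OF obj[OF X]]])
        (simp add: b[OF C.ident[OF X]] body_Ab(3) id[OF X])
    show "amap F (g \<cdot>\<^bsub>C\<^esub> f) = amap F g \<cdot>\<^bsub>Ab\<^esub> amap F f"
      if f: "\<guillemotleft>f : X \<rightarrow>\<^bsub>C\<^esub> Y\<guillemotright>" and g: "\<guillemotleft>g : Y \<rightarrow>\<^bsub>C\<^esub> Z\<guillemotright>" for X Y Z f g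
      by (rule Ab_eqI[OF in_hom[OF C.comp[OF f g]] Ab.comp[OF in_hom[OF f] in_hom[OF g]]])
        (simp add: b[OF C.comp[OF f g]] body_Ab(1)[OF _ in_hom[OF f]] b[OF f] b[OF g] closed[OF f] comp[OF f g])
    show "amap F (f \<boxplus>\<^bsub>C\<^esub> g) = amap F f \<boxplus>\<^bsub>Ab\<^esub> amap F g"
      if f: "\<guillemotleft>f : X \<rightarrow>\<^bsub>C\<^esub> Y\<guillemotright>" and g: "\<guillemotleft>g : X \<rightarrow>\<^bsub>C\<^esub> Y\<guillemotright>" for X Y f g
      by (rule Ab_eqI[OF in_hom[OF C.add_in_hom[OF f g]] Ab.add_in_hom[OF in_hom[OF f] in_hom[OF g]]])
        (simp add: b[OF C.add_in_hom[OF f g]] body_Ab(2)[OF _ in_hom[OF f]] b[OF f] b[OF g] add[OF f g])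
  qed
qed

context preadditive
begin

lemma preadditive_AbFun: "preadditive (fun_cat C Ab)"
  by (rule preadditive_fun_cat[OF preadditive_axioms preadditive_Ab])

context
  fixes F :: "('o, 'a, 'u monoid, ('u monoid, 'u \<Rightarrow> 'u) arrow) ftor"
  assumes F: "is_additive_functor C Ab F"
begin

lemma functor_group: "X \<in> Obj C \<Longrightarrow> comm_group (omap F X)"
  and functor_small: "X \<in> Obj C \<Longrightarrow> small TYPE('u) (carrier (omap F X))"
  using F by (auto simp: is_additive_functor_def is_functor_def)

lemma functor_arr_Ab: "\<guillemotleft>f : X \<rightarrow> Y\<guillemotright> \<Longrightarrow> \<guillemotleft>amap F f : omap F X \<rightarrow>\<^bsub>Ab\<^esub> omap F Y\<guillemotright>"
  using F by (auto simp: is_additive_functor_def is_functor_def)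

lemma act_closed: "\<guillemotleft>f : X \<rightarrow> Y\<guillemotright> \<Longrightarrow> x \<in> carrier (omap F X) \<Longrightarrow> act F f x \<in> carrier (omap F Y)"
  unfolding act_def by (rule Ab_apply(1)[OF functor_arr_Ab])

lemma act_hom: "\<guillemotleft>f : X \<rightarrow> Y\<guillemotright> \<Longrightarrow> group_hom (omap F X) (omap F Y) (act F f)"
  using functor_arr_Ab functor_group hom_objs
  by (auto simp: group_hom_def group_hom_axioms_def comm_group_def act_def in_hom_Ab)

lemma act_ident: "X \<in> Obj C \<Longrightarrow> x \<in> carrier (omap F X) \<Longrightarrow> act F (Ident C X) x = x"
  using F by (simp add: is_additive_functor_def is_functor_def act_def body_Ab)

lemma act_comp: "\<guillemotleft>f : X \<rightarrow> Y\<guillemotright> \<Longrightarrow> \<guillemotleft>g : Y \<rightarrow> Z\<guillemotright> \<Longrightarrow> x \<in> carrier (omap F X) \<Longrightarrow>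
    act F (g \<cdot> f) x = act F g (act F f x)"
  using F functor_arr_Ab[of f X Y] unfolding is_additive_functor_def is_functor_def act_def
  by (metis body_Ab(1))

lemma act_add: "\<guillemotleft>f : X \<rightarrow> Y\<guillemotright> \<Longrightarrow> \<guillemotleft>g : X \<rightarrow> Y\<guillemotright> \<Longrightarrow> x \<in> carrier (omap F X) \<Longrightarrow>
    act F (f \<boxplus> g) x = act F f x \<otimes>\<^bsub>omap F Y\<^esub> act F g x"
  using F functor_arr_Ab[of f X Y] unfolding is_additive_functor_def is_functor_def act_def
  by (metis body_Ab(2))

end

lemma trans_functors:
  "\<tau> \<in> carrier (Hom (fun_cat C Ab) F G) \<Longrightarrow> is_additive_functor C Ab F \<and> is_additive_functor C Ab G"
  by (simp add: in_hom_fun_cat)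

lemma app_hom:
  assumes "\<tau> \<in> carrier (Hom (fun_cat C Ab) F G)" "X \<in> Obj C"
  shows "group_hom (omap F X) (omap G X) (app \<tau> X)"
  using fun_cat_component[OF assms] trans_functors[OF assms(1)] functor_group[OF _ assms(2)]
  by (auto simp: group_hom_def group_hom_axioms_def comm_group_def app_def in_hom_Ab)

lemma app_closed:
  assumes "\<tau> \<in> carrier (Hom (fun_cat C Ab) F G)" "X \<in> Obj C" "x \<in> carrier (omap F X)"
  shows "app \<tau> X x \<in> carrier (omap G X)"
  using group_hom.hom_closed[OF app_hom[OF assms(1,2)] assms(3)] .

lemma app_natural:
  assumes t: "\<tau> \<in> carrier (Hom (fun_cat C Ab) F G)" and f: "\<guillemotleft>f : X \<rightarrow> Y\<guillemotright>" and x: "x \<in> carrier (omap F X)"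
  shows "app \<tau> Y (act F f x) = act G f (app \<tau> X x)"
proof -
  have "amap G f \<cdot>\<^bsub>Ab\<^esub> body \<tau> X = body \<tau> Y \<cdot>\<^bsub>Ab\<^esub> amap F f"
    using t f by (auto simp: in_hom_fun_cat nat_trans_def)
  from arg_cong[where f = "\<lambda>a. body a x", OF this] show ?thesis
    using body_Ab(1)[OF x fun_cat_component[OF t]] body_Ab(1)[OF x functor_arr_Ab[OF _ f]]
      trans_functors[OF t] hom_objs[OF f] by (simp add: app_def act_def)
qed

lemma trans_eqI:
  assumes s: "\<sigma> \<in> carrier (Hom (fun_cat C Ab) F G)" and t: "\<tau> \<in> carrier (Hom (fun_cat C Ab) F G)"
    and "\<And>X x. X \<in> Obj C \<Longrightarrow> x \<in> carrier (omap F X) \<Longrightarrow> app \<sigma> X x = app \<tau> X x"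
  shows "\<sigma> = \<tau>"
  using assms(3) fun_cat_component[OF s] fun_cat_component[OF t]
  by (intro fun_cat_eqI[OF s t] Ab_eqI) (auto simp: app_def)

lemma trans_ofI:
  fixes F G :: "('o, 'a, 'u monoid, ('u monoid, 'u \<Rightarrow> 'u) arrow) ftor"
  assumes F: "is_additive_functor C Ab F" and G: "is_additive_functor C Ab G"
    and hom: "\<And>X. X \<in> Obj C \<Longrightarrow> t X \<in> hom (omap F X) (omap G X)"
    and nat: "\<And>X Y f x. \<guillemotleft>f : X \<rightarrow> Y\<guillemotright> \<Longrightarrow> x \<in> carrier (omap F X) \<Longrightarrow> t Y (act F f x) = act G f (t X x)"
  shows "trans_of C F G t \<in> carrier (Hom (fun_cat C Ab) F G)"
proof -
  let ?t = "\<lambda>X. Arrow (omap F X) (omap G X) (\<lambda>x\<in>carrier (omap F X). t X x)"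
  interpret Ab: preadditive "Ab :: ('u monoid, _) cat" by (rule preadditive_Ab)
  have c: "\<guillemotleft>?t X : omap F X \<rightarrow>\<^bsub>Ab\<^esub> omap G X\<guillemotright>" if X: "X \<in> Obj C" for X
    unfolding in_hom_Ab
    using X functor_group[OF F X] functor_group[OF G X] functor_small[OF F X] functor_small[OF G X]
      hom_restrict[OF comm_group.axioms(2)[OF functor_group[OF F X]] hom[OF X]] by simp
  have "amap G f \<cdot>\<^bsub>Ab\<^esub> ?t X = ?t Y \<cdot>\<^bsub>Ab\<^esub> amap F f" if f: "\<guillemotleft>f : X \<rightarrow> Y\<guillemotright>" for f X Y
  proof -
    have X: "X \<in> Obj C" and Y: "Y \<in> Obj C" using hom_objs[OF f] by auto
    show ?thesis
    proof (rule Ab_eqI[OF Ab.comp[OF c[OF X] functor_arr_Ab[OF G f]] Ab.comp[OF functor_arr_Ab[OF F f] c[OF Y]]])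
      fix x assume x: "x \<in> carrier (omap F X)"
      show "body (amap G f \<cdot>\<^bsub>Ab\<^esub> ?t X) x = body (?t Y \<cdot>\<^bsub>Ab\<^esub> amap F f) x"
        using nat[OF f x] act_closed[OF F f x]
        by (simp add: body_Ab(1)[OF x c[OF X]] body_Ab(1)[OF x functor_arr_Ab[OF F f]] act_def x)
    qed
  qed
  then show ?thesis
    using F G c hom_objs by (simp add: in_hom_fun_cat nat_trans_def trans_of_def)
qed

lemma app_comp:
  assumes "\<sigma> \<in> carrier (Hom (fun_cat C Ab) F G)" "X \<in> Obj C" "x \<in> carrier (omap F X)"
  shows "app (\<tau> \<cdot>\<^bsub>fun_cat C Ab\<^esub> \<sigma>) X x = app \<tau> X (app \<sigma> X x)"
  using body_Ab(1)[OF assms(3) fun_cat_component[OF assms(1,2)]] assms(2) by (simp add: app_def)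

lemma app_add:
  assumes "\<sigma> \<in> carrier (Hom (fun_cat C Ab) F G)" "X \<in> Obj C" "x \<in> carrier (omap F X)"
  shows "app (\<sigma> \<boxplus>\<^bsub>fun_cat C Ab\<^esub> \<tau>) X x = app \<sigma> X x \<otimes>\<^bsub>omap G X\<^esub> app \<tau> X x"
  using body_Ab(2)[OF assms(3) fun_cat_component[OF assms(1,2)]] assms(2) by (simp add: app_def)

lemma app_ident: "X \<in> Obj C \<Longrightarrow> x \<in> carrier (omap F X) \<Longrightarrow> app (Ident (fun_cat C Ab) F) X x = x"
  and app_zero: "X \<in> Obj C \<Longrightarrow> x \<in> carrier (omap F X) \<Longrightarrow> app (Zero (fun_cat C Ab) F G) X x = \<one>\<^bsub>omap G X\<^esub>"
  by (simp_all add: app_def body_Ab)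

text \<open>The pointwise inverses form a transformation: additivity and naturality can be checked
  after applying the injective components of \<tau>.\<close>

lemma trans_iso_if_bij:
  fixes F G :: "('o, 'a, 'u monoid, ('u monoid, 'u \<Rightarrow> 'u) arrow) ftor"
  assumes t: "\<tau> \<in> carrier (Hom (fun_cat C Ab) F G)"
    and bij: "\<And>X. X \<in> Obj C \<Longrightarrow> bij_betw (app \<tau> X) (carrier (omap F X)) (carrier (omap G X))"
  shows "is_iso (fun_cat C Ab) \<tau> F G"
proof -
  interpret N: preadditive "fun_cat C Ab" by (rule preadditive_AbFun)
  have F: "is_additive_functor C Ab F" and G: "is_additive_functor C Ab G"
    using trans_functors[OF t] by auto
  define s where "s X = inv_into (carrier (omap F X)) (app \<tau> X)" for X
  have s: "s X y \<in> carrier (omap F X)" "app \<tau> X (s X y) = y"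
    if "X \<in> Obj C" "y \<in> carrier (omap G X)" for X y
    using that bij[OF that(1)] unfolding s_def bij_betw_def
    by (auto intro: inv_into_into f_inv_into_f)
  have s': "s X (app \<tau> X x) = x" if "X \<in> Obj C" "x \<in> carrier (omap F X)" for X x
    using that bij[OF that(1)] unfolding s_def bij_betw_def by simp
  have inj: "x = y" if "X \<in> Obj C" "x \<in> carrier (omap F X)" "y \<in> carrier (omap F X)" "app \<tau> X x = app \<tau> X y" for X x y
    using s' that by metis
  let ?s = "trans_of C G F s"
  have S: "?s \<in> carrier (Hom (fun_cat C Ab) G F)"
  proof (rule trans_ofI[OF G F])
    show "s X \<in> hom (omap G X) (omap F X)" if X: "X \<in> Obj C" for X
    proof (rule homI)
      interpret group_hom "omap F X" "omap G X" "app \<tau> X" by (rule app_hom[OF t X])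
      show "s X y \<in> carrier (omap F X)" if "y \<in> carrier (omap G X)" for y
        using s(1)[OF X that] .
      show "s X (y \<otimes>\<^bsub>omap G X\<^esub> z) = s X y \<otimes>\<^bsub>omap F X\<^esub> s X z"
        if "y \<in> carrier (omap G X)" "z \<in> carrier (omap G X)" for y z
        by (rule inj[OF X]) (simp_all only: s[OF X] that hom_mult m_closed H.m_closed G.m_closed)
    qed
    show "s Y (act G f y) = act F f (s X y)"
      if f: "\<guillemotleft>f : X \<rightarrow> Y\<guillemotright>" and y: "y \<in> carrier (omap G X)" for X Y f y
    proof -
      have X: "X \<in> Obj C" and Y: "Y \<in> Obj C" using hom_objs[OF f] by auto
      show ?thesis
        using s[OF X y] s[OF Y act_closed[OF G f y]] app_natural[OF t f s(1)[OF X y]]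
          act_closed[OF F f s(1)[OF X y]] by - (rule inj[OF Y], simp_all)
    qed
  qed
  have "?s \<cdot>\<^bsub>fun_cat C Ab\<^esub> \<tau> = Ident (fun_cat C Ab) F"
    using F by (intro trans_eqI[OF N.comp[OF t S] N.ident]) (simp_all add: app_comp[OF t] app_closed[OF t] app_ident s')
  moreover have "\<tau> \<cdot>\<^bsub>fun_cat C Ab\<^esub> ?s = Ident (fun_cat C Ab) G"
    using G by (intro trans_eqI[OF N.comp[OF S t] N.ident]) (simp_all add: app_comp[OF S] app_ident s)
  ultimately show ?thesis
    unfolding is_iso_def using t S by blast
qed

end

text \<open>Each group law of \<open>B\<close> is the image of the same law of \<open>A\<close>.
  This serves for quotients, where \<open>f\<close> identifies elements, and for relabelled copies,
  where it is injective.\<close>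

lemma comm_group_image:
  assumes A: "comm_group A" and img: "f ` carrier A = carrier B"
    and mult: "\<And>x y. x \<in> carrier A \<Longrightarrow> y \<in> carrier A \<Longrightarrow> f (x \<otimes>\<^bsub>A\<^esub> y) = f x \<otimes>\<^bsub>B\<^esub> f y"
    and one: "f \<one>\<^bsub>A\<^esub> = \<one>\<^bsub>B\<^esub>"
  shows "comm_group B"
proof -
  interpret A: comm_group A by fact
  have ex: "\<exists>a\<in>carrier A. x = f a" if "x \<in> carrier B" for x using that img by blast
  have cl: "f a \<in> carrier B" if "a \<in> carrier A" for a using that img by blast
  show ?thesis
  proof (rule comm_groupI)
    fix x y assume "x \<in> carrier B" "y \<in> carrier B"
    then obtain a b where ab: "a \<in> carrier A" "b \<in> carrier A" "x = f a" "y = f b" using ex by meson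
    show "x \<otimes>\<^bsub>B\<^esub> y \<in> carrier B" using ab mult[symmetric] cl by simp
    show "x \<otimes>\<^bsub>B\<^esub> y = y \<otimes>\<^bsub>B\<^esub> x" using ab mult[symmetric] A.m_comm by simp
    fix z assume "z \<in> carrier B"
    then obtain c where "c \<in> carrier A" "z = f c" using ex by meson
    then show "x \<otimes>\<^bsub>B\<^esub> y \<otimes>\<^bsub>B\<^esub> z = x \<otimes>\<^bsub>B\<^esub> (y \<otimes>\<^bsub>B\<^esub> z)" using ab mult[symmetric] A.m_assoc by simp
  next
    show "\<one>\<^bsub>B\<^esub> \<in> carrier B" using one cl[OF A.one_closed] by simp
    fix x assume "x \<in> carrier B"
    then obtain a where a: "a \<in> carrier A" "x = f a" using ex by meson
    show "\<one>\<^bsub>B\<^esub> \<otimes>\<^bsub>B\<^esub> x = x" using a mult[OF A.one_closed a(1)] one by simp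
    have "f (inv\<^bsub>A\<^esub> a) \<otimes>\<^bsub>B\<^esub> x = \<one>\<^bsub>B\<^esub>" using a mult[of "inv\<^bsub>A\<^esub> a" a] one by simp
    then show "\<exists>y\<in>carrier B. y \<otimes>\<^bsub>B\<^esub> x = \<one>\<^bsub>B\<^esub>" using cl a by blast
  qed
qed

text \<open>Carried by representatives of the cosets, the quotient stays a group on the same type.\<close>

lemma (in comm_group) quotient_by_representatives:
  assumes N: "subgroup N G"
  obtains Q :: "('a) monoid" and r :: "'a \<Rightarrow> 'a" where
    "comm_group Q" "carrier Q \<subseteq> carrier G" "r \<in> hom G Q" "r ` carrier G = carrier Q"
    "\<And>x y. x \<in> carrier G \<Longrightarrow> y \<in> carrier G \<Longrightarrow> r x = r y \<longleftrightarrow> x \<otimes> inv y \<in> N"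
    "\<And>x. x \<in> carrier G \<Longrightarrow> r x = \<one>\<^bsub>Q\<^esub> \<longleftrightarrow> x \<in> N"
proof -
  interpret N: subgroup N G by fact
  \<comment> \<open>The chosen element depends on the coset as a set and not on \<open>x\<close>, so
    \<open>r\<close> is constant on cosets.\<close>
  define r where "r x = (SOME y. y \<in> N #> x)" for x
  have r1: "r x \<in> N #> x" if "x \<in> carrier G" for x
    unfolding r_def using rcos_self[OF that N] by (rule someI[where P = "\<lambda>y. y \<in> N #> x"])
  have rc: "r x \<in> carrier G" if "x \<in> carrier G" for x
    using r1[OF that] r_coset_subset_G[OF N.subset that] by blast
  have eq: "r x = r y \<longleftrightarrow> x \<otimes> inv y \<in> N" if x: "x \<in> carrier G" and y: "y \<in> carrier G" for x y
  proof
    assume "x \<otimes> inv y \<in> N"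
    moreover have "x = (x \<otimes> inv y) \<otimes> y" using x y by (simp add: m_assoc)
    ultimately have "x \<in> N #> y" unfolding r_coset_def by blast
    then have "N #> x = N #> y" using repr_independence[OF _ y N] by blast
    then show "r x = r y" by (simp add: r_def)
  next
    assume e: "r x = r y"
    obtain a where a: "a \<in> N" "r x = a \<otimes> x" using r1[OF x] unfolding r_coset_def by blast
    obtain b where b: "b \<in> N" "r y = b \<otimes> y" using r1[OF y] unfolding r_coset_def by blast
    have ab: "a \<in> carrier G" "b \<in> carrier G" using a b N.subset by auto
    have "x \<otimes> inv y = inv a \<otimes> (a \<otimes> x) \<otimes> inv y" using ab x y by (simp add: m_assoc[symmetric])
    also have "\<dots> = inv a \<otimes> (b \<otimes> y) \<otimes> inv y" using a b e by simp
    also have "\<dots> = inv a \<otimes> b" using ab y by (simp add: m_assoc)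
    finally show "x \<otimes> inv y \<in> N" using a b by simp
  qed
  have self: "r (r x) = r x" if x: "x \<in> carrier G" for x
  proof -
    obtain a where a: "a \<in> N" "r x = a \<otimes> x" using r1[OF x] unfolding r_coset_def by blast
    then have "a \<in> carrier G" using N.subset by auto
    then have "r x \<otimes> inv x = a" using a x by (simp add: m_assoc)
    then show ?thesis using eq[OF rc[OF x] x] a(1) by simp
  qed
  define Q where "Q = \<lparr>carrier = r ` carrier G, monoid.mult = (\<lambda>x y. r (x \<otimes> y)), one = r \<one>\<rparr>"
  have mult: "r (x \<otimes> y) = r x \<otimes>\<^bsub>Q\<^esub> r y" if x: "x \<in> carrier G" and y: "y \<in> carrier G" for x y
  proof -
    \<comment> \<open>Both factors differ from their representatives by elements of
      \<open>N\<close>, and commutativity collects the two differences.\<close>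
    have "x \<otimes> inv (r x) \<in> N" "y \<otimes> inv (r y) \<in> N"
      using eq[OF x rc[OF x]] eq[OF y rc[OF y]] self[OF x] self[OF y] by auto
    then have "(x \<otimes> inv (r x)) \<otimes> (y \<otimes> inv (r y)) \<in> N" by simp
    also have "(x \<otimes> inv (r x)) \<otimes> (y \<otimes> inv (r y)) = (x \<otimes> y) \<otimes> inv (r x \<otimes> r y)"
      using x y rc by (simp add: inv_mult m_ac)
    finally show ?thesis using eq[of "x \<otimes> y" "r x \<otimes> r y"] x y rc by (simp add: Q_def)
  qed
  show thesis
  proof
    show "comm_group Q"
      by (rule comm_group_image[OF comm_group_axioms, of r]) (auto simp: mult, auto simp: Q_def)
    show "carrier Q \<subseteq> carrier G" "r ` carrier G = carrier Q" using rc by (auto simp: Q_def)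
    show "r \<in> hom G Q" by (intro homI mult) (auto simp: Q_def)
    show "r x = r y \<longleftrightarrow> x \<otimes> inv y \<in> N" if "x \<in> carrier G" "y \<in> carrier G" for x y using eq that .
    show "r x = \<one>\<^bsub>Q\<^esub> \<longleftrightarrow> x \<in> N" if "x \<in> carrier G" for x
      using eq[of x \<one>] that by (simp add: Q_def)
  qed
qed

text \<open>Objectwise quotients by a subfunctor, with the action induced on classes. The projection
  records its kernel exactly, which is what makes the quotient a test object for cokernels.\<close>

lemma (in preadditive) quotient_functor:
  fixes F :: "('o, 'a, 'u monoid, ('u monoid, 'u \<Rightarrow> 'u) arrow) ftor"
  assumes F: "is_additive_functor C Ab F"
    and N: "\<And>X. X \<in> Obj C \<Longrightarrow> subgroup (N X) (omap F X)"
    and stable: "\<And>X Y f x. \<guillemotleft>f : X \<rightarrow> Y\<guillemotright> \<Longrightarrow> x \<in> N X \<Longrightarrow> act F f x \<in> N Y"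
  obtains Q q where "q \<in> carrier (Hom (fun_cat C Ab) F Q)"
    "\<And>X x. X \<in> Obj C \<Longrightarrow> x \<in> carrier (omap F X) \<Longrightarrow> app q X x = \<one>\<^bsub>omap Q X\<^esub> \<longleftrightarrow> x \<in> N X"
proof -
  \<comment> \<open>The carrier is kept inside that of \<open>omap F X\<close> so that the quotient
    is small.\<close>
  define quot where "quot X Q r \<longleftrightarrow> comm_group Q \<and> carrier Q \<subseteq> carrier (omap F X) \<and>
      r \<in> hom (omap F X) Q \<and> r ` carrier (omap F X) = carrier Q \<and>
      (\<forall>x\<in>carrier (omap F X). \<forall>y\<in>carrier (omap F X). r x = r y \<longleftrightarrow> x \<otimes>\<^bsub>omap F X\<^esub> inv\<^bsub>omap F X\<^esub> y \<in> N X) \<and>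
      (\<forall>x\<in>carrier (omap F X). r x = \<one>\<^bsub>Q\<^esub> \<longleftrightarrow> x \<in> N X)" for X and Q :: "'u monoid" and r
  have "\<forall>X\<in>Obj C. \<exists>Q r. quot X Q r"
  proof
    fix X assume X: "X \<in> Obj C"
    interpret comm_group "omap F X" by (rule functor_group[OF F X])
    show "\<exists>Q r. quot X Q r"
    proof (rule quotient_by_representatives[OF N[OF X]])
      fix Q :: "'u monoid" and r
      assume "comm_group Q" "carrier Q \<subseteq> carrier (omap F X)" "r \<in> hom (omap F X) Q"
        "r ` carrier (omap F X) = carrier Q"
        "\<And>x y. x \<in> carrier (omap F X) \<Longrightarrow> y \<in> carrier (omap F X) \<Longrightarrow>
           r x = r y \<longleftrightarrow> x \<otimes>\<^bsub>omap F X\<^esub> inv\<^bsub>omap F X\<^esub> y \<in> N X"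
        "\<And>x. x \<in> carrier (omap F X) \<Longrightarrow> r x = \<one>\<^bsub>Q\<^esub> \<longleftrightarrow> x \<in> N X"
      then have "quot X Q r" unfolding quot_def by blast
      then show "\<exists>Q r. quot X Q r" by blast
    qed
  qed
  then obtain O' r where q: "\<And>X. X \<in> Obj C \<Longrightarrow> quot X (O' X) (r X)" by metis
  have Q: "comm_group (O' X)" "carrier (O' X) \<subseteq> carrier (omap F X)"
    and r: "r X \<in> hom (omap F X) (O' X)" "r X ` carrier (omap F X) = carrier (O' X)"
    if "X \<in> Obj C" for X
    using q[OF that] by (simp_all add: quot_def)
  have eq: "r X x = r X y \<longleftrightarrow> x \<otimes>\<^bsub>omap F X\<^esub> inv\<^bsub>omap F X\<^esub> y \<in> N X"
    if "X \<in> Obj C" "x \<in> carrier (omap F X)" "y \<in> carrier (omap F X)" for X x y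
    using q[OF that(1), unfolded quot_def, THEN conjunct2, THEN conjunct2, THEN conjunct2, THEN conjunct2, THEN conjunct1] that(2,3) by (elim ballE) auto
  have one: "r X x = \<one>\<^bsub>O' X\<^esub> \<longleftrightarrow> x \<in> N X" if "X \<in> Obj C" "x \<in> carrier (omap F X)" for X x
    using q[OF that(1), unfolded quot_def, THEN conjunct2, THEN conjunct2, THEN conjunct2, THEN conjunct2, THEN conjunct2] that(2) by (elim ballE) auto
  \<comment> \<open>A set-theoretic section. The action defined through it does not depend on its
    choice, as \<open>push\<close> shows below.\<close>
  define s where "s X y = (SOME x. x \<in> carrier (omap F X) \<and> r X x = y)" for X y
  have s: "s X y \<in> carrier (omap F X)" "r X (s X y) = y" if "X \<in> Obj C" "y \<in> carrier (O' X)" for X y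
  proof -
    have "\<exists>x. x \<in> carrier (omap F X) \<and> r X x = y" using r(2)[OF that(1)] that(2) by (metis imageE)
    then have "s X y \<in> carrier (omap F X) \<and> r X (s X y) = y"
      unfolding s_def by (rule someI_ex)
    then show "s X y \<in> carrier (omap F X)" "r X (s X y) = y" by auto
  qed
  define a where "a f y = r (Cod C f) (act F f (s (Dom C f) y))" for f y
  define Q where "Q = \<lparr>omap = O', amap = (\<lambda>f. Arrow (O' (Dom C f)) (O' (Cod C f)) (\<lambda>y\<in>carrier (O' (Dom C f)). a f y))\<rparr>"
  have omapQ [simp]: "omap Q = O'" by (simp add: Q_def)
  have rin: "r X x \<in> carrier (O' X)" if "X \<in> Obj C" "x \<in> carrier (omap F X)" for X x
    using r(2)[OF that(1)] that(2) by (metis imageI)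
  \<comment> \<open>Well-definedness: the action on a class may be computed on any representative,
    since \<open>N\<close> is stable under the action.\<close>
  have push: "a f (r X x) = r Y (act F f x)" if f: "\<guillemotleft>f : X \<rightarrow> Y\<guillemotright>" and x: "x \<in> carrier (omap F X)" for X Y f x
  proof -
    have X: "X \<in> Obj C" and Y: "Y \<in> Obj C" using hom_objs[OF f] by auto
    note sx = s[OF X rin[OF X x]]
    interpret FX: comm_group "omap F X" by (rule functor_group[OF F X])
    interpret group_hom "omap F X" "omap F Y" "act F f" by (rule act_hom[OF F f])
    have "s X (r X x) \<otimes>\<^bsub>omap F X\<^esub> inv\<^bsub>omap F X\<^esub> x \<in> N X" using eq[OF X sx(1) x] sx(2) by simp
    then have "act F f (s X (r X x)) \<otimes>\<^bsub>omap F Y\<^esub> inv\<^bsub>omap F Y\<^esub> act F f x \<in> N Y"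
      using stable[OF f] sx(1) x by fastforce
    then have "r Y (act F f (s X (r X x))) = r Y (act F f x)"
      using eq[OF Y] sx(1) x by simp
    then show ?thesis using f by (simp add: a_def in_hom_iff)
  qed
  have rep: "\<exists>x\<in>carrier (omap F X). y = r X x" if "X \<in> Obj C" "y \<in> carrier (O' X)" for X y
    using s that by metis
  have rmult: "r X (x \<otimes>\<^bsub>omap F X\<^esub> y) = r X x \<otimes>\<^bsub>O' X\<^esub> r X y"
    if "X \<in> Obj C" "x \<in> carrier (omap F X)" "y \<in> carrier (omap F X)" for X x y
    using r(1) that by (simp add: hom_def)
  have QF: "is_additive_functor C Ab Q"
  proof (rule additive_functorI[where a = a, OF preadditive_axioms]; (unfold omapQ)?)
    show "comm_group (O' X)" if "X \<in> Obj C" for X using Q(1) that .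
    show "small TYPE('u) (carrier (O' X))" if "X \<in> Obj C" for X
      using small_lepoll[OF functor_small[OF F that] subset_imp_lepoll[OF Q(2)[OF that]]] .
    show "amap Q f = Arrow (O' X) (O' Y) (\<lambda>y\<in>carrier (O' X). a f y)" if "\<guillemotleft>f : X \<rightarrow> Y\<guillemotright>" for X Y f
      using that by (simp add: Q_def in_hom_iff)
    show "a f \<in> hom (O' X) (O' Y)" if f: "\<guillemotleft>f : X \<rightarrow> Y\<guillemotright>" for X Y f
    proof -
      have X: "X \<in> Obj C" and Y: "Y \<in> Obj C" using hom_objs[OF f] by auto
      interpret group_hom "omap F X" "omap F Y" "act F f" by (rule act_hom[OF F f])
      show ?thesis
      proof (rule homI)
        fix y assume "y \<in> carrier (O' X)"
        then obtain x where x: "x \<in> carrier (omap F X)" "y = r X x" using rep[OF X] by blast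
        show "a f y \<in> carrier (O' Y)" using x push[OF f x(1)] rin[OF Y] by simp
        fix z assume "z \<in> carrier (O' X)"
        then obtain w where w: "w \<in> carrier (omap F X)" "z = r X w" using rep[OF X] by blast
        show "a f (y \<otimes>\<^bsub>O' X\<^esub> z) = a f y \<otimes>\<^bsub>O' Y\<^esub> a f z"
          using push[OF f] x w by (simp add: rmult[OF X, symmetric] rmult[OF Y, symmetric])
      qed
    qed
    show "a (Ident C X) y = y" if X: "X \<in> Obj C" and y: "y \<in> carrier (O' X)" for X y
    proof -
      obtain x where x: "x \<in> carrier (omap F X)" "y = r X x" using rep[OF X y] by blast
      show ?thesis using push[OF ident[OF X] x(1)] x act_ident[OF F X x(1)] by simp
    qed
    show "a (g \<cdot> f) y = a g (a f y)"
      if f: "\<guillemotleft>f : X \<rightarrow> Y\<guillemotright>" and g: "\<guillemotleft>g : Y \<rightarrow> Z\<guillemotright>" and y: "y \<in> carrier (O' X)" for X Y Z f g y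
    proof -
      obtain x where x: "x \<in> carrier (omap F X)" "y = r X x" using rep[OF _ y] hom_objs[OF f] by blast
      show ?thesis
        using push[OF comp[OF f g] x(1)] push[OF f x(1)] push[OF g act_closed[OF F f x(1)]] x(2)
          act_comp[OF F f g x(1)] by simp
    qed
    show "a (f \<boxplus> g) y = a f y \<otimes>\<^bsub>O' Y\<^esub> a g y"
      if f: "\<guillemotleft>f : X \<rightarrow> Y\<guillemotright>" and g: "\<guillemotleft>g : X \<rightarrow> Y\<guillemotright>" and y: "y \<in> carrier (O' X)" for X Y f g y
    proof -
      have Y: "Y \<in> Obj C" using hom_objs[OF f] by auto
      obtain x where x: "x \<in> carrier (omap F X)" "y = r X x" using rep[OF _ y] hom_objs[OF f] by blast
      show ?thesis
        using push[OF add_in_hom[OF f g] x(1)] push[OF f x(1)] push[OF g x(1)] x(2)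
          act_add[OF F f g x(1)] rmult[OF Y act_closed[OF F f x(1)] act_closed[OF F g x(1)]] by simp
    qed
  qed
  have actQ: "act Q f y = a f y" if "\<guillemotleft>f : X \<rightarrow> Y\<guillemotright>" "y \<in> carrier (O' X)" for X Y f y
    using that by (simp add: act_def Q_def in_hom_iff)
  have "trans_of C F Q r \<in> carrier (Hom (fun_cat C Ab) F Q)"
  proof (rule trans_ofI[OF F QF])
    show "r X \<in> hom (omap F X) (omap Q X)" if "X \<in> Obj C" for X using r(1) that by simp
    show "r Y (act F f x) = act Q f (r X x)" if f: "\<guillemotleft>f : X \<rightarrow> Y\<guillemotright>" and x: "x \<in> carrier (omap F X)" for X Y f x
      using push[OF f x] actQ[OF f rin[OF _ x]] hom_objs[OF f] by simp
  qed
  moreover have "app (trans_of C F Q r) X x = \<one>\<^bsub>omap Q X\<^esub> \<longleftrightarrow> x \<in> N X"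
    if "X \<in> Obj C" "x \<in> carrier (omap F X)" for X x
    using one that by simp
  ultimately show thesis using that by blast
qed

section \<open>Representable and finitely presented functors\<close>

text \<open>Arrows have the same type \<open>'u\<close> as the elements of the groups in
  \<open>Ab\<close>, so a hom-group is itself an object of \<open>Ab\<close> as soon as it is
  small.\<close>

locale locally_small_category = preadditive C for C :: "('o, 'u, 'm) cat_scheme" (structure) +
  assumes hom_small: "\<lbrakk>X \<in> Obj C; Y \<in> Obj C\<rbrakk> \<Longrightarrow> small TYPE('u) (carrier (Hom C X Y))"
begin

lemma omap_hom_ftor [simp]: "omap (hom_ftor C X) = Hom C X"
  by (simp add: hom_ftor_def)

lemma act_hom_ftor:
  "\<guillemotleft>f : Y \<rightarrow> Z\<guillemotright> \<Longrightarrow> \<guillemotleft>g : X \<rightarrow> Y\<guillemotright> \<Longrightarrow> act (hom_ftor C X) f g = f \<cdot> g"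
  by (simp add: act_def hom_ftor_def in_hom_iff)

lemma hom_ftor_additive:
  assumes X: "X \<in> Obj C"
  shows "is_additive_functor C Ab (hom_ftor C X)"
proof (rule additive_functorI[where a = "\<lambda>f g. f \<cdot> g", OF preadditive_axioms])
  show "(\<lambda>g. f \<cdot> g) \<in> hom (omap (hom_ftor C X) Y) (omap (hom_ftor C X) Z)" if "\<guillemotleft>f : Y \<rightarrow> Z\<guillemotright>" for Y Z f
    using group_hom.homh[OF comp_left_hom[OF that X]] by simp
  show "amap (hom_ftor C X) f = Arrow (omap (hom_ftor C X) Y) (omap (hom_ftor C X) Z)
      (\<lambda>g\<in>carrier (omap (hom_ftor C X) Y). f \<cdot> g)" if "\<guillemotleft>f : Y \<rightarrow> Z\<guillemotright>" for Y Z f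
    using that by (simp add: in_hom_iff hom_ftor_def)
qed (use hom_group hom_small X in \<open>auto intro: ident_left assoc distrib_right\<close>)

lemma hom_trans_eq:
  "\<guillemotleft>f : X \<rightarrow> Y\<guillemotright> \<Longrightarrow> hom_trans C (Obj C) f = trans_of C (hom_ftor C Y) (hom_ftor C X) (\<lambda>Z g. g \<cdot> f)"
  by (simp add: hom_trans_def trans_of_def in_hom_iff)

lemma hom_trans_in_hom:
  assumes f: "\<guillemotleft>f : X \<rightarrow> Y\<guillemotright>"
  shows "hom_trans C (Obj C) f \<in> carrier (Hom (AbFun C) (hom_ftor C Y) (hom_ftor C X))"
  unfolding hom_trans_eq[OF f]
proof (rule trans_ofI)
  show "(\<lambda>g. g \<cdot> f) \<in> hom (omap (hom_ftor C Y) Z) (omap (hom_ftor C X) Z)" if "Z \<in> Obj C" for Z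
    using group_hom.homh[OF comp_right_hom[OF f that]] by simp
  show "act (hom_ftor C Y) k g \<cdot> f = act (hom_ftor C X) k (g \<cdot> f)"
    if k: "\<guillemotleft>k : Z \<rightarrow> W\<guillemotright>" and "g \<in> carrier (omap (hom_ftor C Y) Z)" for Z W k g
  proof -
    have g: "\<guillemotleft>g : Y \<rightarrow> Z\<guillemotright>" using that by simp
    show ?thesis using act_hom_ftor[OF k g] act_hom_ftor[OF k comp[OF f g]] assoc[OF f g k] by simp
  qed
qed (use hom_objs[OF f] hom_ftor_additive in auto)

lemma app_hom_trans:
  assumes "\<guillemotleft>f : X \<rightarrow> Y\<guillemotright>" "\<guillemotleft>g : Y \<rightarrow> Z\<guillemotright>"
  shows "app (hom_trans C (Obj C) f) Z g = g \<cdot> f"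
  using assms hom_objs[OF assms(2)] by (simp add: hom_trans_eq[OF assms(1)])

lemma hom_trans_add:
  assumes f: "\<guillemotleft>f : X \<rightarrow> Y\<guillemotright>" and g: "\<guillemotleft>g : X \<rightarrow> Y\<guillemotright>"
  shows "hom_trans C (Obj C) (f \<boxplus> g) = hom_trans C (Obj C) f \<boxplus>\<^bsub>AbFun C\<^esub> hom_trans C (Obj C) g"
proof -
  interpret N: preadditive "AbFun C" by (rule preadditive_AbFun)
  show ?thesis
    using distrib_left[OF f g]
    by (intro trans_eqI[OF hom_trans_in_hom[OF add_in_hom[OF f g]] N.add_in_hom[OF hom_trans_in_hom[OF f] hom_trans_in_hom[OF g]]])
      (simp add: app_add[OF hom_trans_in_hom[OF f]] app_hom_trans[OF f] app_hom_trans[OF g] app_hom_trans[OF add_in_hom[OF f g]])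
qed

lemma hom_embed_functor: "is_functor (op C) (AbFun C) (hom_embed C)"
proof -
  interpret N: preadditive "AbFun C" by (rule preadditive_AbFun)
  have "hom_trans C (Obj C) (Ident C X) = Ident (AbFun C) (hom_ftor C X)" if X: "X \<in> Obj C" for X
    using hom_ftor_additive[OF X] ident_right
    by (intro trans_eqI[OF hom_trans_in_hom[OF ident[OF X]] N.ident]) (simp_all add: app_hom_trans[OF ident[OF X]] app_ident)
  moreover have "hom_trans C (Obj C) (g \<cdot> f) = hom_trans C (Obj C) f \<cdot>\<^bsub>AbFun C\<^esub> hom_trans C (Obj C) g"
    if f: "\<guillemotleft>f : X \<rightarrow> Y\<guillemotright>" and g: "\<guillemotleft>g : Y \<rightarrow> Z\<guillemotright>" for X Y Z f g
    using assoc[OF f g] app_hom_trans[OF f comp[OF g]]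
    by (intro trans_eqI[OF hom_trans_in_hom[OF comp[OF f g]] N.comp[OF hom_trans_in_hom[OF g] hom_trans_in_hom[OF f]]])
      (simp add: app_comp[OF hom_trans_in_hom[OF g]] app_hom_trans[OF g] app_hom_trans[OF comp[OF f g]])
  ultimately show ?thesis
    using hom_ftor_additive hom_trans_in_hom by (simp add: is_functor_def hom_embed_def) blast
qed

text \<open>Naturality along \<open>g\<close>, applied to the identity of \<open>X\<close>.\<close>

lemma yoneda:
  assumes s: "\<sigma> \<in> carrier (Hom (AbFun C) (hom_ftor C X) F)" and g: "\<guillemotleft>g : X \<rightarrow> Y\<guillemotright>"
  shows "app \<sigma> Y g = act F g (app \<sigma> X (Ident C X))"
proof -
  have i: "\<guillemotleft>Ident C X : X \<rightarrow> X\<guillemotright>" using ident hom_objs[OF g] by blast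
  show ?thesis
    using app_natural[OF s g, of "Ident C X"] i act_hom_ftor[OF g i] ident_right[OF g] by simp
qed

text \<open>The converse construction in the Yoneda lemma; additivity in \<open>g\<close> is
  additivity of the functor \<open>F\<close>.\<close>

lemma yoneda_trans:
  assumes F: "is_additive_functor C Ab F" and X: "X \<in> Obj C" and a: "a \<in> carrier (omap F X)"
  shows "trans_of C (hom_ftor C X) F (\<lambda>Y g. act F g a) \<in> carrier (Hom (AbFun C) (hom_ftor C X) F)"
proof (rule trans_ofI[OF hom_ftor_additive[OF X] F])
  show "(\<lambda>g. act F g a) \<in> hom (omap (hom_ftor C X) Y) (omap F Y)" for Y
    using act_closed[OF F _ a] act_add[OF F _ _ a] by (intro homI) simp_all
  show "act F (act (hom_ftor C X) f g) a = act F f (act F g a)"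
    if f: "\<guillemotleft>f : Y \<rightarrow> Z\<guillemotright>" and "g \<in> carrier (omap (hom_ftor C X) Y)" for Y Z f g
    using act_hom_ftor[OF f] act_comp[OF F _ f a] that by simp
qed

text \<open>\<open>presented F f a\<close> says that the Yoneda map \<open>Hom(A,-) \<rightarrow> F\<close> of \<open>a \<in> F(A)\<close> is, objectwise, a
  cokernel of \<open>Hom(f,-)\<close>, where \<open>f : A \<rightarrow> B\<close>.\<close>

definition presented :: "('o, 'u) abftor \<Rightarrow> 'u \<Rightarrow> 'u \<Rightarrow> bool" where
  "presented F f a \<longleftrightarrow> f \<in> Arr C \<and> is_additive_functor C Ab F \<and> a \<in> carrier (omap F (Dom C f)) \<and>
     (\<forall>X\<in>Obj C. \<forall>x\<in>carrier (omap F X). \<exists>u. \<guillemotleft>u : Dom C f \<rightarrow> X\<guillemotright> \<and> x = act F u a) \<and>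
     (\<forall>X u. \<guillemotleft>u : Dom C f \<rightarrow> X\<guillemotright> \<longrightarrow>
        (act F u a = \<one>\<^bsub>omap F X\<^esub> \<longleftrightarrow> (\<exists>w. \<guillemotleft>w : Cod C f \<rightarrow> X\<guillemotright> \<and> u = w \<cdot> f)))"

text \<open>The universal property is tested on two quotient functors. The projection of F modulo
  the image of \<open>p\<close> must vanish, so \<open>p\<close> is objectwise onto. The projection
  of Hom(A,-) modulo the image of Hom(f,-) factors through \<open>p\<close>, so the kernel of
  \<open>p\<close> is no larger than that image. Yoneda turns both facts into statements about the
  image of the identity of \<open>A\<close>.\<close>

lemma cokernel_presented:
  assumes f: "\<guillemotleft>f : A \<rightarrow> B\<guillemotright>" and coker: "is_cokernel (AbFun C) p (hom_trans C (Obj C) f)"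
  shows "presented (target p) f (app p A (Ident C A))"
proof -
  interpret N: preadditive "AbFun C" by (rule preadditive_AbFun)
  define F where "F = target p"
  have A: "A \<in> Obj C" and B: "B \<in> Obj C" using hom_objs[OF f] by auto
  note hf = hom_trans_in_hom[OF f]
  have src: "source (hom_trans C (Obj C) f) = hom_ftor C B" "target (hom_trans C (Obj C) f) = hom_ftor C A"
    using hf by (auto simp: in_hom_fun_cat)
  have p: "p \<in> carrier (Hom (AbFun C) (hom_ftor C A) F)"
    and pf: "p \<cdot>\<^bsub>AbFun C\<^esub> hom_trans C (Obj C) f = Zero (AbFun C) (hom_ftor C B) F"
    using coker src by (auto simp: is_cokernel_def is_kernel_def in_hom_iff F_def)
  have univ: "\<exists>!l. l \<in> carrier (Hom (AbFun C) F G) \<and> l \<cdot>\<^bsub>AbFun C\<^esub> p = h"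
    if "h \<in> carrier (Hom (AbFun C) (hom_ftor C A) G)"
      "h \<cdot>\<^bsub>AbFun C\<^esub> hom_trans C (Obj C) f = Zero (AbFun C) (hom_ftor C B) G" for G h
    using coker src that by (auto simp: is_cokernel_def is_kernel_def F_def)
  have F: "is_additive_functor C Ab F" using trans_functors[OF p] by simp
  let ?a = "app p A (Ident C A)"
  have a: "?a \<in> carrier (omap F A)" using app_closed[OF p A] ident[OF A] by simp
  note y = yoneda[OF p]
  have surj: "\<exists>u. \<guillemotleft>u : A \<rightarrow> X\<guillemotright> \<and> x = act F u ?a" if X: "X \<in> Obj C" and x: "x \<in> carrier (omap F X)" for X x
  proof -
    let ?N = "\<lambda>X. app p X ` carrier (Hom C A X)"
    obtain Q q where q: "q \<in> carrier (Hom (AbFun C) F Q)"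
      and ker: "\<And>X x. X \<in> Obj C \<Longrightarrow> x \<in> carrier (omap F X) \<Longrightarrow> app q X x = \<one>\<^bsub>omap Q X\<^esub> \<longleftrightarrow> x \<in> ?N X"
    proof (rule quotient_functor[OF F, of ?N])
      show "subgroup (?N X) (omap F X)" if "X \<in> Obj C" for X
        using group_hom.img_is_subgroup[OF app_hom[OF p that]] by simp
      show "act F k x \<in> ?N Y" if k: "\<guillemotleft>k : X \<rightarrow> Y\<guillemotright>" and x: "x \<in> ?N X" for X Y k x
      proof -
        obtain g where g: "\<guillemotleft>g : A \<rightarrow> X\<guillemotright>" "x = app p X g" using x by blast
        have "act F k x = app p Y (k \<cdot> g)"
          using app_natural[OF p k, of g] g act_hom_ftor[OF k g(1)] by simp
        then show ?thesis using comp[OF g(1) k] by blast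
      qed
    qed blast
    have Q: "is_additive_functor C Ab Q" using trans_functors[OF q] by simp
    have z: "Zero (AbFun C) F Q \<in> carrier (Hom (AbFun C) F Q)" using F Q by (intro N.zero_in_hom) auto
    have zp: "Zero (AbFun C) F Q \<cdot>\<^bsub>AbFun C\<^esub> p = Zero (AbFun C) (hom_ftor C A) Q"
      using N.zero_comp[OF p] Q by simp
    \<comment> \<open>\<open>q\<close> and the zero map agree after \<open>p\<close>, so uniqueness
      in the universal property makes \<open>q\<close> zero and every element of F lies in the image
      of \<open>p\<close>.\<close>
    have "q \<cdot>\<^bsub>AbFun C\<^esub> p = Zero (AbFun C) (hom_ftor C A) Q"
    proof (rule trans_eqI[OF N.comp[OF p q]])
      show "Zero (AbFun C) (hom_ftor C A) Q \<in> carrier (Hom (AbFun C) (hom_ftor C A) Q)"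
        using hom_ftor_additive[OF A] Q by (intro N.zero_in_hom) auto
      show "app (q \<cdot>\<^bsub>AbFun C\<^esub> p) Y g = app (Zero (AbFun C) (hom_ftor C A) Q) Y g"
        if "Y \<in> Obj C" "g \<in> carrier (omap (hom_ftor C A) Y)" for Y g
        using that ker[OF that(1) app_closed[OF p that]] by (simp add: app_comp[OF p] app_zero)
    qed
    moreover have "\<exists>!l. l \<in> carrier (Hom (AbFun C) F Q) \<and> l \<cdot>\<^bsub>AbFun C\<^esub> p = Zero (AbFun C) (hom_ftor C A) Q"
      using hom_ftor_additive[OF A] Q N.zero_comp[OF hf] by (intro univ N.zero_in_hom) auto
    ultimately have "q = Zero (AbFun C) F Q" using q z zp by blast
    then have "app q X x = \<one>\<^bsub>omap Q X\<^esub>" using app_zero[OF X x] by simp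
    then show ?thesis using ker[OF X x] y by auto
  qed
  have kernel: "act F u ?a = \<one>\<^bsub>omap F X\<^esub> \<longleftrightarrow> (\<exists>w. \<guillemotleft>w : B \<rightarrow> X\<guillemotright> \<and> u = w \<cdot> f)"
    if u: "\<guillemotleft>u : A \<rightarrow> X\<guillemotright>" for X u
  proof
    have X: "X \<in> Obj C" using hom_objs[OF u] by simp
    {
      assume "\<exists>w. \<guillemotleft>w : B \<rightarrow> X\<guillemotright> \<and> u = w \<cdot> f"
      then obtain w where w: "\<guillemotleft>w : B \<rightarrow> X\<guillemotright>" "u = w \<cdot> f" by blast
      have "app p X u = app (p \<cdot>\<^bsub>AbFun C\<^esub> hom_trans C (Obj C) f) X w"
        using app_comp[OF hf X] w app_hom_trans[OF f w(1)] by simp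
      then show "act F u ?a = \<one>\<^bsub>omap F X\<^esub>"
        using pf app_zero[OF X, of w "hom_ftor C B" F] w y[OF u] by simp
    }
    assume "act F u ?a = \<one>\<^bsub>omap F X\<^esub>"
    then have pu: "app p X u = \<one>\<^bsub>omap F X\<^esub>" using y[OF u] by simp
    let ?N = "\<lambda>X. (\<lambda>w. w \<cdot> f) ` carrier (Hom C B X)"
    obtain Q q where q: "q \<in> carrier (Hom (AbFun C) (hom_ftor C A) Q)"
      and ker: "\<And>X x. X \<in> Obj C \<Longrightarrow> x \<in> carrier (omap (hom_ftor C A) X) \<Longrightarrow>
        app q X x = \<one>\<^bsub>omap Q X\<^esub> \<longleftrightarrow> x \<in> ?N X"
    proof (rule quotient_functor[OF hom_ftor_additive[OF A], of ?N])
      show "subgroup (?N X) (omap (hom_ftor C A) X)" if "X \<in> Obj C" for X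
        using group_hom.img_is_subgroup[OF comp_right_hom[OF f that]] by simp
      show "act (hom_ftor C A) k x \<in> ?N Y" if k: "\<guillemotleft>k : X \<rightarrow> Y\<guillemotright>" and x: "x \<in> ?N X" for X Y k x
      proof -
        obtain w where w: "\<guillemotleft>w : B \<rightarrow> X\<guillemotright>" "x = w \<cdot> f" using x by blast
        have "act (hom_ftor C A) k x = (k \<cdot> w) \<cdot> f"
          using w act_hom_ftor[OF k comp[OF f w(1)]] assoc[OF f w(1) k] by simp
        then show ?thesis using comp[OF w(1) k] by blast
      qed
    qed blast
    have Q: "is_additive_functor C Ab Q" using trans_functors[OF q] by simp
    have "q \<cdot>\<^bsub>AbFun C\<^esub> hom_trans C (Obj C) f = Zero (AbFun C) (hom_ftor C B) Q"
    proof (rule trans_eqI[OF N.comp[OF hf q]])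
      show "Zero (AbFun C) (hom_ftor C B) Q \<in> carrier (Hom (AbFun C) (hom_ftor C B) Q)"
        using hom_ftor_additive[OF B] Q by (intro N.zero_in_hom) auto
      show "app (q \<cdot>\<^bsub>AbFun C\<^esub> hom_trans C (Obj C) f) Y w = app (Zero (AbFun C) (hom_ftor C B) Q) Y w"
        if "Y \<in> Obj C" "w \<in> carrier (omap (hom_ftor C B) Y)" for Y w
        using that ker[OF that(1), of "w \<cdot> f"] comp[OF f, of w Y]
        by (simp add: app_comp[OF hf] app_hom_trans[OF f] app_zero)
    qed
    \<comment> \<open>Since \<open>q\<close> factors through \<open>p\<close>, it kills whatever
      \<open>p\<close> kills; as \<open>q\<close> detects the image of Hom(f,-), \<open>u\<close>
      lies in it.\<close>
    then obtain l where l: "l \<in> carrier (Hom (AbFun C) F Q)" "l \<cdot>\<^bsub>AbFun C\<^esub> p = q"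
      using univ[OF q] by blast
    have "app q X u = app l X (app p X u)"
      using app_comp[OF p X, of u l] u l(2) by simp
    also have "\<dots> = \<one>\<^bsub>omap Q X\<^esub>" using pu group_hom.hom_one[OF app_hom[OF l(1) X]] by simp
    finally show "\<exists>w. \<guillemotleft>w : B \<rightarrow> X\<guillemotright> \<and> u = w \<cdot> f" using ker[OF X] u by auto
  qed
  show ?thesis
    unfolding presented_def F_def[symmetric]
    using f F a surj kernel by (auto simp: in_hom_iff)
qed

lemma presentedD:
  assumes "presented F f a"
  shows "\<guillemotleft>f : Dom C f \<rightarrow> Cod C f\<guillemotright>" "is_additive_functor C Ab F" "a \<in> carrier (omap F (Dom C f))"
    "\<And>X x. X \<in> Obj C \<Longrightarrow> x \<in> carrier (omap F X) \<Longrightarrow> \<exists>u. \<guillemotleft>u : Dom C f \<rightarrow> X\<guillemotright> \<and> x = act F u a"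
    "\<And>X u. \<guillemotleft>u : Dom C f \<rightarrow> X\<guillemotright> \<Longrightarrow>
       act F u a = \<one>\<^bsub>omap F X\<^esub> \<longleftrightarrow> (\<exists>w. \<guillemotleft>w : Cod C f \<rightarrow> X\<guillemotright> \<and> u = w \<cdot> f)"
  using assms unfolding presented_def by (auto simp: in_hom_iff)

text \<open>\<open>f\<close> factors through itself by the identity, so it lies in the kernel of the
  presenting map.\<close>

lemma presented_relation:
  assumes pres: "presented F f a"
  shows "act F f a = \<one>\<^bsub>omap F (Cod C f)\<^esub>"
  using presentedD(5)[OF pres presentedD(1)[OF pres]] ident_left[OF presentedD(1)[OF pres]]
    ident hom_objs[OF presentedD(1)[OF pres]] by metis

text \<open>Every element of F has the form \<open>act F u a\<close>, so a natural map is fixed by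
  its value at the generator \<open>a\<close>.\<close>

lemma presented_unique:
  assumes pres: "presented F f a"
    and s: "\<sigma> \<in> carrier (Hom (AbFun C) F G)" and t: "\<tau> \<in> carrier (Hom (AbFun C) F G)"
    and e: "app \<sigma> (Dom C f) a = app \<tau> (Dom C f) a"
  shows "\<sigma> = \<tau>"
proof (rule trans_eqI[OF s t])
  fix X x assume "X \<in> Obj C" "x \<in> carrier (omap F X)"
  then obtain u where u: "\<guillemotleft>u : Dom C f \<rightarrow> X\<guillemotright>" "x = act F u a" using presentedD(4)[OF pres] by blast
  show "app \<sigma> X x = app \<tau> X x"
    using app_natural[OF s u(1) presentedD(3)[OF pres]] app_natural[OF t u(1) presentedD(3)[OF pres]] e u(2) by simp
qed

text \<open>A map out of F amounts to an element of G(A) satisfying the defining relation. It sends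
  \<open>act F u a\<close> to \<open>act G u b\<close>; for two choices of \<open>u\<close> the
  difference factors through \<open>f\<close>, and the relation on \<open>b\<close> annihilates
  it.\<close>

lemma presented_lift:
  assumes pres: "presented F f a" and G: "is_additive_functor C Ab G"
    and b: "b \<in> carrier (omap G (Dom C f))" and rel: "act G f b = \<one>\<^bsub>omap G (Cod C f)\<^esub>"
  obtains \<sigma> where "\<sigma> \<in> carrier (Hom (AbFun C) F G)" "app \<sigma> (Dom C f) a = b"
proof -
  define A B where "A = Dom C f" and "B = Cod C f"
  have f: "\<guillemotleft>f : A \<rightarrow> B\<guillemotright>" and F: "is_additive_functor C Ab F" and a: "a \<in> carrier (omap F A)"
    and surj: "\<And>X x. X \<in> Obj C \<Longrightarrow> x \<in> carrier (omap F X) \<Longrightarrow> \<exists>u. \<guillemotleft>u : A \<rightarrow> X\<guillemotright> \<and> x = act F u a"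
    and ker: "\<And>X u. \<guillemotleft>u : A \<rightarrow> X\<guillemotright> \<Longrightarrow> act F u a = \<one>\<^bsub>omap F X\<^esub> \<longleftrightarrow> (\<exists>w. \<guillemotleft>w : B \<rightarrow> X\<guillemotright> \<and> u = w \<cdot> f)"
    using presentedD[OF pres] unfolding A_def B_def by auto
  have A: "A \<in> Obj C" and B: "B \<in> Obj C" using hom_objs[OF f] by auto
  have b: "b \<in> carrier (omap G A)" and rel: "act G f b = \<one>\<^bsub>omap G B\<^esub>"
    using b rel by (auto simp: A_def B_def)
  define p h where "p = trans_of C (hom_ftor C A) F (\<lambda>Y g. act F g a)"
    and "h = trans_of C (hom_ftor C A) G (\<lambda>Y g. act G g b)"
  have p: "p \<in> carrier (Hom (AbFun C) (hom_ftor C A) F)" and h: "h \<in> carrier (Hom (AbFun C) (hom_ftor C A) G)"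
    unfolding p_def h_def by (rule yoneda_trans[OF F A a], rule yoneda_trans[OF G A b])
  have appp: "app p X u = act F u a" and apph: "app h X u = act G u b" if "\<guillemotleft>u : A \<rightarrow> X\<guillemotright>" for X u
    using that hom_objs[OF that] by (simp_all add: p_def h_def)
  have one: "act G u b = \<one>\<^bsub>omap G X\<^esub>" if u: "\<guillemotleft>u : A \<rightarrow> X\<guillemotright>" "act F u a = \<one>\<^bsub>omap F X\<^esub>" for X u
  proof -
    obtain w where w: "\<guillemotleft>w : B \<rightarrow> X\<guillemotright>" "u = w \<cdot> f" using ker[OF u(1)] u(2) by blast
    show ?thesis
      using act_comp[OF G f w(1) b] w(2) rel group_hom.hom_one[OF act_hom[OF G w(1)]] by simp
  qed
  have same: "act G u b = act G v b" if u: "\<guillemotleft>u : A \<rightarrow> X\<guillemotright>" and v: "\<guillemotleft>v : A \<rightarrow> X\<guillemotright>"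
    and e: "act F u a = act F v a" for X u v
  proof -
    have X: "X \<in> Obj C" using hom_objs[OF u] by simp
    interpret H: comm_group "Hom C A X" by (rule comm_group_Hom[OF u])
    interpret PF: group_hom "Hom C A X" "omap F X" "app p X" using app_hom[OF p X] by simp
    interpret PG: group_hom "Hom C A X" "omap G X" "app h X" using app_hom[OF h X] by simp
    \<comment> \<open>The difference of \<open>u\<close> and \<open>v\<close> in the hom-group. The
      Yoneda maps of \<open>a\<close> and \<open>b\<close> are homomorphisms, so they turn equality
      of values into vanishing at \<open>?d\<close>.\<close>
    let ?d = "u \<otimes>\<^bsub>Hom C A X\<^esub> inv\<^bsub>Hom C A X\<^esub> v"
    have d: "\<guillemotleft>?d : A \<rightarrow> X\<guillemotright>" using u v by blast
    have "app p X ?d = \<one>\<^bsub>omap F X\<^esub>"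
      using u v e PF.hom_closed[OF u] PF.hom_closed[OF v] PF.hom_mult[OF u H.inv_closed[OF v]] PF.hom_inv[OF v]
      by (simp add: appp[OF u] appp[OF v] PF.H.r_inv del: mult_Hom)
    then have "app h X ?d = \<one>\<^bsub>omap G X\<^esub>" using one[OF d] appp[OF d] apph[OF d] by simp
    then have "app h X u \<otimes>\<^bsub>omap G X\<^esub> inv\<^bsub>omap G X\<^esub> (app h X v) = \<one>\<^bsub>omap G X\<^esub>"
      using PG.hom_mult[OF u H.inv_closed[OF v]] PG.hom_inv[OF v] by (simp del: mult_Hom)
    then have "app h X u = app h X v"
      using PG.hom_closed[OF u] PG.hom_closed[OF v] by (metis PG.H.inv_equality PG.H.inv_inv PG.H.inv_closed)
    then show ?thesis using apph u v by simp
  qed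
  define t where "t X x = act G (SOME u. \<guillemotleft>u : A \<rightarrow> X\<guillemotright> \<and> x = act F u a) b" for X x
  have t: "t X (act F u a) = act G u b" if u: "\<guillemotleft>u : A \<rightarrow> X\<guillemotright>" for X u
  proof -
    let ?v = "SOME v. \<guillemotleft>v : A \<rightarrow> X\<guillemotright> \<and> act F u a = act F v a"
    have "\<guillemotleft>?v : A \<rightarrow> X\<guillemotright> \<and> act F u a = act F ?v a"
      using u by (intro someI[where P = "\<lambda>v. \<guillemotleft>v : A \<rightarrow> X\<guillemotright> \<and> act F u a = act F v a"]) simp
    then show ?thesis unfolding t_def using same[OF u, of ?v] by simp
  qed
  let ?l = "trans_of C F G t"
  have l: "?l \<in> carrier (Hom (AbFun C) F G)"
  proof (rule trans_ofI[OF F G])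
    show "t X \<in> hom (omap F X) (omap G X)" if X: "X \<in> Obj C" for X
    proof (rule homI)
      fix x assume "x \<in> carrier (omap F X)"
      then obtain u where u: "\<guillemotleft>u : A \<rightarrow> X\<guillemotright>" "x = act F u a" using surj[OF X] by blast
      show "t X x \<in> carrier (omap G X)" using u t[OF u(1)] act_closed[OF G u(1) b] by simp
      fix y assume "y \<in> carrier (omap F X)"
      then obtain v where v: "\<guillemotleft>v : A \<rightarrow> X\<guillemotright>" "y = act F v a" using surj[OF X] by blast
      show "t X (x \<otimes>\<^bsub>omap F X\<^esub> y) = t X x \<otimes>\<^bsub>omap G X\<^esub> t X y"
        using t[OF add_in_hom[OF u(1) v(1)]] t[OF u(1)] t[OF v(1)] u v
          act_add[OF F u(1) v(1) a] act_add[OF G u(1) v(1) b] by simp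
    qed
    show "t Y (act F k x) = act G k (t X x)"
      if k: "\<guillemotleft>k : X \<rightarrow> Y\<guillemotright>" and x: "x \<in> carrier (omap F X)" for X Y k x
    proof -
      obtain u where u: "\<guillemotleft>u : A \<rightarrow> X\<guillemotright>" "x = act F u a" using surj[OF _ x] hom_objs[OF k] by blast
      show ?thesis
        using t[OF comp[OF u(1) k]] t[OF u(1)] u(2) act_comp[OF F u(1) k a] act_comp[OF G u(1) k b] by simp
    qed
  qed
  moreover have "app ?l A a = b"
    using t[OF ident[OF A]] act_ident[OF F A a] act_ident[OF G A b] A a by simp
  ultimately show thesis using that by (simp add: A_def)
qed

text \<open>The Yoneda map of \<open>a\<close> is the cokernel. A competing map \<open>h\<close> is
  given by its value at the identity; \<open>presented_lift\<close> yields the factorisation and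
  \<open>presented_unique\<close> its uniqueness.\<close>

lemma presented_finitely_presented:
  assumes pres: "presented F f a"
  shows "finitely_presented C F"
proof -
  interpret N: preadditive "AbFun C" by (rule preadditive_AbFun)
  define A B where "A = Dom C f" and "B = Cod C f"
  have f: "\<guillemotleft>f : A \<rightarrow> B\<guillemotright>" and F: "is_additive_functor C Ab F" and a: "a \<in> carrier (omap F A)"
    and surj: "\<And>X x. X \<in> Obj C \<Longrightarrow> x \<in> carrier (omap F X) \<Longrightarrow> \<exists>u. \<guillemotleft>u : A \<rightarrow> X\<guillemotright> \<and> x = act F u a"
    and ker: "\<And>X u. \<guillemotleft>u : A \<rightarrow> X\<guillemotright> \<Longrightarrow> act F u a = \<one>\<^bsub>omap F X\<^esub> \<longleftrightarrow> (\<exists>w. \<guillemotleft>w : B \<rightarrow> X\<guillemotright> \<and> u = w \<cdot> f)"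
    using pres unfolding presented_def A_def B_def by (auto simp: in_hom_iff)
  have A: "A \<in> Obj C" and B: "B \<in> Obj C" using hom_objs[OF f] by auto
  note hf = hom_trans_in_hom[OF f]
  let ?f = "hom_trans C (Obj C) f"
  define p where "p = trans_of C (hom_ftor C A) F (\<lambda>Y g. act F g a)"
  have p: "p \<in> carrier (Hom (AbFun C) (hom_ftor C A) F)"
    unfolding p_def by (rule yoneda_trans[OF F A a])
  have appp: "app p X u = act F u a" if "\<guillemotleft>u : A \<rightarrow> X\<guillemotright>" for X u
    using that hom_objs[OF that] by (simp add: p_def)
  have frame: "source ?f = hom_ftor C B" "target ?f = hom_ftor C A" "source p = hom_ftor C A" "target p = F"
    using hf p by (auto simp: in_hom_fun_cat)
  have pf: "p \<cdot>\<^bsub>AbFun C\<^esub> ?f = Zero (AbFun C) (hom_ftor C B) F"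
  proof (rule trans_eqI[OF N.comp[OF hf p]])
    show "Zero (AbFun C) (hom_ftor C B) F \<in> carrier (Hom (AbFun C) (hom_ftor C B) F)"
      using hom_ftor_additive[OF B] F by (intro N.zero_in_hom) auto
    show "app (p \<cdot>\<^bsub>AbFun C\<^esub> ?f) X w = app (Zero (AbFun C) (hom_ftor C B) F) X w"
      if "X \<in> Obj C" "w \<in> carrier (omap (hom_ftor C B) X)" for X w
    proof -
      have w: "\<guillemotleft>w : B \<rightarrow> X\<guillemotright>" using that by simp
      show ?thesis
        using that ker[OF comp[OF f w]] w appp[OF comp[OF f w]]
        by (simp add: app_comp[OF hf] app_hom_trans[OF f] app_zero) blast
    qed
  qed
  have univ: "\<exists>!l. l \<in> carrier (Hom (AbFun C) F G) \<and> l \<cdot>\<^bsub>AbFun C\<^esub> p = h"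
    if h: "h \<in> carrier (Hom (AbFun C) (hom_ftor C A) G)"
      and hz: "h \<cdot>\<^bsub>AbFun C\<^esub> ?f = Zero (AbFun C) (hom_ftor C B) G" for G h
  proof -
    have G: "is_additive_functor C Ab G" using trans_functors[OF h] by simp
    define b where "b = app h A (Ident C A)"
    have b: "b \<in> carrier (omap G A)" using app_closed[OF h A] ident[OF A] by (simp add: b_def)
    have apph: "app h X u = act G u b" if "\<guillemotleft>u : A \<rightarrow> X\<guillemotright>" for X u
      using yoneda[OF h that] by (simp add: b_def)
    have "app h B f = app (h \<cdot>\<^bsub>AbFun C\<^esub> ?f) B (Ident C B)"
      using app_comp[OF hf B, of "Ident C B" h] ident[OF B] app_hom_trans[OF f ident[OF B]] ident_left[OF f] by simp
    then have "act G f b = \<one>\<^bsub>omap G B\<^esub>"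
      using hz app_zero[OF B, of "Ident C B" "hom_ftor C B" G] ident[OF B] apph[OF f] by simp
    then obtain l where l: "l \<in> carrier (Hom (AbFun C) F G)" "app l A a = b"
      using presented_lift[OF pres G, of b] b unfolding A_def B_def by blast
    have "l \<cdot>\<^bsub>AbFun C\<^esub> p = h"
      using l(2) app_natural[OF l(1) _ a]
      by (intro trans_eqI[OF N.comp[OF p l(1)] h]) (simp add: app_comp[OF p] appp apph)
    moreover have "m = l" if m: "m \<in> carrier (Hom (AbFun C) F G)" "m \<cdot>\<^bsub>AbFun C\<^esub> p = h" for m
    proof (rule presented_unique[OF pres m(1) l(1), folded A_def])
      show "app m A a = app l A a"
        using app_comp[OF p A, of "Ident C A" m] m(2) appp[OF ident[OF A]] act_ident[OF F A a] ident[OF A] l(2)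
        by (simp add: b_def)
    qed
    ultimately show ?thesis using l(1) by blast
  qed
  have "is_cokernel (AbFun C) p ?f"
    unfolding is_cokernel_def is_kernel_def
    using p hf pf univ frame by (auto simp: in_hom_iff)
  then show ?thesis
    unfolding finitely_presented_def using f frame(4) by (auto simp: in_hom_iff)
qed

text \<open>Allows finite presentation to be handled by generators and relations instead of
  universal properties.\<close>

lemma finitely_presented_iff: "finitely_presented C F \<longleftrightarrow> (\<exists>f a. presented F f a)"
proof
  assume "finitely_presented C F"
  then obtain f p where "f \<in> Arr C" "is_cokernel (AbFun C) p (hom_trans C (Obj C) f)" "target p = F"
    unfolding finitely_presented_def by blast
  then show "\<exists>f a. presented F f a" using cokernel_presented[OF arr_in_hom] by blast
qed (blast intro: presented_finitely_presented)

end

section \<open>Small copies of groups\<close>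

context
  fixes A :: "('x, 'm) monoid_scheme"
  assumes small: "small TYPE('u) (carrier A)"
begin

text \<open>Smallness provides some injection, so the chosen \<open>encode\<close> is one.\<close>

lemma inj_encode: "inj_on (encode A :: 'x \<Rightarrow> 'u) (carrier A)"
proof -
  obtain e :: "'x \<Rightarrow> 'u" where "inj_on e (carrier A)" by (rule small_inj[OF small])
  then show ?thesis unfolding encode_def by (rule someI[where P = "\<lambda>e. inj_on e (carrier A)"])
qed

lemma decode_encode: "x \<in> carrier A \<Longrightarrow> decode A (encode A x :: 'u) = x"
  unfolding decode_def by (rule inv_into_f_f[OF inj_encode])

lemma carrier_small_copy: "carrier (small_copy A :: 'u monoid) = encode A ` carrier A"
  by (simp add: small_copy_def)

lemma small_copyE:
  assumes "s \<in> carrier (small_copy A :: 'u monoid)"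
  obtains x where "x \<in> carrier A" "s = encode A x" "decode A s = x"
  using assms decode_encode by (auto simp: carrier_small_copy)

lemma encode_in_small_copy: "x \<in> carrier A \<Longrightarrow> encode A x \<in> carrier (small_copy A :: 'u monoid)"
  by (simp add: carrier_small_copy)

lemma mult_small_copy:
  "x \<in> carrier A \<Longrightarrow> y \<in> carrier A \<Longrightarrow>
     (encode A x :: 'u) \<otimes>\<^bsub>small_copy A\<^esub> encode A y = encode A (x \<otimes>\<^bsub>A\<^esub> y)"
  by (simp add: small_copy_def decode_encode)

lemma one_small_copy: "\<one>\<^bsub>small_copy A :: 'u monoid\<^esub> = encode A \<one>\<^bsub>A\<^esub>"
  by (simp add: small_copy_def)

lemma comm_group_small_copy:
  assumes "comm_group A" shows "comm_group (small_copy A :: 'u monoid)"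
  by (rule comm_group_image[OF assms, of "encode A"])
    (simp_all add: carrier_small_copy mult_small_copy one_small_copy)

lemma small_small_copy: "small TYPE('u) (carrier (small_copy A :: 'u monoid))"
  unfolding carrier_small_copy by (rule small_image[OF small])

end


section \<open>Dual pairs of categories with weak triangles\<close>

text \<open>What a triangle leaves behind once the shift is forgotten: \<open>g\<close> is a weak
  cokernel of \<open>f\<close> and \<open>h\<close> of \<open>g\<close>, while \<open>f\<close> is a
  weak kernel of \<open>g\<close> and \<open>g\<close> of \<open>h\<close>. Equivalently, Hom(-,Y)
  and Hom(X,-) turn the three maps into sequences that are exact at the two inner places.\<close>

definition exact_triple :: "('o, 'a, 'm) cat_scheme \<Rightarrow> 'a \<Rightarrow> 'a \<Rightarrow> 'a \<Rightarrow> bool" where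
  "exact_triple C f g h \<longleftrightarrow> f \<in> Arr C \<and> g \<in> Arr C \<and> h \<in> Arr C \<and> Cod C f = Dom C g \<and> Cod C g = Dom C h \<and>
     (\<forall>Y t. \<guillemotleft>t : Dom C g \<rightarrow>\<^bsub>C\<^esub> Y\<guillemotright> \<longrightarrow>
        (t \<cdot>\<^bsub>C\<^esub> f = Zero C (Dom C f) Y \<longleftrightarrow> (\<exists>c. \<guillemotleft>c : Dom C h \<rightarrow>\<^bsub>C\<^esub> Y\<guillemotright> \<and> t = c \<cdot>\<^bsub>C\<^esub> g))) \<and>
     (\<forall>Y c. \<guillemotleft>c : Dom C h \<rightarrow>\<^bsub>C\<^esub> Y\<guillemotright> \<longrightarrow>
        (c \<cdot>\<^bsub>C\<^esub> g = Zero C (Dom C g) Y \<longleftrightarrow> (\<exists>d. \<guillemotleft>d : Cod C h \<rightarrow>\<^bsub>C\<^esub> Y\<guillemotright> \<and> c = d \<cdot>\<^bsub>C\<^esub> h))) \<and>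
     (\<forall>X a. \<guillemotleft>a : X \<rightarrow>\<^bsub>C\<^esub> Dom C g\<guillemotright> \<longrightarrow>
        (g \<cdot>\<^bsub>C\<^esub> a = Zero C X (Dom C h) \<longleftrightarrow> (\<exists>b. \<guillemotleft>b : X \<rightarrow>\<^bsub>C\<^esub> Dom C f\<guillemotright> \<and> a = f \<cdot>\<^bsub>C\<^esub> b))) \<and>
     (\<forall>X r. \<guillemotleft>r : X \<rightarrow>\<^bsub>C\<^esub> Dom C h\<guillemotright> \<longrightarrow>
        (h \<cdot>\<^bsub>C\<^esub> r = Zero C X (Cod C h) \<longleftrightarrow> (\<exists>b. \<guillemotleft>b : X \<rightarrow>\<^bsub>C\<^esub> Dom C g\<guillemotright> \<and> r = g \<cdot>\<^bsub>C\<^esub> b)))"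

text \<open>The features of the compact objects on which the study of \<delta> rests, stated without
  shift or triangles.\<close>

locale small_triangle_category =
  locally_small_category C + additive_category C for C :: "('o, 'u) cat" (structure) +
  assumes universe: "universe TYPE('u)"
    and essentially_small: "\<exists>S \<subseteq> Obj C. small TYPE('u) S \<and> (\<forall>K\<in>Obj C. \<exists>K'\<in>S. isomorphic C K K')"
    and triangle: "f \<in> Arr C \<Longrightarrow> \<exists>g h. exact_triple C f g h"
begin

text \<open>A transformation is determined by its graph on a small skeleton.\<close>

lemma small_trans:
  assumes F: "is_additive_functor C Ab F" and G: "is_additive_functor C Ab G"
  shows "small TYPE('u) (carrier (Hom (AbFun C) F G))"
proof -
  obtain S where S: "S \<subseteq> Obj C" "small TYPE('u) S" and skel: "\<And>K. K \<in> Obj C \<Longrightarrow> \<exists>K'\<in>S. isomorphic C K K'"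
    using essentially_small by blast
  \<comment> \<open>The skeleton and the groups over it are small, so all graphs are subsets of one
    small set.\<close>
  let ?P = "Sigma S (\<lambda>X. carrier (omap F X) \<times> carrier (omap G X))"
  define gr where "gr \<sigma> = {(X, x, app \<sigma> X x) | X x. X \<in> S \<and> x \<in> carrier (omap F X)}"
    for \<sigma> :: "('o, 'u) abtrans"
  have "small TYPE('u) ?P"
    using S functor_small[OF F] functor_small[OF G]
    by (intro small_Sigma[OF universe]) auto
  then have "small TYPE('u) (Pow ?P)" by (rule small_Pow[OF universe])
  moreover have "carrier (Hom (AbFun C) F G) \<lesssim> Pow ?P"
    unfolding lepoll_def
  proof (intro exI conjI)
    show "gr ` carrier (Hom (AbFun C) F G) \<subseteq> Pow ?P"
      using S(1) by (auto simp: gr_def intro!: app_closed)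
    show "inj_on gr (carrier (Hom (AbFun C) F G))"
    proof (rule inj_onI)
      fix \<sigma> \<tau> assume s: "\<sigma> \<in> carrier (Hom (AbFun C) F G)" and t: "\<tau> \<in> carrier (Hom (AbFun C) F G)"
        and e: "gr \<sigma> = gr \<tau>"
      have on_S: "app \<sigma> X x = app \<tau> X x" if "X \<in> S" "x \<in> carrier (omap F X)" for X x
      proof -
        have "(X, x, app \<sigma> X x) \<in> gr \<tau>" using that e[symmetric] by (auto simp: gr_def)
        then show ?thesis by (auto simp: gr_def)
      qed
      show "\<sigma> = \<tau>"
      proof (rule trans_eqI[OF s t])
        fix K x assume K: "K \<in> Obj C" and x: "x \<in> carrier (omap F K)"
        \<comment> \<open>Naturality along the retraction \<open>k'\<close> carries agreement on the
          skeleton over to \<open>K\<close>.\<close>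
        obtain K' k k' where K': "K' \<in> S" and k: "\<guillemotleft>k : K \<rightarrow> K'\<guillemotright>" "\<guillemotleft>k' : K' \<rightarrow> K\<guillemotright>" "k' \<cdot> k = Ident C K"
          using skel[OF K] unfolding isomorphic_def is_iso_def by blast
        have x': "act F k x \<in> carrier (omap F K')" by (rule act_closed[OF F k(1) x])
        have "x = act F k' (act F k x)" using act_comp[OF F k(1,2) x] k(3) act_ident[OF F K x] by simp
        then show "app \<sigma> K x = app \<tau> K x"
          using app_natural[OF s k(2) x'] app_natural[OF t k(2) x'] on_S[OF K' x'] by simp
      qed
    qed
  qed
  ultimately show ?thesis by (rule small_lepoll)
qed

end

section \<open>Dual pairs and their adjunction\<close>

locale dual_pair = C: small_triangle_category C + C': small_triangle_category C'
  for C :: "('t, 'u) cat" and C' :: "('s, 'u) cat" +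
  fixes D :: "('t, 'u, 's, 'u) ftor" and D' :: "('s, 'u, 't, 'u) ftor" and \<eta> :: "'t \<Rightarrow> 'u" and \<epsilon> :: "'s \<Rightarrow> 'u"
  assumes D: "is_functor (op C) C' D" and D': "is_functor (op C') C D'"
    and unit: "nat_iso C C id_ftor (D' \<circ>\<^sub>F D) \<eta>" and counit: "nat_iso C' C' id_ftor (D \<circ>\<^sub>F D') \<epsilon>"
    and triangle_D: "X \<in> Obj C \<Longrightarrow> amap D (\<eta> X) \<cdot>\<^bsub>C'\<^esub> \<epsilon> (omap D X) = Ident C' (omap D X)"
    and triangle_D': "Y \<in> Obj C' \<Longrightarrow> amap D' (\<epsilon> Y) \<cdot>\<^bsub>C\<^esub> \<eta> (omap D' Y) = Ident C (omap D' Y)"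
begin

text \<open>The assumptions are invariant under exchanging \<open>C\<close>, \<open>D\<close>,
  \<eta> with \<open>C'\<close>, \<open>D'\<close>, \<epsilon>, so every result holds for both
  directions.\<close>

lemma dual: "dual_pair C' C D' D \<epsilon> \<eta>"
  by unfold_locales (fact D D' unit counit triangle_D triangle_D')+

lemma D_obj: "X \<in> Obj C \<Longrightarrow> omap D X \<in> Obj C'"
  and D_arr: "\<guillemotleft>f : X \<rightarrow>\<^bsub>C\<^esub> Y\<guillemotright> \<Longrightarrow> \<guillemotleft>amap D f : omap D Y \<rightarrow>\<^bsub>C'\<^esub> omap D X\<guillemotright>"
  and D_ident: "X \<in> Obj C \<Longrightarrow> amap D (Ident C X) = Ident C' (omap D X)"
  and D_comp: "\<guillemotleft>f : X \<rightarrow>\<^bsub>C\<^esub> Y\<guillemotright> \<Longrightarrow> \<guillemotleft>g : Y \<rightarrow>\<^bsub>C\<^esub> Z\<guillemotright> \<Longrightarrow> amap D (g \<cdot>\<^bsub>C\<^esub> f) = amap D f \<cdot>\<^bsub>C'\<^esub> amap D g"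
  using functor_obj[OF D, of X] functor_arr[OF D, of f Y X] functor_ident[OF D, of X] functor_comp[OF D, of g Z Y f X]
  by simp_all

lemma unit_iso: "X \<in> Obj C \<Longrightarrow> is_iso C (\<eta> X) X (omap D' (omap D X))"
  using unit by (simp add: nat_iso_def)

lemma unit_natural: "\<guillemotleft>f : X \<rightarrow>\<^bsub>C\<^esub> Y\<guillemotright> \<Longrightarrow> amap D' (amap D f) \<cdot>\<^bsub>C\<^esub> \<eta> X = \<eta> Y \<cdot>\<^bsub>C\<^esub> f"
  using unit by (simp add: nat_iso_def nat_trans_def)

text \<open>By naturality of the unit \<open>\<eta> Y \<cdot> f\<close> depends only on D f, and
  \<open>\<eta> Y\<close> is an isomorphism.\<close>

lemma D_faithful:
  assumes f: "\<guillemotleft>f : X \<rightarrow>\<^bsub>C\<^esub> Y\<guillemotright>" and g: "\<guillemotleft>g : X \<rightarrow>\<^bsub>C\<^esub> Y\<guillemotright>" and e: "amap D f = amap D g"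
  shows "f = g"
  using unit_natural[OF f] unit_natural[OF g] e C.hom_objs[OF f]
  by (intro C.iso_cancel_left[OF unit_iso f g]) auto

text \<open>The adjunction bijection from Hom(D'Y, X) to Hom(DX, Y). The same formula for the dual
  pair, \<open>dual.phi\<close>, is its inverse.\<close>

definition phi :: "'s \<Rightarrow> 'u \<Rightarrow> 'u" where
  "phi Y g = inv_arr C' (\<epsilon> Y) \<cdot>\<^bsub>C'\<^esub> amap D g"

end

context dual_pair
begin

interpretation dual: dual_pair C' C D' D \<epsilon> \<eta> by (rule dual)

lemma phi_in_hom:
  assumes Y: "Y \<in> Obj C'" and g: "\<guillemotleft>g : omap D' Y \<rightarrow>\<^bsub>C\<^esub> X\<guillemotright>"
  shows "\<guillemotleft>phi Y g : omap D X \<rightarrow>\<^bsub>C'\<^esub> Y\<guillemotright>"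
  unfolding phi_def by (rule C'.comp[OF D_arr[OF g] inv_arr(1)[OF dual.unit_iso[OF Y]]])

text \<open>Naturality of the adjunction in \<open>X\<close>. Only functoriality of \<open>D\<close>
  enters here, whereas naturality in \<open>Y\<close> needs that of the counit.\<close>

lemma phi_precomp:
  assumes Y: "Y \<in> Obj C'" and g: "\<guillemotleft>g : omap D' Y \<rightarrow>\<^bsub>C\<^esub> X\<guillemotright>" and u: "\<guillemotleft>u : X \<rightarrow>\<^bsub>C\<^esub> X'\<guillemotright>"
  shows "phi Y (u \<cdot>\<^bsub>C\<^esub> g) = phi Y g \<cdot>\<^bsub>C'\<^esub> amap D u"
  unfolding phi_def D_comp[OF g u]
  by (rule C'.assoc[symmetric, OF D_arr[OF u] D_arr[OF g] inv_arr(1)[OF dual.unit_iso[OF Y]]])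

lemma inv_counit_natural:
  assumes v: "\<guillemotleft>v : Y \<rightarrow>\<^bsub>C'\<^esub> Y'\<guillemotright>"
  shows "inv_arr C' (\<epsilon> Y') \<cdot>\<^bsub>C'\<^esub> amap D (amap D' v) = v \<cdot>\<^bsub>C'\<^esub> inv_arr C' (\<epsilon> Y)"
proof -
  have "is_functor C' C' (D \<circ>\<^sub>F D')"
    using is_functor_comp[OF is_functor_op[OF D'], of C' D] D by simp
  then have "nat_iso C' C' (D \<circ>\<^sub>F D') id_ftor (\<lambda>Y. inv_arr C' (\<epsilon> Y))"
    using counit is_functor_id
    by (intro nat_iso_inverse C'.preadditive_axioms)
  then show ?thesis using v by (simp add: nat_iso_def nat_trans_def)
qed

lemma phi_postcomp:
  assumes g: "\<guillemotleft>g : omap D' Y \<rightarrow>\<^bsub>C\<^esub> X\<guillemotright>" and v: "\<guillemotleft>v : Y \<rightarrow>\<^bsub>C'\<^esub> Y'\<guillemotright>"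
  shows "phi Y' (g \<cdot>\<^bsub>C\<^esub> amap D' v) = v \<cdot>\<^bsub>C'\<^esub> phi Y g"
proof -
  have Y: "Y \<in> Obj C'" "Y' \<in> Obj C'" using C'.hom_objs[OF v] by auto
  note i = inv_arr(1)[OF dual.unit_iso[OF Y(1)]] inv_arr(1)[OF dual.unit_iso[OF Y(2)]]
  show ?thesis
    unfolding phi_def D_comp[OF dual.D_arr[OF v] g]
    using C'.assoc[OF D_arr[OF g] D_arr[OF dual.D_arr[OF v]] i(2)] C'.assoc[OF D_arr[OF g] i(1) v]
      inv_counit_natural[OF v] by simp
qed

text \<open>The triangle identity makes D'(\<epsilon> Y) a left inverse of the isomorphism \<eta> at
  D'Y, hence its inverse.\<close>

lemma inv_unit_dual:
  assumes Y: "Y \<in> Obj C'"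
  shows "inv_arr C (\<eta> (omap D' Y)) = amap D' (\<epsilon> Y)"
  using C.inv_arr_unique[OF unit_iso[OF dual.D_obj[OF Y]] _ triangle_D'[OF Y]]
    dual.D_arr[of "\<epsilon> Y"] dual.unit_iso[OF Y] by (auto simp: is_iso_def)

end

context dual_pair
begin

interpretation dual: dual_pair C' C D' D \<epsilon> \<eta> by (rule dual)

text \<open>Naturality of the inverse unit moves \<open>g\<close> to the front. What remains is the
  inverse unit at D'Y, which is D'(\<epsilon> Y) and cancels D' of the inverse counit.\<close>

lemma psi_phi:
  assumes Y: "Y \<in> Obj C'" and g: "\<guillemotleft>g : omap D' Y \<rightarrow>\<^bsub>C\<^esub> X\<guillemotright>"
  shows "dual.phi X (phi Y g) = g"
proof -
  have e: "is_iso C' (\<epsilon> Y) Y (omap D (omap D' Y))" by (rule dual.unit_iso[OF Y])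
  note i = inv_arr[OF e]
  have eY: "\<guillemotleft>\<epsilon> Y : Y \<rightarrow>\<^bsub>C'\<^esub> omap D (omap D' Y)\<guillemotright>" using e by (simp add: is_iso_def)
  have X: "X \<in> Obj C" using C.hom_objs[OF g] by simp
  note j = inv_arr(1)[OF unit_iso[OF X]] inv_arr(1)[OF unit_iso[OF dual.D_obj[OF Y]]]
  have "dual.phi X (phi Y g) = inv_arr C (\<eta> X) \<cdot>\<^bsub>C\<^esub> (amap D' (amap D g) \<cdot>\<^bsub>C\<^esub> amap D' (inv_arr C' (\<epsilon> Y)))"
    by (simp add: dual.phi_def phi_def dual.D_comp[OF D_arr[OF g] i(1)])
  also have "\<dots> = g \<cdot>\<^bsub>C\<^esub> (amap D' (\<epsilon> Y) \<cdot>\<^bsub>C\<^esub> amap D' (inv_arr C' (\<epsilon> Y)))"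
    using C.assoc[OF dual.D_arr[OF i(1)] dual.D_arr[OF D_arr[OF g]] j(1)]
      C.assoc[OF dual.D_arr[OF i(1)] j(2) g] dual.inv_counit_natural[OF g] inv_unit_dual[OF Y] by simp
  also have "\<dots> = g"
    using dual.D_comp[OF eY i(1)] i(2) dual.D_ident[OF Y] C.ident_right[OF g] by simp
  finally show ?thesis .
qed

text \<open>The transpose of \<open>b\<close>, precomposed with \<open>\<eta> A\<close>, is the
  preimage, because D(\<eta> A) is the inverse counit at DA. The assumptions on the transpose are
  the dual forms of \<open>phi_in_hom\<close> and \<open>psi_phi\<close>.\<close>

lemma D_full_aux:
  assumes A: "A \<in> Obj C" and psi: "\<guillemotleft>dual.phi X b : omap D' (omap D A) \<rightarrow>\<^bsub>C\<^esub> X\<guillemotright>"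
    and phi: "phi (omap D A) (dual.phi X b) = b"
  shows "\<exists>u. \<guillemotleft>u : A \<rightarrow>\<^bsub>C\<^esub> X\<guillemotright> \<and> amap D u = b"
proof (intro exI conjI)
  have e: "\<guillemotleft>\<eta> A : A \<rightarrow>\<^bsub>C\<^esub> omap D' (omap D A)\<guillemotright>" using unit_iso[OF A] by (simp add: is_iso_def)
  show "\<guillemotleft>dual.phi X b \<cdot>\<^bsub>C\<^esub> \<eta> A : A \<rightarrow>\<^bsub>C\<^esub> X\<guillemotright>" by (rule C.comp[OF e psi])
  show "amap D (dual.phi X b \<cdot>\<^bsub>C\<^esub> \<eta> A) = b"
    using phi dual.inv_unit_dual[OF A] D_comp[OF e psi] by (simp add: phi_def)
qed

end

context dual_pair
begin

interpretation dual: dual_pair C' C D' D \<epsilon> \<eta> by (rule dual)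

lemma D_full:
  assumes A: "A \<in> Obj C" and X: "X \<in> Obj C" and b: "\<guillemotleft>b : omap D X \<rightarrow>\<^bsub>C'\<^esub> omap D A\<guillemotright>"
  obtains u where "\<guillemotleft>u : A \<rightarrow>\<^bsub>C\<^esub> X\<guillemotright>" "amap D u = b"
  using D_full_aux[OF A dual.phi_in_hom[OF X b] dual.psi_phi[OF X b]] by blast

text \<open>Additivity of \<open>D\<close> is not given. A zero map factors through a zero object Z,
  and by fullness the zero map DY -> DZ is the image of an arrow Z -> Y, of which there is only
  one.\<close>

lemma D_zero:
  assumes X: "X \<in> Obj C" and Y: "Y \<in> Obj C"
  shows "amap D (Zero C X Y) = Zero C' (omap D Y) (omap D X)"
proof -
  obtain Z where Z: "is_zero C Z" using C.zero_object by blast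
  then have ZO: "Z \<in> Obj C" by (simp add: is_zero_def)
  have xz: "\<guillemotleft>Zero C X Z : X \<rightarrow>\<^bsub>C\<^esub> Z\<guillemotright>" and zy: "\<guillemotleft>Zero C Z Y : Z \<rightarrow>\<^bsub>C\<^esub> Y\<guillemotright>" using C.zero_in_hom X Y ZO by auto
  have z: "\<guillemotleft>Zero C' (omap D Y) (omap D Z) : omap D Y \<rightarrow>\<^bsub>C'\<^esub> omap D Z\<guillemotright>"
    using C'.zero_in_hom D_obj Y ZO by blast
  obtain u where u: "\<guillemotleft>u : Z \<rightarrow>\<^bsub>C\<^esub> Y\<guillemotright>" "amap D u = Zero C' (omap D Y) (omap D Z)" by (rule D_full[OF ZO Y z])
  have "u = Zero C Z Y" using Z u(1) zy Y unfolding is_zero_def by blast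
  then have "amap D (Zero C Z Y \<cdot>\<^bsub>C\<^esub> Zero C X Z) = amap D (Zero C X Z) \<cdot>\<^bsub>C'\<^esub> Zero C' (omap D Y) (omap D Z)"
    using D_comp[OF xz zy] u(2) by simp
  then show ?thesis
    using C.comp_zero[OF zy X] C'.comp_zero[OF D_arr[OF xz] D_obj[OF Y]] by simp
qed

text \<open>Addition is determined by biproducts, and a full and faithful functor preserves these.\<close>

lemma D_add:
  assumes u: "\<guillemotleft>u : X \<rightarrow>\<^bsub>C\<^esub> Y\<guillemotright>" and v: "\<guillemotleft>v : X \<rightarrow>\<^bsub>C\<^esub> Y\<guillemotright>"
  shows "amap D (u \<boxplus>\<^bsub>C\<^esub> v) = amap D u \<boxplus>\<^bsub>C'\<^esub> amap D v"
proof -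
  have X: "X \<in> Obj C" and Y: "Y \<in> Obj C" using C.hom_objs[OF u] by auto
  obtain P i j p q where i: "\<guillemotleft>i : X \<rightarrow>\<^bsub>C\<^esub> P\<guillemotright>" and j: "\<guillemotleft>j : X \<rightarrow>\<^bsub>C\<^esub> P\<guillemotright>"
    and p: "\<guillemotleft>p : P \<rightarrow>\<^bsub>C\<^esub> X\<guillemotright>" and q: "\<guillemotleft>q : P \<rightarrow>\<^bsub>C\<^esub> X\<guillemotright>"
    and pi: "p \<cdot>\<^bsub>C\<^esub> i = Ident C X" and qj: "q \<cdot>\<^bsub>C\<^esub> j = Ident C X"
    and qi: "q \<cdot>\<^bsub>C\<^esub> i = Zero C X X" and pj: "p \<cdot>\<^bsub>C\<^esub> j = Zero C X X"
    and sum: "(i \<cdot>\<^bsub>C\<^esub> p) \<boxplus>\<^bsub>C\<^esub> (j \<cdot>\<^bsub>C\<^esub> q) = Ident C P"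
    using C.biproducts[OF X X] unfolding is_biproduct_def by blast
  have P: "P \<in> Obj C" using C.hom_objs[OF i] by simp
  \<comment> \<open>Once this sum is known to be the identity, DP is a biproduct with injections D
    p, D q and projections D i, D j.\<close>
  let ?e = "(amap D p \<cdot>\<^bsub>C'\<^esub> amap D i) \<boxplus>\<^bsub>C'\<^esub> (amap D q \<cdot>\<^bsub>C'\<^esub> amap D j)"
  note DI = D_arr[OF i] and DJ = D_arr[OF j] and DP = D_arr[OF p] and DQ = D_arr[OF q]
  note pI = C'.comp[OF DI DP] and qJ = C'.comp[OF DJ DQ]
  have e: "\<guillemotleft>?e : omap D P \<rightarrow>\<^bsub>C'\<^esub> omap D P\<guillemotright>" by (rule C'.add_in_hom[OF pI qJ])
  have ip: "amap D i \<cdot>\<^bsub>C'\<^esub> amap D p = Ident C' (omap D X)" "amap D j \<cdot>\<^bsub>C'\<^esub> amap D q = Ident C' (omap D X)"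
    "amap D i \<cdot>\<^bsub>C'\<^esub> amap D q = Zero C' (omap D X) (omap D X)" "amap D j \<cdot>\<^bsub>C'\<^esub> amap D p = Zero C' (omap D X) (omap D X)"
    using D_comp[OF i p] D_comp[OF j q] D_comp[OF i q] D_comp[OF j p] pi qj qi pj D_ident[OF X] D_zero[OF X X] by auto
  have ei: "amap D i \<cdot>\<^bsub>C'\<^esub> ?e = amap D i" and ej: "amap D j \<cdot>\<^bsub>C'\<^esub> ?e = amap D j"
    using C'.distrib_left[OF pI qJ DI] C'.distrib_left[OF pI qJ DJ]
      C'.assoc[OF DI DP DI] C'.assoc[OF DJ DQ DI] C'.assoc[OF DI DP DJ] C'.assoc[OF DJ DQ DJ]
      ip C'.ident_left[OF DI] C'.ident_left[OF DJ] C'.zero_comp[OF DI D_obj[OF X]] C'.zero_comp[OF DJ D_obj[OF X]]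
      C'.add_zero[OF DI] C'.add_zero[OF DJ] by simp_all
  \<comment> \<open>Fullness lifts \<open>?e\<close> to \<open>k\<close>. Faithfulness makes
    \<open>k\<close> fix both injections, hence be the identity of the biproduct.\<close>
  obtain k where k: "\<guillemotleft>k : P \<rightarrow>\<^bsub>C\<^esub> P\<guillemotright>" "amap D k = ?e" by (rule D_full[OF P P e])
  have ki: "k \<cdot>\<^bsub>C\<^esub> i = i" and kj: "k \<cdot>\<^bsub>C\<^esub> j = j"
    using D_faithful[OF C.comp[OF i k(1)] i] D_faithful[OF C.comp[OF j k(1)] j]
      D_comp[OF i k(1)] D_comp[OF j k(1)] k(2) ei ej by simp_all
  have "k = k \<cdot>\<^bsub>C\<^esub> ((i \<cdot>\<^bsub>C\<^esub> p) \<boxplus>\<^bsub>C\<^esub> (j \<cdot>\<^bsub>C\<^esub> q))" using sum C.ident_right[OF k(1)] by simp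
  also have "\<dots> = Ident C P"
    using C.distrib_left[OF C.comp[OF p i] C.comp[OF q j] k(1)] C.assoc[OF p i k(1)] C.assoc[OF q j k(1)]
      ki kj sum by simp
  finally have eid: "?e = Ident C' (omap D P)" using k(2) D_ident[OF P] by simp
  \<comment> \<open>\<open>m\<close> restricts to \<open>u\<close> and \<open>v\<close> on the two
    summands and \<open>s\<close> is the diagonal, so \<open>m \<cdot> s\<close> is the sum of
    \<open>u\<close> and \<open>v\<close>. Inserting the identity \<open>?e\<close> between D s and
    D m computes the image of this sum.\<close>
  define m s where "m = (u \<cdot>\<^bsub>C\<^esub> p) \<boxplus>\<^bsub>C\<^esub> (v \<cdot>\<^bsub>C\<^esub> q)" and "s = i \<boxplus>\<^bsub>C\<^esub> j"
  have m: "\<guillemotleft>m : P \<rightarrow>\<^bsub>C\<^esub> Y\<guillemotright>" and s: "\<guillemotleft>s : X \<rightarrow>\<^bsub>C\<^esub> P\<guillemotright>"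
    unfolding m_def s_def by (rule C.add_in_hom[OF C.comp[OF p u] C.comp[OF q v]], rule C.add_in_hom[OF i j])
  have mi: "m \<cdot>\<^bsub>C\<^esub> i = u"
    unfolding m_def
    using C.distrib_right[OF i C.comp[OF p u] C.comp[OF q v]] C.assoc[OF i p u] C.assoc[OF i q v] pi qi
      C.ident_right[OF u] C.comp_zero[OF v X] C.add_zero[OF u] by simp
  have mj: "m \<cdot>\<^bsub>C\<^esub> j = v"
    unfolding m_def
    using C.distrib_right[OF j C.comp[OF p u] C.comp[OF q v]] C.assoc[OF j p u] C.assoc[OF j q v] pj qj
      C.ident_right[OF v] C.comp_zero[OF u X] C.add_zero[OF v] by simp
  have ms: "m \<cdot>\<^bsub>C\<^esub> s = u \<boxplus>\<^bsub>C\<^esub> v" unfolding s_def using C.distrib_left[OF i j m] mi mj by simp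
  have ps: "p \<cdot>\<^bsub>C\<^esub> s = Ident C X" "q \<cdot>\<^bsub>C\<^esub> s = Ident C X"
    unfolding s_def using C.distrib_left[OF i j p] C.distrib_left[OF i j q] pi qj pj qi C.add_zero[OF C.ident[OF X]] by simp_all
  note DM = D_arr[OF m] and DS = D_arr[OF s]
  have "amap D (u \<boxplus>\<^bsub>C\<^esub> v) = amap D s \<cdot>\<^bsub>C'\<^esub> (?e \<cdot>\<^bsub>C'\<^esub> amap D m)"
    using D_comp[OF s m] ms eid C'.ident_left[OF DM] by simp
  also have "?e \<cdot>\<^bsub>C'\<^esub> amap D m = (amap D p \<cdot>\<^bsub>C'\<^esub> amap D u) \<boxplus>\<^bsub>C'\<^esub> (amap D q \<cdot>\<^bsub>C'\<^esub> amap D v)"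
    using C'.distrib_right[OF DM pI qJ] C'.assoc[OF DM DI DP] C'.assoc[OF DM DJ DQ]
      D_comp[OF i m] D_comp[OF j m] mi mj by simp
  also have "amap D s \<cdot>\<^bsub>C'\<^esub> \<dots> = amap D u \<boxplus>\<^bsub>C'\<^esub> amap D v"
    using C'.distrib_left[OF C'.comp[OF D_arr[OF u] DP] C'.comp[OF D_arr[OF v] DQ] DS]
      C'.assoc[OF D_arr[OF u] DP DS] C'.assoc[OF D_arr[OF v] DQ DS] D_comp[OF s p] D_comp[OF s q] ps
      D_ident[OF X] C'.ident_left[OF D_arr[OF u]] C'.ident_left[OF D_arr[OF v]] by simp
  finally show ?thesis .
qed

lemma phi_add:
  assumes Y: "Y \<in> Obj C'" and g: "\<guillemotleft>g : omap D' Y \<rightarrow>\<^bsub>C\<^esub> X\<guillemotright>" and h: "\<guillemotleft>h : omap D' Y \<rightarrow>\<^bsub>C\<^esub> X\<guillemotright>"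
  shows "phi Y (g \<boxplus>\<^bsub>C\<^esub> h) = phi Y g \<boxplus>\<^bsub>C'\<^esub> phi Y h"
  unfolding phi_def D_add[OF g h]
  by (rule C'.distrib_left[OF D_arr[OF g] D_arr[OF h] inv_arr(1)[OF dual.unit_iso[OF Y]]])

lemma phi_zero:
  assumes Y: "Y \<in> Obj C'" and X: "X \<in> Obj C"
  shows "phi Y (Zero C (omap D' Y) X) = Zero C' (omap D X) Y"
  unfolding phi_def using D_zero[OF dual.D_obj[OF Y] X]
    C'.comp_zero[OF inv_arr(1)[OF dual.unit_iso[OF Y]] D_obj[OF X]] by simp

lemma phi_inj:
  assumes "Y \<in> Obj C'" "\<guillemotleft>g : omap D' Y \<rightarrow>\<^bsub>C\<^esub> X\<guillemotright>" "\<guillemotleft>h : omap D' Y \<rightarrow>\<^bsub>C\<^esub> X\<guillemotright>" "phi Y g = phi Y h"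
  shows "g = h"
  using psi_phi[OF assms(1,2)] psi_phi[OF assms(1,3)] assms(4) by metis

lemma phi_surj:
  assumes "X \<in> Obj C" "\<guillemotleft>h : omap D X \<rightarrow>\<^bsub>C'\<^esub> Y\<guillemotright>"
  obtains g where "\<guillemotleft>g : omap D' Y \<rightarrow>\<^bsub>C\<^esub> X\<guillemotright>" "phi Y g = h"
  using dual.phi_in_hom[OF assms] dual.psi_phi[OF assms] by blast

end

section \<open>The functor \<open>\<delta>\<close> of a dual pair\<close>

context dual_pair
begin

interpretation dual: dual_pair C' C D' D \<epsilon> \<eta> by (rule dual)
interpretation N: preadditive "AbFun C" by (rule C.preadditive_AbFun)
interpretation N': preadditive "AbFun C'" by (rule C'.preadditive_AbFun)

text \<open>The group of transformations before recoding. Computations take place here, the codes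
  being unpacked by \<open>delta_elem\<close>.\<close>

abbreviation H :: "('t, 'u) abftor \<Rightarrow> 's \<Rightarrow> ('t, 'u) abtrans monoid" where
  "H F Y \<equiv> Hom (AbFun C) F (hom_ftor C (omap D' Y))"

abbreviation \<delta> :: "('t, 'u) abftor \<Rightarrow> ('s, 'u) abftor" where
  "\<delta> F \<equiv> delta_obj C C' D' F"

lemma omap_delta: "omap (\<delta> F) Y = small_copy (H F Y)"
  by (simp add: delta_obj_def)

context
  fixes F :: "('t, 'u) abftor" and Y :: 's
  assumes F: "is_additive_functor C Ab F" and Y: "Y \<in> Obj C'"
begin

lemma small_H: "small TYPE('u) (carrier (H F Y))"
  by (rule C.small_trans[OF F C.hom_ftor_additive[OF dual.D_obj[OF Y]]])

lemma comm_group_H: "comm_group (H F Y)"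
  using F C.hom_ftor_additive[OF dual.D_obj[OF Y]] by (intro N.hom_group) auto

lemmas decode_H = decode_encode[OF small_H]
  and encode_H = encode_in_small_copy[OF small_H, folded omap_delta]
  and mult_H = mult_small_copy[OF small_H, folded omap_delta, simplified mult_Hom]
  and one_H = one_small_copy[OF small_H, folded omap_delta, simplified one_Hom]
  and delta_elem = small_copyE[OF small_H, folded omap_delta]
  and inj_H = inj_onD[OF inj_encode[OF small_H]]

lemma act_delta:
  assumes v: "\<guillemotleft>v : Y \<rightarrow>\<^bsub>C'\<^esub> Y'\<guillemotright>" and s: "\<sigma> \<in> carrier (H F Y)"
  shows "act (\<delta> F) v (encode (H F Y) \<sigma>) = encode (H F Y') (hom_trans C (Obj C) (amap D' v) \<cdot>\<^bsub>AbFun C\<^esub> \<sigma>)"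
  using v encode_H[OF s] decode_H[OF s] omap_delta[of F Y]
  by (simp add: act_def delta_obj_def small_copy_map_def in_hom_iff)

end

lemma hom_trans_D':
  "\<guillemotleft>v : Y \<rightarrow>\<^bsub>C'\<^esub> Y'\<guillemotright> \<Longrightarrow> hom_trans C (Obj C) (amap D' v) \<in>
     carrier (Hom (AbFun C) (hom_ftor C (omap D' Y)) (hom_ftor C (omap D' Y')))"
  by (rule C.hom_trans_in_hom[OF dual.D_arr])

lemma delta_push:
  "\<guillemotleft>v : Y \<rightarrow>\<^bsub>C'\<^esub> Y'\<guillemotright> \<Longrightarrow> \<sigma> \<in> carrier (H F Y) \<Longrightarrow>
     hom_trans C (Obj C) (amap D' v) \<cdot>\<^bsub>AbFun C\<^esub> \<sigma> \<in> carrier (H F Y')"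
  by (rule N.comp[OF _ hom_trans_D'])

lemma app_delta_push:
  assumes v: "\<guillemotleft>v : Y \<rightarrow>\<^bsub>C'\<^esub> Y'\<guillemotright>" and s: "\<sigma> \<in> carrier (H F Y)" and X: "X \<in> Obj C" and x: "x \<in> carrier (omap F X)"
  shows "app (hom_trans C (Obj C) (amap D' v) \<cdot>\<^bsub>AbFun C\<^esub> \<sigma>) X x = app \<sigma> X x \<cdot>\<^bsub>C\<^esub> amap D' v"
  using C.app_comp[OF s X x] C.app_closed[OF s X x] C.app_hom_trans[OF dual.D_arr[OF v]] by simp

lemma app_H_in_hom:
  "\<sigma> \<in> carrier (H F Y) \<Longrightarrow> X \<in> Obj C \<Longrightarrow> x \<in> carrier (omap F X) \<Longrightarrow> \<guillemotleft>app \<sigma> X x : omap D' Y \<rightarrow>\<^bsub>C\<^esub> X\<guillemotright>"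
  using C.app_closed by fastforce

text \<open>Functoriality in \<open>Y\<close> is inherited from D' followed by the representable
  embedding, and additivity from that of D', which is \<open>dual.D_add\<close>.\<close>

lemma delta_additive:
  assumes F: "is_additive_functor C Ab F"
  shows "is_additive_functor C' Ab (\<delta> F)"
proof (rule additive_functorI[OF C'.preadditive_axioms, where a = "act (\<delta> F)"])
  note del = delta_elem[OF F] and grp = comm_group_small_copy[OF small_H[OF F] comm_group_H[OF F], folded omap_delta]
  show "comm_group (omap (\<delta> F) Y)" if "Y \<in> Obj C'" for Y by (intro grp that)
  show "small TYPE('u) (carrier (omap (\<delta> F) Y))" if "Y \<in> Obj C'" for Y
    unfolding omap_delta by (rule small_small_copy[OF small_H[OF F that]])
  show "amap (\<delta> F) v = Arrow (omap (\<delta> F) Y) (omap (\<delta> F) Y') (\<lambda>s\<in>carrier (omap (\<delta> F) Y). act (\<delta> F) v s)"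
    if "\<guillemotleft>v : Y \<rightarrow>\<^bsub>C'\<^esub> Y'\<guillemotright>" for Y Y' v
    using that by (auto simp: act_def delta_obj_def small_copy_map_def in_hom_iff fun_eq_iff)
  show "act (\<delta> F) v \<in> hom (omap (\<delta> F) Y) (omap (\<delta> F) Y')" if v: "\<guillemotleft>v : Y \<rightarrow>\<^bsub>C'\<^esub> Y'\<guillemotright>" for Y Y' v
  proof -
    have Y: "Y \<in> Obj C'" "Y' \<in> Obj C'" using C'.hom_objs[OF v] by auto
    show ?thesis
    proof (rule homI)
      fix s assume "s \<in> carrier (omap (\<delta> F) Y)"
      then obtain \<sigma> where s: "\<sigma> \<in> carrier (H F Y)" "s = encode (H F Y) \<sigma>" using del[OF Y(1)] by metis
      show "act (\<delta> F) v s \<in> carrier (omap (\<delta> F) Y')"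
        using act_delta[OF F Y(1) v s(1)] s(2) encode_H[OF F Y(2) delta_push[OF v s(1)]] by simp
      fix t assume "t \<in> carrier (omap (\<delta> F) Y)"
      then obtain \<tau> where t: "\<tau> \<in> carrier (H F Y)" "t = encode (H F Y) \<tau>" using del[OF Y(1)] by metis
      show "act (\<delta> F) v (s \<otimes>\<^bsub>omap (\<delta> F) Y\<^esub> t) = act (\<delta> F) v s \<otimes>\<^bsub>omap (\<delta> F) Y'\<^esub> act (\<delta> F) v t"
        using act_delta[OF F Y(1) v s(1)] act_delta[OF F Y(1) v t(1)] act_delta[OF F Y(1) v N.add_in_hom[OF s(1) t(1)]]
          mult_H[OF F Y(1) s(1) t(1)] mult_H[OF F Y(2) delta_push[OF v s(1)] delta_push[OF v t(1)]] s(2) t(2)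
          N.distrib_left[OF s(1) t(1) hom_trans_D'[OF v]] by simp
    qed
  qed
  show "act (\<delta> F) (Ident C' Y) s = s" if Y: "Y \<in> Obj C'" and s: "s \<in> carrier (omap (\<delta> F) Y)" for Y s
  proof -
    obtain \<sigma> where s: "\<sigma> \<in> carrier (H F Y)" "s = encode (H F Y) \<sigma>" using del[OF Y s] by metis
    have "hom_trans C (Obj C) (amap D' (Ident C' Y)) = Ident (AbFun C) (hom_ftor C (omap D' Y))"
      using functor_ident[OF C.hom_embed_functor, of "omap D' Y"] dual.D_obj[OF Y] dual.D_ident[OF Y]
      by (simp add: hom_embed_def)
    then show ?thesis
      using act_delta[OF F Y C'.ident[OF Y] s(1)] s(2) N.ident_left[OF s(1)] by simp
  qed
  show "act (\<delta> F) (w \<cdot>\<^bsub>C'\<^esub> v) s = act (\<delta> F) w (act (\<delta> F) v s)"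
    if v: "\<guillemotleft>v : Y \<rightarrow>\<^bsub>C'\<^esub> Y'\<guillemotright>" and w: "\<guillemotleft>w : Y' \<rightarrow>\<^bsub>C'\<^esub> Y''\<guillemotright>" and s: "s \<in> carrier (omap (\<delta> F) Y)"
    for Y Y' Y'' v w s
  proof -
    have Y: "Y \<in> Obj C'" "Y' \<in> Obj C'" using C'.hom_objs[OF v] by auto
    obtain \<sigma> where s: "\<sigma> \<in> carrier (H F Y)" "s = encode (H F Y) \<sigma>" using del[OF Y(1) s] by metis
    have "hom_trans C (Obj C) (amap D' (w \<cdot>\<^bsub>C'\<^esub> v)) =
        hom_trans C (Obj C) (amap D' w) \<cdot>\<^bsub>AbFun C\<^esub> hom_trans C (Obj C) (amap D' v)"
      using functor_comp[OF C.hom_embed_functor, of "amap D' v" "omap D' Y" "omap D' Y'" "amap D' w" "omap D' Y''"]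
        dual.D_arr[OF v] dual.D_arr[OF w] dual.D_comp[OF v w] by (simp add: hom_embed_def)
    then show ?thesis
      using act_delta[OF F Y(1) v s(1)] act_delta[OF F Y(1) C'.comp[OF v w] s(1)]
        act_delta[OF F Y(2) w delta_push[OF v s(1)]] s(2)
        N.assoc[OF s(1) hom_trans_D'[OF v] hom_trans_D'[OF w]] by simp
  qed
  show "act (\<delta> F) (v \<boxplus>\<^bsub>C'\<^esub> w) s = act (\<delta> F) v s \<otimes>\<^bsub>omap (\<delta> F) Y'\<^esub> act (\<delta> F) w s"
    if v: "\<guillemotleft>v : Y \<rightarrow>\<^bsub>C'\<^esub> Y'\<guillemotright>" and w: "\<guillemotleft>w : Y \<rightarrow>\<^bsub>C'\<^esub> Y'\<guillemotright>" and s: "s \<in> carrier (omap (\<delta> F) Y)"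
    for Y Y' v w s
  proof -
    have Y: "Y \<in> Obj C'" "Y' \<in> Obj C'" using C'.hom_objs[OF v] by auto
    obtain \<sigma> where s: "\<sigma> \<in> carrier (H F Y)" "s = encode (H F Y) \<sigma>" using del[OF Y(1) s] by metis
    show ?thesis
      using act_delta[OF F Y(1) v s(1)] act_delta[OF F Y(1) w s(1)] act_delta[OF F Y(1) C'.add_in_hom[OF v w] s(1)]
        s(2) dual.D_add[OF v w] C.hom_trans_add[OF dual.D_arr[OF v] dual.D_arr[OF w]]
        N.distrib_right[OF s(1) hom_trans_D'[OF v] hom_trans_D'[OF w]]
        mult_H[OF F Y(2) delta_push[OF v s(1)] delta_push[OF w s(1)]] by simp
  qed
qed

text \<open>Precomposition with \<tau> commutes with the action on \<delta>, which is a
  postcomposition, by associativity.\<close>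

lemma amap_delta:
  assumes t: "\<tau> \<in> carrier (Hom (AbFun C) F G)"
  shows "amap (delta C C' D') \<tau> \<in> carrier (Hom (AbFun C') (\<delta> G) (\<delta> F))"
    and "Y \<in> Obj C' \<Longrightarrow> \<sigma> \<in> carrier (H G Y) \<Longrightarrow>
      app (amap (delta C C' D') \<tau>) Y (encode (H G Y) \<sigma>) = encode (H F Y) (\<sigma> \<cdot>\<^bsub>AbFun C\<^esub> \<tau>)"
proof -
  have F: "is_additive_functor C Ab F" and G: "is_additive_functor C Ab G"
    and st: "source \<tau> = F" "target \<tau> = G"
    using t by (auto simp: in_hom_fun_cat)
  let ?t = "\<lambda>Y (s :: 'u). encode (H F Y) (decode (H G Y) s \<cdot>\<^bsub>AbFun C\<^esub> \<tau>) :: 'u"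
  have eq: "amap (delta C C' D') \<tau> = trans_of C' (\<delta> G) (\<delta> F) ?t"
    by (simp add: delta_def st trans_of_def small_copy_map_def omap_delta)
  have val: "?t Y (encode (H G Y) \<sigma>) = encode (H F Y) (\<sigma> \<cdot>\<^bsub>AbFun C\<^esub> \<tau>)" if "Y \<in> Obj C'" "\<sigma> \<in> carrier (H G Y)" for Y \<sigma>
    using decode_H[OF G that] by simp
  show "app (amap (delta C C' D') \<tau>) Y (encode (H G Y) \<sigma>) = encode (H F Y) (\<sigma> \<cdot>\<^bsub>AbFun C\<^esub> \<tau>)"
    if Y: "Y \<in> Obj C'" and s: "\<sigma> \<in> carrier (H G Y)" for Y \<sigma>
    unfolding eq using val[OF Y s] encode_H[OF G Y s] Y by simp
  show "amap (delta C C' D') \<tau> \<in> carrier (Hom (AbFun C') (\<delta> G) (\<delta> F))"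
    unfolding eq
  proof (rule C'.trans_ofI[OF delta_additive[OF G] delta_additive[OF F]])
    show "?t Y \<in> hom (omap (\<delta> G) Y) (omap (\<delta> F) Y)" if Y: "Y \<in> Obj C'" for Y
    proof (rule homI)
      fix s assume "s \<in> carrier (omap (\<delta> G) Y)"
      then obtain \<sigma> where s: "\<sigma> \<in> carrier (H G Y)" "s = encode (H G Y) \<sigma>" using delta_elem[OF G Y] by metis
      show "?t Y s \<in> carrier (omap (\<delta> F) Y)"
        using val[OF Y s(1)] s(2) encode_H[OF F Y N.comp[OF t s(1)]] by simp
      fix r assume "r \<in> carrier (omap (\<delta> G) Y)"
      then obtain \<rho> where r: "\<rho> \<in> carrier (H G Y)" "r = encode (H G Y) \<rho>" using delta_elem[OF G Y] by metis
      show "?t Y (s \<otimes>\<^bsub>omap (\<delta> G) Y\<^esub> r) = ?t Y s \<otimes>\<^bsub>omap (\<delta> F) Y\<^esub> ?t Y r"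
        using val[OF Y s(1)] val[OF Y r(1)] val[OF Y N.add_in_hom[OF s(1) r(1)]] s(2) r(2)
          mult_H[OF G Y s(1) r(1)] mult_H[OF F Y N.comp[OF t s(1)] N.comp[OF t r(1)]]
          N.distrib_right[OF t s(1) r(1)] by simp
    qed
    show "?t Y' (act (\<delta> G) v s) = act (\<delta> F) v (?t Y s)"
      if v: "\<guillemotleft>v : Y \<rightarrow>\<^bsub>C'\<^esub> Y'\<guillemotright>" and s: "s \<in> carrier (omap (\<delta> G) Y)" for Y Y' v s
    proof -
      have Y: "Y \<in> Obj C'" "Y' \<in> Obj C'" using C'.hom_objs[OF v] by auto
      obtain \<sigma> where s: "\<sigma> \<in> carrier (H G Y)" "s = encode (H G Y) \<sigma>" using delta_elem[OF G Y(1) s] by metis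
      show ?thesis
        using val[OF Y(1) s(1)] val[OF Y(2) delta_push[OF v s(1)]] s(2) act_delta[OF G Y(1) v s(1)]
          act_delta[OF F Y(1) v N.comp[OF t s(1)]] N.assoc[OF t s(1) hom_trans_D'[OF v]] by simp
    qed
  qed
qed

lemma delta_eqI:
  assumes F: "is_additive_functor C Ab F"
    and a: "\<alpha> \<in> carrier (Hom (AbFun C') (\<delta> F) G)" and b: "\<beta> \<in> carrier (Hom (AbFun C') (\<delta> F) G)"
    and e: "\<And>Y \<sigma>. Y \<in> Obj C' \<Longrightarrow> \<sigma> \<in> carrier (H F Y) \<Longrightarrow>
      app \<alpha> Y (encode (H F Y) \<sigma>) = app \<beta> Y (encode (H F Y) \<sigma>)"
  shows "\<alpha> = \<beta>"
proof (rule C'.trans_eqI[OF a b])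
  fix Y s assume Y: "Y \<in> Obj C'" and "s \<in> carrier (omap (\<delta> F) Y)"
  then obtain \<sigma> where "\<sigma> \<in> carrier (H F Y)" "s = encode (H F Y) \<sigma>" using delta_elem[OF F Y] by metis
  then show "app \<alpha> Y s = app \<beta> Y s" using e[OF Y] by simp
qed

lemma delta_additive_functor: "is_additive_functor (op (AbFun C)) (AbFun C') (delta C C' D')"
proof -
  have obj: "omap (delta C C' D') F = \<delta> F" for F by (simp add: delta_def)
  have ident: "amap (delta C C' D') (Ident (AbFun C) F) = Ident (AbFun C') (\<delta> F)"
    if F: "is_additive_functor C Ab F" for F
  proof -
    have i: "Ident (AbFun C) F \<in> carrier (Hom (AbFun C) F F)" using F by (intro N.ident) simp
    have i': "Ident (AbFun C') (\<delta> F) \<in> carrier (Hom (AbFun C') (\<delta> F) (\<delta> F))"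
      using delta_additive[OF F] by (intro N'.ident) simp
    show ?thesis
      using amap_delta(2)[OF i] N.ident_right encode_H[OF F]
      by (intro delta_eqI[OF F amap_delta(1)[OF i] i']) (simp add: C'.app_ident)
  qed
  have comp: "amap (delta C C' D') (\<tau> \<cdot>\<^bsub>AbFun C\<^esub> \<sigma>) =
      amap (delta C C' D') \<sigma> \<cdot>\<^bsub>AbFun C'\<^esub> amap (delta C C' D') \<tau>"
    if s: "\<sigma> \<in> carrier (Hom (AbFun C) F G)" and t: "\<tau> \<in> carrier (Hom (AbFun C) G K)" for \<sigma> \<tau> F G K
  proof -
    have K: "is_additive_functor C Ab K" using C.trans_functors[OF t] by simp
    show ?thesis
    proof (rule delta_eqI[OF K amap_delta(1)[OF N.comp[OF s t]] N'.comp[OF amap_delta(1)[OF t] amap_delta(1)[OF s]]])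
      fix Y \<rho> assume Y: "Y \<in> Obj C'" and r: "\<rho> \<in> carrier (H K Y)"
      show "app (amap (delta C C' D') (\<tau> \<cdot>\<^bsub>AbFun C\<^esub> \<sigma>)) Y (encode (H K Y) \<rho>) =
          app (amap (delta C C' D') \<sigma> \<cdot>\<^bsub>AbFun C'\<^esub> amap (delta C C' D') \<tau>) Y (encode (H K Y) \<rho>)"
        using amap_delta(2)[OF N.comp[OF s t] Y r] amap_delta(2)[OF t Y r] amap_delta(2)[OF s Y N.comp[OF t r]]
          C'.app_comp[OF amap_delta(1)[OF t] Y encode_H[OF K Y r]] N.assoc[OF s t r] by simp
    qed
  qed
  have add: "amap (delta C C' D') (\<sigma> \<boxplus>\<^bsub>AbFun C\<^esub> \<tau>) =
      amap (delta C C' D') \<sigma> \<boxplus>\<^bsub>AbFun C'\<^esub> amap (delta C C' D') \<tau>"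
    if s: "\<sigma> \<in> carrier (Hom (AbFun C) F G)" and t: "\<tau> \<in> carrier (Hom (AbFun C) F G)" for \<sigma> \<tau> F G
  proof -
    have F: "is_additive_functor C Ab F" and G: "is_additive_functor C Ab G" using C.trans_functors[OF t] by auto
    show ?thesis
    proof (rule delta_eqI[OF G amap_delta(1)[OF N.add_in_hom[OF s t]] N'.add_in_hom[OF amap_delta(1)[OF s] amap_delta(1)[OF t]]])
      fix Y \<rho> assume Y: "Y \<in> Obj C'" and r: "\<rho> \<in> carrier (H G Y)"
      show "app (amap (delta C C' D') (\<sigma> \<boxplus>\<^bsub>AbFun C\<^esub> \<tau>)) Y (encode (H G Y) \<rho>) =
          app (amap (delta C C' D') \<sigma> \<boxplus>\<^bsub>AbFun C'\<^esub> amap (delta C C' D') \<tau>) Y (encode (H G Y) \<rho>)"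
        using amap_delta(2)[OF N.add_in_hom[OF s t] Y r] amap_delta(2)[OF t Y r] amap_delta(2)[OF s Y r]
          C'.app_add[OF amap_delta(1)[OF s] Y encode_H[OF G Y r]] N.distrib_left[OF s t r]
          mult_H[OF F Y N.comp[OF s r] N.comp[OF t r]] by simp
    qed
  qed
  show ?thesis
    unfolding is_additive_functor_def is_functor_def
  proof (intro conjI allI impI ballI; (elim conjE)?)
    fix F G K \<sigma> \<tau>
    assume "\<sigma> \<in> carrier (Hom (op (AbFun C)) F G)" "\<tau> \<in> carrier (Hom (op (AbFun C)) G K)"
    then show "amap (delta C C' D') (\<tau> \<cdot>\<^bsub>op (AbFun C)\<^esub> \<sigma>) =
        amap (delta C C' D') \<tau> \<cdot>\<^bsub>AbFun C'\<^esub> amap (delta C C' D') \<sigma>"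
      using comp[of \<tau> K G \<sigma> F] by simp
  next
    fix F G \<sigma> \<tau>
    assume "\<sigma> \<in> carrier (Hom (op (AbFun C)) F G)" "\<tau> \<in> carrier (Hom (op (AbFun C)) F G)"
    then show "amap (delta C C' D') (\<sigma> \<boxplus>\<^bsub>op (AbFun C)\<^esub> \<tau>) =
        amap (delta C C' D') \<sigma> \<boxplus>\<^bsub>AbFun C'\<^esub> amap (delta C C' D') \<tau>"
      using add[of \<sigma> G F \<tau>] by simp
  qed (use obj delta_additive ident amap_delta(1) in simp_all)
qed

text \<open>At Y the isomorphism sends the code of a transformation \<sigma> from Hom(X,-) to
  Hom(D'Y,-) to the adjoint of \<sigma>(1); Yoneda and \<open>phi\<close> are both bijective. Each
  side composes two contravariant functors, so naturality is over \<open>C\<close> itself.\<close>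

lemma delta_hom_iso:
  "\<exists>\<alpha>. nat_iso C (AbFun C') (delta C C' D' \<circ>\<^sub>F hom_embed C) (hom_embed C' \<circ>\<^sub>F D) \<alpha>"
proof -
  let ?h = "\<lambda>X. hom_ftor C X" and ?h' = "\<lambda>X. hom_ftor C' (omap D X)"
  let ?t = "\<lambda>X Y (s :: 'u). phi Y (app (decode (H (?h X) Y) s) X (Ident C X))"
  define \<alpha> where "\<alpha> X = trans_of C' (\<delta> (?h X)) (?h' X) (?t X)" for X
  have val: "?t X Y (encode (H (?h X) Y) \<sigma>) = phi Y (app \<sigma> X (Ident C X))"
    if "X \<in> Obj C" "Y \<in> Obj C'" "\<sigma> \<in> carrier (H (?h X) Y)" for X Y \<sigma>
    using decode_H[OF C.hom_ftor_additive that(2,3)] that(1) by simp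
  have pt: "\<guillemotleft>app \<sigma> X (Ident C X) : omap D' Y \<rightarrow>\<^bsub>C\<^esub> X\<guillemotright>"
    if "X \<in> Obj C" "\<sigma> \<in> carrier (H (?h X) Y)" for X Y \<sigma>
    using app_H_in_hom[OF that(2,1), of "Ident C X"] C.ident[OF that(1)] by simp
  have a: "\<alpha> X \<in> carrier (Hom (AbFun C') (\<delta> (?h X)) (?h' X))" if X: "X \<in> Obj C" for X
    unfolding \<alpha>_def
  proof (rule C'.trans_ofI[OF delta_additive[OF C.hom_ftor_additive[OF X]] C'.hom_ftor_additive[OF D_obj[OF X]]])
    note hX = C.hom_ftor_additive[OF X]
    have i: "Ident C X \<in> carrier (omap (?h X) X)" using C.ident[OF X] by simp
    show "?t X Y \<in> hom (omap (\<delta> (?h X)) Y) (omap (?h' X) Y)" if Y: "Y \<in> Obj C'" for Y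
    proof (rule homI)
      fix s assume "s \<in> carrier (omap (\<delta> (?h X)) Y)"
      then obtain \<sigma> where s: "\<sigma> \<in> carrier (H (?h X) Y)" "s = encode (H (?h X) Y) \<sigma>" using delta_elem[OF hX Y] by metis
      show "?t X Y s \<in> carrier (omap (?h' X) Y)"
        using val[OF X Y s(1)] s(2) phi_in_hom[OF Y pt[OF X s(1)]] by simp
      fix r assume "r \<in> carrier (omap (\<delta> (?h X)) Y)"
      then obtain \<rho> where r: "\<rho> \<in> carrier (H (?h X) Y)" "r = encode (H (?h X) Y) \<rho>" using delta_elem[OF hX Y] by metis
      show "?t X Y (s \<otimes>\<^bsub>omap (\<delta> (?h X)) Y\<^esub> r) = ?t X Y s \<otimes>\<^bsub>omap (?h' X) Y\<^esub> ?t X Y r"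
        using val[OF X Y s(1)] val[OF X Y r(1)] val[OF X Y N.add_in_hom[OF s(1) r(1)]] s(2) r(2)
          mult_H[OF hX Y s(1) r(1)] C.app_add[OF s(1) X i, of \<rho>] phi_add[OF Y pt[OF X s(1)] pt[OF X r(1)]] by simp
    qed
    show "?t X Y' (act (\<delta> (?h X)) v s) = act (?h' X) v (?t X Y s)"
      if v: "\<guillemotleft>v : Y \<rightarrow>\<^bsub>C'\<^esub> Y'\<guillemotright>" and s: "s \<in> carrier (omap (\<delta> (?h X)) Y)" for Y Y' v s
    proof -
      have Y: "Y \<in> Obj C'" "Y' \<in> Obj C'" using C'.hom_objs[OF v] by auto
      obtain \<sigma> where s: "\<sigma> \<in> carrier (H (?h X) Y)" "s = encode (H (?h X) Y) \<sigma>" using delta_elem[OF hX Y(1) s] by metis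
      show ?thesis
        using val[OF X Y(1) s(1)] val[OF X Y(2) delta_push[OF v s(1)]] s(2) act_delta[OF hX Y(1) v s(1)]
          app_delta_push[OF v s(1) X i] phi_postcomp[OF pt[OF X s(1)] v]
          C'.act_hom_ftor[OF v phi_in_hom[OF Y(1) pt[OF X s(1)]]] by simp
    qed
  qed
  have app_a: "app (\<alpha> X) Y (encode (H (?h X) Y) \<sigma>) = phi Y (app \<sigma> X (Ident C X))"
    if "X \<in> Obj C" "Y \<in> Obj C'" "\<sigma> \<in> carrier (H (?h X) Y)" for X Y \<sigma>
    using val[OF that] encode_H[OF C.hom_ftor_additive[OF that(1)] that(2,3)] that(2) by (simp add: \<alpha>_def)
  have iso: "is_iso (AbFun C') (\<alpha> X) (\<delta> (?h X)) (?h' X)" if X: "X \<in> Obj C" for X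
  proof (rule C'.trans_iso_if_bij[OF a[OF X]])
    fix Y assume Y: "Y \<in> Obj C'"
    note hX = C.hom_ftor_additive[OF X]
    show "bij_betw (app (\<alpha> X) Y) (carrier (omap (\<delta> (?h X)) Y)) (carrier (omap (?h' X) Y))"
      unfolding bij_betw_def
    proof (intro conjI subset_antisym)
      show "inj_on (app (\<alpha> X) Y) (carrier (omap (\<delta> (?h X)) Y))"
      proof (rule inj_onI)
        fix s r assume s: "s \<in> carrier (omap (\<delta> (?h X)) Y)" and r: "r \<in> carrier (omap (\<delta> (?h X)) Y)"
          and e: "app (\<alpha> X) Y s = app (\<alpha> X) Y r"
        obtain \<sigma> where s: "\<sigma> \<in> carrier (H (?h X) Y)" "s = encode (H (?h X) Y) \<sigma>" using delta_elem[OF hX Y s] by metis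
        obtain \<rho> where r: "\<rho> \<in> carrier (H (?h X) Y)" "r = encode (H (?h X) Y) \<rho>" using delta_elem[OF hX Y r] by metis
        have "app \<sigma> X (Ident C X) = app \<rho> X (Ident C X)"
          using e app_a[OF X Y s(1)] app_a[OF X Y r(1)] s(2) r(2) phi_inj[OF Y pt[OF X s(1)] pt[OF X r(1)]] by simp
        then have "\<sigma> = \<rho>"
          using C.yoneda[OF s(1)] C.yoneda[OF r(1)] by (intro C.trans_eqI[OF s(1) r(1)]) simp
        then show "s = r" using s r by simp
      qed
      show "app (\<alpha> X) Y ` carrier (omap (\<delta> (?h X)) Y) \<subseteq> carrier (omap (?h' X) Y)"
        using C'.app_closed[OF a[OF X] Y] by (rule image_subsetI)
      show "carrier (omap (?h' X) Y) \<subseteq> app (\<alpha> X) Y ` carrier (omap (\<delta> (?h X)) Y)"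
      proof
        fix h assume "h \<in> carrier (omap (?h' X) Y)"
        then have h: "\<guillemotleft>h : omap D X \<rightarrow>\<^bsub>C'\<^esub> Y\<guillemotright>" by simp
        \<comment> \<open>The preimage of \<open>h\<close> is Hom(g,-) for the arrow
          \<open>g\<close> adjoint to \<open>h\<close>.\<close>
        obtain g where g: "\<guillemotleft>g : omap D' Y \<rightarrow>\<^bsub>C\<^esub> X\<guillemotright>" "phi Y g = h" by (rule phi_surj[OF X h])
        note s = C.hom_trans_in_hom[OF g(1)]
        have "app (\<alpha> X) Y (encode (H (?h X) Y) (hom_trans C (Obj C) g)) = h"
          using app_a[OF X Y s] C.app_hom_trans[OF g(1) C.ident[OF X]] C.ident_left[OF g(1)] g(2) by simp
        then show "h \<in> app (\<alpha> X) Y ` carrier (omap (\<delta> (?h X)) Y)"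
          using encode_H[OF hX Y s] by (metis imageI)
      qed
    qed
  qed
  have nat: "hom_trans C' (Obj C') (amap D u) \<cdot>\<^bsub>AbFun C'\<^esub> \<alpha> X =
      \<alpha> X' \<cdot>\<^bsub>AbFun C'\<^esub> amap (delta C C' D') (hom_trans C (Obj C) u)"
    if u: "\<guillemotleft>u : X \<rightarrow>\<^bsub>C\<^esub> X'\<guillemotright>" for X X' u
  proof -
    have X: "X \<in> Obj C" "X' \<in> Obj C" using C.hom_objs[OF u] by auto
    note hX = C.hom_ftor_additive[OF X(1)]
    note hu = C.hom_trans_in_hom[OF u] and hDu = C'.hom_trans_in_hom[OF D_arr[OF u]]
    show ?thesis
    proof (rule delta_eqI[OF hX N'.comp[OF a[OF X(1)] hDu] N'.comp[OF amap_delta(1)[OF hu] a[OF X(2)]]])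
      fix Y \<sigma> assume Y: "Y \<in> Obj C'" and s: "\<sigma> \<in> carrier (H (?h X) Y)"
      note e = encode_H[OF hX Y s] and g = pt[OF X(1) s]
      have i': "Ident C X' \<in> carrier (omap (?h X') X')" using C.ident[OF X(2)] by simp
      \<comment> \<open>By Yoneda, precomposition with Hom(u,-) composes the classifying arrow of
        \<sigma> with \<open>u\<close>; \<open>phi_precomp\<close> then turns \<open>u\<close> into
        D u.\<close>
      have "app (\<sigma> \<cdot>\<^bsub>AbFun C\<^esub> hom_trans C (Obj C) u) X' (Ident C X') = app \<sigma> X' u"
        using C.app_comp[OF hu X(2) i'] C.app_hom_trans[OF u C.ident[OF X(2)]] C.ident_left[OF u] by simp
      also have "\<dots> = u \<cdot>\<^bsub>C\<^esub> app \<sigma> X (Ident C X)"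
        using C.yoneda[OF s u] C.act_hom_ftor[OF u g] by simp
      finally show "app (hom_trans C' (Obj C') (amap D u) \<cdot>\<^bsub>AbFun C'\<^esub> \<alpha> X) Y (encode (H (?h X) Y) \<sigma>) =
          app (\<alpha> X' \<cdot>\<^bsub>AbFun C'\<^esub> amap (delta C C' D') (hom_trans C (Obj C) u)) Y (encode (H (?h X) Y) \<sigma>)"
        using C'.app_comp[OF a[OF X(1)] Y e] C'.app_comp[OF amap_delta(1)[OF hu] Y e]
          app_a[OF X(1) Y s] amap_delta(2)[OF hu Y s] app_a[OF X(2) Y N.comp[OF hu s]]
          C'.app_hom_trans[OF D_arr[OF u] phi_in_hom[OF Y g]] phi_precomp[OF Y g u] by simp
    qed
  qed
  have "nat_iso C (AbFun C') (delta C C' D' \<circ>\<^sub>F hom_embed C) (hom_embed C' \<circ>\<^sub>F D) \<alpha>"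
    unfolding nat_iso_def nat_trans_def using a iso nat
    by (simp add: hom_embed_def) (simp add: delta_def)
  then show ?thesis by blast
qed

end

section \<open>Evaluation into the double dual\<close>

context dual_pair
begin

interpretation dual: dual_pair C' C D' D \<epsilon> \<eta> by (rule dual)
interpretation N: preadditive "AbFun C" by (rule C.preadditive_AbFun)
interpretation N': preadditive "AbFun C'" by (rule C'.preadditive_AbFun)

text \<open>Evaluation at \<open>x\<close>, as a transformation from \<delta> F to Hom(DX,-) and
  thus an uncoded element of the double dual at \<open>X\<close>. The plain value \<sigma>(x) is an
  arrow D'Y -> X; \<open>phi\<close> turns it into an arrow DX -> Y, as the target requires.\<close>

definition ev_at :: "('t, 'u) abftor \<Rightarrow> 't \<Rightarrow> 'u \<Rightarrow> ('s, 'u) abtrans" where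
  "ev_at F X x = trans_of C' (\<delta> F) (hom_ftor C' (omap D X)) (\<lambda>Y s. phi Y (app (decode (H F Y) s) X x))"

definition ev :: "('t, 'u) abftor \<Rightarrow> ('t, 'u) abtrans" where
  "ev F = trans_of C F (dual.\<delta> (\<delta> F)) (\<lambda>X x. encode (dual.H (\<delta> F) X) (ev_at F X x))"

context
  fixes F :: "('t, 'u) abftor"
  assumes F: "is_additive_functor C Ab F"
begin

lemma app_ev_at:
  assumes "Y \<in> Obj C'" "\<sigma> \<in> carrier (H F Y)"
  shows "app (ev_at F X x) Y (encode (H F Y) \<sigma>) = phi Y (app \<sigma> X x)"
  using encode_H[OF F assms] decode_H[OF F assms] assms(1) by (simp add: ev_at_def)

lemma ev_at_in_hom:
  assumes X: "X \<in> Obj C" and x: "x \<in> carrier (omap F X)"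
  shows "ev_at F X x \<in> carrier (dual.H (\<delta> F) X)"
  unfolding ev_at_def
proof (rule C'.trans_ofI[OF delta_additive[OF F] C'.hom_ftor_additive[OF D_obj[OF X]]])
  let ?t = "\<lambda>Y (s :: 'u). phi Y (app (decode (H F Y) s) X x)"
  have val: "?t Y (encode (H F Y) \<sigma>) = phi Y (app \<sigma> X x)" if "Y \<in> Obj C'" "\<sigma> \<in> carrier (H F Y)" for Y \<sigma>
    using decode_H[OF F that] by simp
  show "?t Y \<in> hom (omap (\<delta> F) Y) (omap (hom_ftor C' (omap D X)) Y)" if Y: "Y \<in> Obj C'" for Y
  proof (rule homI)
    fix s assume "s \<in> carrier (omap (\<delta> F) Y)"
    then obtain \<sigma> where s: "\<sigma> \<in> carrier (H F Y)" "s = encode (H F Y) \<sigma>" using delta_elem[OF F Y] by metis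
    show "?t Y s \<in> carrier (omap (hom_ftor C' (omap D X)) Y)"
      using val[OF Y s(1)] s(2) phi_in_hom[OF Y app_H_in_hom[OF s(1) X x]] by simp
    fix r assume "r \<in> carrier (omap (\<delta> F) Y)"
    then obtain \<rho> where r: "\<rho> \<in> carrier (H F Y)" "r = encode (H F Y) \<rho>" using delta_elem[OF F Y] by metis
    show "?t Y (s \<otimes>\<^bsub>omap (\<delta> F) Y\<^esub> r) = ?t Y s \<otimes>\<^bsub>omap (hom_ftor C' (omap D X)) Y\<^esub> ?t Y r"
      using val[OF Y s(1)] val[OF Y r(1)] val[OF Y N.add_in_hom[OF s(1) r(1)]] s(2) r(2)
        mult_H[OF F Y s(1) r(1)] C.app_add[OF s(1) X x, of \<rho>]
        phi_add[OF Y app_H_in_hom[OF s(1) X x] app_H_in_hom[OF r(1) X x]] by simp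
  qed
  show "?t Y' (act (\<delta> F) v s) = act (hom_ftor C' (omap D X)) v (?t Y s)"
    if v: "\<guillemotleft>v : Y \<rightarrow>\<^bsub>C'\<^esub> Y'\<guillemotright>" and s: "s \<in> carrier (omap (\<delta> F) Y)" for Y Y' v s
  proof -
    have Y: "Y \<in> Obj C'" "Y' \<in> Obj C'" using C'.hom_objs[OF v] by auto
    obtain \<sigma> where s: "\<sigma> \<in> carrier (H F Y)" "s = encode (H F Y) \<sigma>" using delta_elem[OF F Y(1) s] by metis
    show ?thesis
      using val[OF Y(1) s(1)] val[OF Y(2) delta_push[OF v s(1)]] s(2) act_delta[OF F Y(1) v s(1)]
        app_delta_push[OF v s(1) X x] phi_postcomp[OF app_H_in_hom[OF s(1) X x] v]
        C'.act_hom_ftor[OF v phi_in_hom[OF Y(1) app_H_in_hom[OF s(1) X x]]] by simp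
  qed
qed

lemma app_ev: "X \<in> Obj C \<Longrightarrow> x \<in> carrier (omap F X) \<Longrightarrow> app (ev F) X x = encode (dual.H (\<delta> F) X) (ev_at F X x)"
  by (simp add: ev_def)

text \<open>Additivity and naturality in \<open>X\<close> are compared at each \<sigma>, where they
  reduce to those of \<sigma> itself together with \<open>phi_add\<close> and
  \<open>phi_precomp\<close>.\<close>

lemma ev_in_hom: "ev F \<in> carrier (Hom (AbFun C) F (dual.\<delta> (\<delta> F)))"
  unfolding ev_def
proof (rule C.trans_ofI[OF F dual.delta_additive[OF delta_additive[OF F]]])
  note dF = delta_additive[OF F]
  show "(\<lambda>x. encode (dual.H (\<delta> F) X) (ev_at F X x)) \<in> hom (omap F X) (omap (dual.\<delta> (\<delta> F)) X)"
    if X: "X \<in> Obj C" for X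
  proof (rule homI)
    interpret FX: comm_group "omap F X" by (rule C.functor_group[OF F X])
    fix x assume x: "x \<in> carrier (omap F X)"
    note ex = ev_at_in_hom[OF X x]
    show "encode (dual.H (\<delta> F) X) (ev_at F X x) \<in> carrier (omap (dual.\<delta> (\<delta> F)) X)"
      by (rule dual.encode_H[OF dF X ex])
    fix y assume y: "y \<in> carrier (omap F X)"
    note ey = ev_at_in_hom[OF X y]
    have "ev_at F X (x \<otimes>\<^bsub>omap F X\<^esub> y) = ev_at F X x \<boxplus>\<^bsub>AbFun C'\<^esub> ev_at F X y"
    proof (rule delta_eqI[OF F ev_at_in_hom[OF X FX.m_closed[OF x y]] N'.add_in_hom[OF ex ey]])
      fix Y \<sigma> assume Y: "Y \<in> Obj C'" and s: "\<sigma> \<in> carrier (H F Y)"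
      have "app \<sigma> X (x \<otimes>\<^bsub>omap F X\<^esub> y) = app \<sigma> X x \<boxplus>\<^bsub>C\<^esub> app \<sigma> X y"
        using group_hom.hom_mult[OF C.app_hom[OF s X] x y] by simp
      then show "app (ev_at F X (x \<otimes>\<^bsub>omap F X\<^esub> y)) Y (encode (H F Y) \<sigma>) =
          app (ev_at F X x \<boxplus>\<^bsub>AbFun C'\<^esub> ev_at F X y) Y (encode (H F Y) \<sigma>)"
        using C'.app_add[OF ex Y encode_H[OF F Y s]] app_ev_at[OF Y s]
          phi_add[OF Y app_H_in_hom[OF s X x] app_H_in_hom[OF s X y]] by simp
    qed
    then show "encode (dual.H (\<delta> F) X) (ev_at F X (x \<otimes>\<^bsub>omap F X\<^esub> y)) =
        encode (dual.H (\<delta> F) X) (ev_at F X x) \<otimes>\<^bsub>omap (dual.\<delta> (\<delta> F)) X\<^esub> encode (dual.H (\<delta> F) X) (ev_at F X y)"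
      using dual.mult_H[OF dF X ex ey] by simp
  qed
  show "encode (dual.H (\<delta> F) X') (ev_at F X' (act F u x)) =
      act (dual.\<delta> (\<delta> F)) u (encode (dual.H (\<delta> F) X) (ev_at F X x))"
    if u: "\<guillemotleft>u : X \<rightarrow>\<^bsub>C\<^esub> X'\<guillemotright>" and x: "x \<in> carrier (omap F X)" for X X' u x
  proof -
    have X: "X \<in> Obj C" "X' \<in> Obj C" using C.hom_objs[OF u] by auto
    note ex = ev_at_in_hom[OF X(1) x] and ux = C.act_closed[OF F u x]
    have "ev_at F X' (act F u x) = hom_trans C' (Obj C') (amap D u) \<cdot>\<^bsub>AbFun C'\<^esub> ev_at F X x"
    proof (rule delta_eqI[OF F ev_at_in_hom[OF X(2) ux] dual.delta_push[OF u ex]])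
      fix Y \<sigma> assume Y: "Y \<in> Obj C'" and s: "\<sigma> \<in> carrier (H F Y)"
      note g = app_H_in_hom[OF s X(1) x]
      have "app \<sigma> X' (act F u x) = u \<cdot>\<^bsub>C\<^esub> app \<sigma> X x"
        using C.app_natural[OF s u x] C.act_hom_ftor[OF u g] by simp
      then show "app (ev_at F X' (act F u x)) Y (encode (H F Y) \<sigma>) =
          app (hom_trans C' (Obj C') (amap D u) \<cdot>\<^bsub>AbFun C'\<^esub> ev_at F X x) Y (encode (H F Y) \<sigma>)"
        using dual.app_delta_push[OF u ex Y encode_H[OF F Y s]] app_ev_at[OF Y s] phi_precomp[OF Y g u] by simp
    qed
    then show ?thesis using dual.act_delta[OF dF X(1) u ex] by simp
  qed
qed

end

text \<open>Both composites send \<open>x\<close> to the evaluation taking \<sigma> to the adjoint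
  of \<sigma>(\<tau>(x)).\<close>

lemma ev_natural:
  assumes t: "\<tau> \<in> carrier (Hom (AbFun C) F G)"
  shows "amap (delta C' C D) (amap (delta C C' D') \<tau>) \<cdot>\<^bsub>AbFun C\<^esub> ev F = ev G \<cdot>\<^bsub>AbFun C\<^esub> \<tau>"
proof -
  have F: "is_additive_functor C Ab F" and G: "is_additive_functor C Ab G" using C.trans_functors[OF t] by auto
  note dt = amap_delta(1)[OF t]
  note ddt = dual.amap_delta(1)[OF dt]
  show ?thesis
  proof (rule C.trans_eqI[OF N.comp[OF ev_in_hom[OF F] ddt] N.comp[OF t ev_in_hom[OF G]]])
    fix X x assume X: "X \<in> Obj C" and x: "x \<in> carrier (omap F X)"
    note tx = C.app_closed[OF t X x] and ex = ev_at_in_hom[OF F X x]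
    have "ev_at F X x \<cdot>\<^bsub>AbFun C'\<^esub> amap (delta C C' D') \<tau> = ev_at G X (app \<tau> X x)"
    proof (rule delta_eqI[OF G N'.comp[OF dt ex] ev_at_in_hom[OF G X tx]])
      fix Y \<sigma> assume Y: "Y \<in> Obj C'" and s: "\<sigma> \<in> carrier (H G Y)"
      show "app (ev_at F X x \<cdot>\<^bsub>AbFun C'\<^esub> amap (delta C C' D') \<tau>) Y (encode (H G Y) \<sigma>) =
          app (ev_at G X (app \<tau> X x)) Y (encode (H G Y) \<sigma>)"
        using C'.app_comp[OF dt Y encode_H[OF G Y s]] amap_delta(2)[OF t Y s] app_ev_at[OF G Y s]
          app_ev_at[OF F Y N.comp[OF t s]] C.app_comp[OF t X x] by simp
    qed
    then show "app (amap (delta C' C D) (amap (delta C C' D') \<tau>) \<cdot>\<^bsub>AbFun C\<^esub> ev F) X x = app (ev G \<cdot>\<^bsub>AbFun C\<^esub> \<tau>) X x"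
      using C.app_comp[OF ev_in_hom[OF F] X x] C.app_comp[OF t X x] app_ev[OF F X x] app_ev[OF G X tx]
        dual.amap_delta(2)[OF dt X ex] by simp
  qed
qed

text \<open>If \<open>F\<close> is presented by \<open>f : A \<rightarrow> B\<close> and a triangle \<open>DB \<rightarrow> DA \<rightarrow> Z \<rightarrow> W\<close> is completed from \<open>Df\<close>, then
  \<open>(\<delta> F)(Y)\<close> consists of the maps \<open>DA \<rightarrow> Y\<close> killed by \<open>Df\<close>, so that \<open>\<delta> F\<close> is presented by \<open>Z \<rightarrow> W\<close>.\<close>

context
  fixes F f a
  assumes pres: "C.presented F f a"
begin

text \<open>By naturality the value of \<sigma> at the generator inherits the relation that
  \<open>f\<close> kills \<open>a\<close>.\<close>

lemma presented_H_relation: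
  assumes Y: "Y \<in> Obj C'" and s: "\<sigma> \<in> carrier (H F Y)"
  shows "f \<cdot>\<^bsub>C\<^esub> app \<sigma> (Dom C f) a = Zero C (omap D' Y) (Cod C f)"
proof -
  note f = C.presentedD(1)[OF pres] and a = C.presentedD(3)[OF pres]
  have A: "Dom C f \<in> Obj C" and B: "Cod C f \<in> Obj C" using C.hom_objs[OF f] by auto
  have "f \<cdot>\<^bsub>C\<^esub> app \<sigma> (Dom C f) a = app \<sigma> (Cod C f) (act F f a)"
    using C.app_natural[OF s f a] C.act_hom_ftor[OF f app_H_in_hom[OF s A a]] by simp
  then show ?thesis
    using C.presented_relation[OF pres] group_hom.hom_one[OF C.app_hom[OF s B]] by simp
qed

text \<open>Together with the preceding relation and uniqueness, this identifies
  \<open>H F Y\<close> with the arrows from D'Y to the source of \<open>f\<close> that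
  \<open>f\<close> annihilates.\<close>

lemma presented_H_lift:
  assumes Y: "Y \<in> Obj C'" and b: "\<guillemotleft>b : omap D' Y \<rightarrow>\<^bsub>C\<^esub> Dom C f\<guillemotright>"
    and rel: "f \<cdot>\<^bsub>C\<^esub> b = Zero C (omap D' Y) (Cod C f)"
  obtains \<sigma> where "\<sigma> \<in> carrier (H F Y)" "app \<sigma> (Dom C f) a = b"
  using C.presented_lift[OF pres C.hom_ftor_additive[OF dual.D_obj[OF Y]], of b] b rel
    C.act_hom_ftor[OF C.presentedD(1)[OF pres] b] by auto

lemma presented_delta:
  assumes ex: "exact_triple C' (amap D f) g h"
  obtains \<zeta> where "\<zeta> \<in> carrier (H F (Dom C' h))" "phi (Dom C' h) (app \<zeta> (Dom C f) a) = g"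
    "C'.presented (\<delta> F) h (encode (H F (Dom C' h)) \<zeta>)"
proof -
  define A B Z where "A = Dom C f" and "B = Cod C f" and "Z = Dom C' h"
  have f: "\<guillemotleft>f : A \<rightarrow>\<^bsub>C\<^esub> B\<guillemotright>" and F: "is_additive_functor C Ab F" and a: "a \<in> carrier (omap F A)"
    using C.presentedD[OF pres] by (auto simp: A_def B_def)
  have A: "A \<in> Obj C" and B: "B \<in> Obj C" using C.hom_objs[OF f] by auto
  note Df = D_arr[OF f]
  have gh: "g \<in> Arr C'" "h \<in> Arr C'" "Dom C' g = omap D A" "Cod C' g = Z"
    using ex Df by (auto simp: exact_triple_def in_hom_iff Z_def)
  have g: "\<guillemotleft>g : omap D A \<rightarrow>\<^bsub>C'\<^esub> Z\<guillemotright>" using gh by (simp add: in_hom_iff)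
  have Z: "Z \<in> Obj C'" using C'.hom_objs[OF g] by simp
  have ex1: "t \<cdot>\<^bsub>C'\<^esub> amap D f = Zero C' (omap D B) Y \<longleftrightarrow> (\<exists>c. \<guillemotleft>c : Z \<rightarrow>\<^bsub>C'\<^esub> Y\<guillemotright> \<and> t = c \<cdot>\<^bsub>C'\<^esub> g)"
    if "\<guillemotleft>t : omap D A \<rightarrow>\<^bsub>C'\<^esub> Y\<guillemotright>" for t Y
    using ex that gh Df unfolding exact_triple_def by (auto simp: in_hom_iff Z_def)
  have ex2: "c \<cdot>\<^bsub>C'\<^esub> g = Zero C' (omap D A) Y \<longleftrightarrow> (\<exists>d. \<guillemotleft>d : Cod C' h \<rightarrow>\<^bsub>C'\<^esub> Y\<guillemotright> \<and> c = d \<cdot>\<^bsub>C'\<^esub> h)"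
    if "\<guillemotleft>c : Z \<rightarrow>\<^bsub>C'\<^esub> Y\<guillemotright>" for c Y
    using ex that gh unfolding exact_triple_def by (auto simp: Z_def)
  \<comment> \<open>\<open>s\<close> is the arrow adjoint to \<open>g\<close>. As \<open>g\<close>
    kills D f, naturality of \<open>phi\<close> shows that \<open>f\<close> kills \<open>s\<close>,
    and \<open>\<zeta>\<close> below is the resulting generator of \<delta> F.\<close>
  obtain s where s: "\<guillemotleft>s : omap D' Z \<rightarrow>\<^bsub>C\<^esub> A\<guillemotright>" "phi Z s = g" by (rule phi_surj[OF A g])
  have "phi Z (f \<cdot>\<^bsub>C\<^esub> s) = phi Z (Zero C (omap D' Z) B)"
    using phi_precomp[OF Z s(1) f] s(2) ex1[OF g] C'.ident_left[OF g] C'.ident[OF Z] phi_zero[OF Z B] by metis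
  then have fs: "f \<cdot>\<^bsub>C\<^esub> s = Zero C (omap D' Z) B"
    using phi_inj[OF Z C.comp[OF s(1) f] C.zero_in_hom[OF dual.D_obj[OF Z] B]] by simp
  obtain \<zeta> where z: "\<zeta> \<in> carrier (H F Z)" "app \<zeta> A a = s"
    using presented_H_lift[OF Z, folded A_def B_def, OF s(1) fs] by blast
  let ?z = "encode (H F Z) \<zeta>"
  have act_z: "act (\<delta> F) c ?z = encode (H F Y) (hom_trans C (Obj C) (amap D' c) \<cdot>\<^bsub>AbFun C\<^esub> \<zeta>)"
      "phi Y (app (hom_trans C (Obj C) (amap D' c) \<cdot>\<^bsub>AbFun C\<^esub> \<zeta>) A a) = c \<cdot>\<^bsub>C'\<^esub> g"
    if c: "\<guillemotleft>c : Z \<rightarrow>\<^bsub>C'\<^esub> Y\<guillemotright>" for c Y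
    using act_delta[OF F Z c z(1)] app_delta_push[OF c z(1) A a] phi_postcomp[OF s(1) c] z(2) s(2) by simp_all
  have "C'.presented (\<delta> F) h ?z"
    unfolding C'.presented_def Z_def[symmetric]
  proof (intro conjI ballI allI impI)
    show "h \<in> Arr C'" "is_additive_functor C' Ab (\<delta> F)" "?z \<in> carrier (omap (\<delta> F) Z)"
      using gh delta_additive[OF F] encode_H[OF F Z z(1)] by auto
  next
    fix Y y assume Y: "Y \<in> Obj C'" and "y \<in> carrier (omap (\<delta> F) Y)"
    then obtain \<sigma> where y: "\<sigma> \<in> carrier (H F Y)" "y = encode (H F Y) \<sigma>" using delta_elem[OF F Y] by metis
    note g' = app_H_in_hom[OF y(1) A a]
    \<comment> \<open>The adjoint of \<sigma>(a) is killed by D f and so factors as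
      \<open>c \<cdot> g\<close>; hence \<sigma> arises from the generator through
      \<open>c\<close>.\<close>
    have "phi Y (app \<sigma> A a) \<cdot>\<^bsub>C'\<^esub> amap D f = Zero C' (omap D B) Y"
      using phi_precomp[OF Y g' f] presented_H_relation[OF Y y(1)] phi_zero[OF Y B] by (simp add: A_def B_def)
    then obtain c where c: "\<guillemotleft>c : Z \<rightarrow>\<^bsub>C'\<^esub> Y\<guillemotright>" "phi Y (app \<sigma> A a) = c \<cdot>\<^bsub>C'\<^esub> g"
      using ex1[OF phi_in_hom[OF Y g']] by blast
    note cz = delta_push[OF c(1) z(1)]
    have "app \<sigma> A a = app (hom_trans C (Obj C) (amap D' c) \<cdot>\<^bsub>AbFun C\<^esub> \<zeta>) A a"
      using phi_inj[OF Y g' app_H_in_hom[OF cz A a]] act_z(2)[OF c(1)] c(2) by simp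
    then have "\<sigma> = hom_trans C (Obj C) (amap D' c) \<cdot>\<^bsub>AbFun C\<^esub> \<zeta>"
      using C.presented_unique[OF pres y(1) cz] by (simp add: A_def)
    then show "\<exists>u. \<guillemotleft>u : Z \<rightarrow>\<^bsub>C'\<^esub> Y\<guillemotright> \<and> y = act (\<delta> F) u ?z" 
      using c(1) act_z(1)[OF c(1)] y(2) by (intro exI[of _ c]) simp
  next
    fix Y c assume c: "\<guillemotleft>c : Z \<rightarrow>\<^bsub>C'\<^esub> Y\<guillemotright>"
    have Y: "Y \<in> Obj C'" using C'.hom_objs[OF c] by simp
    note cz = delta_push[OF c z(1)]
    let ?cz = "hom_trans C (Obj C) (amap D' c) \<cdot>\<^bsub>AbFun C\<^esub> \<zeta>"
    let ?o = "Zero (AbFun C) F (hom_ftor C (omap D' Y))"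
    have z0: "?o \<in> carrier (H F Y)" using F C.hom_ftor_additive[OF dual.D_obj[OF Y]] by (intro N.zero_in_hom) auto
    have app0: "app ?o A a = Zero C (omap D' Y) A" using C.app_zero[OF A a] by simp
    \<comment> \<open>The image of the generator under \<open>c\<close> vanishes iff its value at
      \<open>a\<close> does, which means that \<open>c\<close> kills \<open>g\<close>, that is,
      factors through \<open>h\<close>.\<close>
    have "act (\<delta> F) c ?z = \<one>\<^bsub>omap (\<delta> F) Y\<^esub> \<longleftrightarrow> ?cz = ?o"
      using act_z(1)[OF c] one_H[OF F Y] inj_H[OF F Y _ cz z0] by auto
    also have "\<dots> \<longleftrightarrow> app ?cz A a = Zero C (omap D' Y) A"
      using C.presented_unique[OF pres cz z0] app0 by (auto simp: A_def)
    also have "\<dots> \<longleftrightarrow> c \<cdot>\<^bsub>C'\<^esub> g = Zero C' (omap D A) Y"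
      using act_z(2)[OF c] phi_zero[OF Y A]
        phi_inj[OF Y app_H_in_hom[OF cz A a] C.zero_in_hom[OF dual.D_obj[OF Y] A]] by auto
    also have "\<dots> \<longleftrightarrow> (\<exists>w. \<guillemotleft>w : Cod C' h \<rightarrow>\<^bsub>C'\<^esub> Y\<guillemotright> \<and> c = w \<cdot>\<^bsub>C'\<^esub> h)"
      by (rule ex2[OF c])
    finally show "act (\<delta> F) c ?z = \<one>\<^bsub>omap (\<delta> F) Y\<^esub> \<longleftrightarrow> (\<exists>w. \<guillemotleft>w : Cod C' h \<rightarrow>\<^bsub>C'\<^esub> Y\<guillemotright> \<and> c = w \<cdot>\<^bsub>C'\<^esub> h)" .
  qed
  then show thesis using that[folded A_def Z_def] z s(2) by blast
qed

end

text \<open>The last map of an exact triple starting with D f is a presentation of the dual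
  functor.\<close>

lemma finitely_presented_delta:
  assumes "finitely_presented C F"
  shows "finitely_presented C' (\<delta> F)"
proof -
  obtain f a where pres: "C.presented F f a" using assms C.finitely_presented_iff by blast
  have "amap D f \<in> Arr C'" using D_arr[OF C.presentedD(1)[OF pres]] by (simp add: in_hom_iff)
  then obtain g h where "exact_triple C' (amap D f) g h" using C'.triangle by blast
  then show ?thesis using presented_delta[OF pres] C'.finitely_presented_iff by metis
qed

end

context dual_pair
begin

interpretation dual: dual_pair C' C D' D \<epsilon> \<eta> by (rule dual)
interpretation N: preadditive "AbFun C" by (rule C.preadditive_AbFun)
interpretation N': preadditive "AbFun C'" by (rule C'.preadditive_AbFun)

text \<open>An element of the double dual at \<open>X\<close> is determined by its value at the
  generator of \<delta> F, an arrow DX -> Z killed by \<open>h\<close>. Injectivity uses that D f is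
  a weak kernel of \<open>g\<close>, surjectivity that \<open>g\<close> is a weak kernel of
  \<open>h\<close>; fullness and faithfulness of \<open>D\<close> translate the arrows found in
  \<open>C'\<close> back to \<open>C\<close>.\<close>

lemma ev_iso:
  assumes "finitely_presented C F"
  shows "is_iso (AbFun C) (ev F) F (dual.\<delta> (\<delta> F))"
proof -
  obtain f a where pres: "C.presented F f a" using assms C.finitely_presented_iff by blast
  define A B where "A = Dom C f" and "B = Cod C f"
  have f: "\<guillemotleft>f : A \<rightarrow>\<^bsub>C\<^esub> B\<guillemotright>" and F: "is_additive_functor C Ab F" and a: "a \<in> carrier (omap F A)"
    and surj: "\<And>X x. X \<in> Obj C \<Longrightarrow> x \<in> carrier (omap F X) \<Longrightarrow> \<exists>u. \<guillemotleft>u : A \<rightarrow>\<^bsub>C\<^esub> X\<guillemotright> \<and> x = act F u a"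
    and ker: "\<And>X u. \<guillemotleft>u : A \<rightarrow>\<^bsub>C\<^esub> X\<guillemotright> \<Longrightarrow>
      act F u a = \<one>\<^bsub>omap F X\<^esub> \<longleftrightarrow> (\<exists>w. \<guillemotleft>w : B \<rightarrow>\<^bsub>C\<^esub> X\<guillemotright> \<and> u = w \<cdot>\<^bsub>C\<^esub> f)"
    using C.presentedD[OF pres] unfolding A_def B_def by auto
  have A: "A \<in> Obj C" and B: "B \<in> Obj C" using C.hom_objs[OF f] by auto
  note Df = D_arr[OF f]
  have "amap D f \<in> Arr C'" using Df by (simp add: in_hom_iff)
  then obtain g h where ex: "exact_triple C' (amap D f) g h" using C'.triangle by blast
  define Z where "Z = Dom C' h"
  obtain \<zeta> where z: "\<zeta> \<in> carrier (H F Z)" "phi Z (app \<zeta> A a) = g"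
    and pres': "C'.presented (\<delta> F) h (encode (H F Z) \<zeta>)"
    by (rule presented_delta[OF pres ex, folded A_def Z_def])
  have gh: "\<guillemotleft>g : omap D A \<rightarrow>\<^bsub>C'\<^esub> Z\<guillemotright>"
    using ex Df unfolding exact_triple_def by (auto simp: in_hom_iff Z_def)
  have Z: "Z \<in> Obj C'" using C'.hom_objs[OF gh] by simp
  have ex3: "g \<cdot>\<^bsub>C'\<^esub> b = Zero C' X Z \<longleftrightarrow> (\<exists>c. \<guillemotleft>c : X \<rightarrow>\<^bsub>C'\<^esub> omap D B\<guillemotright> \<and> b = amap D f \<cdot>\<^bsub>C'\<^esub> c)"
    if "\<guillemotleft>b : X \<rightarrow>\<^bsub>C'\<^esub> omap D A\<guillemotright>" for b X
    using ex that gh Df unfolding exact_triple_def by (auto simp: in_hom_iff Z_def)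
  have ex4: "\<exists>b. \<guillemotleft>b : X \<rightarrow>\<^bsub>C'\<^esub> omap D A\<guillemotright> \<and> r = g \<cdot>\<^bsub>C'\<^esub> b"
    if "\<guillemotleft>r : X \<rightarrow>\<^bsub>C'\<^esub> Z\<guillemotright>" "h \<cdot>\<^bsub>C'\<^esub> r = Zero C' X (Cod C' h)" for r X
    using ex that gh unfolding exact_triple_def by (auto simp: in_hom_iff Z_def)
  let ?z = "encode (H F Z) \<zeta>"
  note dF = delta_additive[OF F]
  \<comment> \<open>Evaluation is computed at the generator only, where an element given by
    \<open>u\<close> yields the composite of \<open>g\<close> with D u.\<close>
  have val: "app (ev_at F X (act F u a)) Z ?z = g \<cdot>\<^bsub>C'\<^esub> amap D u" if u: "\<guillemotleft>u : A \<rightarrow>\<^bsub>C\<^esub> X\<guillemotright>" for X u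
  proof -
    note s = app_H_in_hom[OF z(1) A a]
    have "app \<zeta> X (act F u a) = u \<cdot>\<^bsub>C\<^esub> app \<zeta> A a"
      using C.app_natural[OF z(1) u a] C.act_hom_ftor[OF u s] by simp
    then show ?thesis
      using app_ev_at[OF F Z z(1)] phi_precomp[OF Z s u] z(2) by simp
  qed
  show ?thesis
  proof (rule C.trans_iso_if_bij[OF ev_in_hom[OF F]])
    fix X assume X: "X \<in> Obj C"
    interpret E: group_hom "omap F X" "omap (dual.\<delta> (\<delta> F)) X" "app (ev F) X"
      by (rule C.app_hom[OF ev_in_hom[OF F] X])
    have "x = \<one>\<^bsub>omap F X\<^esub>" if x: "x \<in> carrier (omap F X)" and e: "app (ev F) X x = \<one>\<^bsub>omap (dual.\<delta> (\<delta> F)) X\<^esub>" for x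
    proof -
      obtain u where u: "\<guillemotleft>u : A \<rightarrow>\<^bsub>C\<^esub> X\<guillemotright>" "x = act F u a" using surj[OF X x] by blast
      let ?o = "Zero (AbFun C') (\<delta> F) (hom_ftor C' (omap D X))"
      have z0: "?o \<in> carrier (dual.H (\<delta> F) X)"
        using dF C'.hom_ftor_additive[OF D_obj[OF X]] by (intro N'.zero_in_hom) auto
      have "ev_at F X x = ?o"
        using e app_ev[OF F X x] dual.one_H[OF dF X] dual.inj_H[OF dF X _ ev_at_in_hom[OF F X x] z0] by simp
      \<comment> \<open>Vanishing at the generator makes D u factor through D f, so \<open>u\<close>
        factors through \<open>f\<close> and represents the unit element.\<close>
      then have "g \<cdot>\<^bsub>C'\<^esub> amap D u = Zero C' (omap D X) Z"
        using val[OF u(1)] u(2) C'.app_zero[OF Z encode_H[OF F Z z(1)], of "hom_ftor C' (omap D X)"] by simp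
      then obtain c where c: "\<guillemotleft>c : omap D X \<rightarrow>\<^bsub>C'\<^esub> omap D B\<guillemotright>" "amap D u = amap D f \<cdot>\<^bsub>C'\<^esub> c"
        using ex3[OF D_arr[OF u(1)]] by blast
      obtain w where w: "\<guillemotleft>w : B \<rightarrow>\<^bsub>C\<^esub> X\<guillemotright>" "amap D w = c" by (rule D_full[OF B X c(1)])
      have "u = w \<cdot>\<^bsub>C\<^esub> f"
        using D_faithful[OF u(1) C.comp[OF f w(1)]] D_comp[OF f w(1)] c(2) w(2) by simp
      then show ?thesis using ker[OF u(1)] w(1) u(2) by blast
    qed
    then have inj: "inj_on (app (ev F) X) (carrier (omap F X))"
      using E.inj_on_one_iff by blast
    have "y \<in> app (ev F) X ` carrier (omap F X)" if y: "y \<in> carrier (omap (dual.\<delta> (\<delta> F)) X)" for y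
    proof -
      obtain \<rho> where r: "\<rho> \<in> carrier (dual.H (\<delta> F) X)" "y = encode (dual.H (\<delta> F) X) \<rho>"
        using dual.delta_elem[OF dF X y] by metis
      have "\<guillemotleft>app \<rho> Z ?z : omap D X \<rightarrow>\<^bsub>C'\<^esub> Z\<guillemotright>"
        by (rule dual.app_H_in_hom[OF r(1) Z encode_H[OF F Z z(1)]])
      moreover have "h \<cdot>\<^bsub>C'\<^esub> app \<rho> Z ?z = Zero C' (omap D X) (Cod C' h)"
        using dual.presented_H_relation[OF pres' X r(1)] by (simp add: Z_def)
      ultimately obtain b where b: "\<guillemotleft>b : omap D X \<rightarrow>\<^bsub>C'\<^esub> omap D A\<guillemotright>" "app \<rho> Z ?z = g \<cdot>\<^bsub>C'\<^esub> b"
        using ex4 by blast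
      obtain u where u: "\<guillemotleft>u : A \<rightarrow>\<^bsub>C\<^esub> X\<guillemotright>" "amap D u = b" by (rule D_full[OF A X b(1)])
      have x: "act F u a \<in> carrier (omap F X)" by (rule C.act_closed[OF F u(1) a])
      \<comment> \<open>The two transformations agree on the generator of \<delta> F, hence
        everywhere.\<close>
      have "ev_at F X (act F u a) = \<rho>"
        using C'.presented_unique[OF pres' ev_at_in_hom[OF F X x] r(1)] val[OF u(1)] b(2) u(2) by (simp add: Z_def)
      then show ?thesis using app_ev[OF F X x] r(2) x by (metis imageI)
    qed
    moreover have "app (ev F) X ` carrier (omap F X) \<subseteq> carrier (omap (dual.\<delta> (\<delta> F)) X)"
      by (rule image_subsetI) (rule E.hom_closed)
    ultimately have "app (ev F) X ` carrier (omap F X) = carrier (omap (dual.\<delta> (\<delta> F)) X)"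
      by (metis subsetI subset_antisym)
    then show "bij_betw (app (ev F) X) (carrier (omap F X)) (carrier (omap (dual.\<delta> (\<delta> F)) X))"
      using inj by (simp add: bij_betw_def)
  qed
qed

text \<open>The double dual of a finitely presented functor is finitely presented, so evaluation and
  its inverse lie in the full subcategory.\<close>

lemma ev_nat_iso: "nat_iso (fp_cat C) (fp_cat C) id_ftor (delta C' C D \<circ>\<^sub>F delta C C' D') ev"
proof -
  have fp: "finitely_presented C (dual.\<delta> (\<delta> F))" if "finitely_presented C F" for F
    using dual.finitely_presented_delta finitely_presented_delta that by blast
  have om: "omap (delta C' C D) (omap (delta C C' D') F) = dual.\<delta> (\<delta> F)" for F by (simp add: delta_def)
  have iso: "is_iso (fp_cat C) (ev F) F (dual.\<delta> (\<delta> F))" if "finitely_presented C F" for F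
    using ev_iso[OF that] fp[OF that] that unfolding is_iso_def by (auto simp: fp_cat_def in_hom_full_sub)
  show ?thesis
    unfolding nat_iso_def nat_trans_def
  proof (intro conjI ballI allI impI)
    fix F assume "F \<in> Obj (fp_cat C)"
    then have "finitely_presented C F" by (simp add: fp_cat_def)
    then show "is_iso (fp_cat C) (ev F) (omap id_ftor F) (omap (delta C' C D \<circ>\<^sub>F delta C C' D') F)"
      "\<guillemotleft>ev F : omap id_ftor F \<rightarrow>\<^bsub>fp_cat C\<^esub> omap (delta C' C D \<circ>\<^sub>F delta C C' D') F\<guillemotright>"
      using iso[of F] by (auto simp: om is_iso_def)
  next
    fix F G \<tau> assume "\<tau> \<in> carrier (Hom (fp_cat C) F G)"
    then show "amap (delta C' C D \<circ>\<^sub>F delta C C' D') \<tau> \<cdot>\<^bsub>fp_cat C\<^esub> ev F = ev G \<cdot>\<^bsub>fp_cat C\<^esub> amap id_ftor \<tau>"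
      using ev_natural by (auto simp: fp_cat_def in_hom_full_sub)
  qed
qed

lemma delta_fp_additive: "is_additive_functor (op (fp_cat C)) (fp_cat C') (delta C C' D')"
proof -
  have om: "omap (delta C C' D') F = \<delta> F" for F by (simp add: delta_def)
  show ?thesis
    using delta_additive_functor finitely_presented_delta
    unfolding is_additive_functor_def is_functor_def
    by (simp add: fp_cat_def in_hom_full_sub om) blast
qed

text \<open>Representables are finitely presented, so the inverse of evaluation applies. With three
  contravariant functors in a row, the composite is a functor on the opposite category.\<close>

lemma delta_hom_double_dual:
  "\<exists>\<beta>. nat_iso (op C) (AbFun C) (delta C' C D \<circ>\<^sub>F delta C C' D' \<circ>\<^sub>F hom_embed C) (hom_embed C) \<beta>"
proof -
  have fp: "finitely_presented C (hom_ftor C X)" if X: "X \<in> Obj C" for X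
  proof -
    obtain Z where Z: "is_zero C Z" using C.zero_object by blast
    then have ZO: "Z \<in> Obj C" by (simp add: is_zero_def)
    have z: "\<guillemotleft>Zero C X Z : X \<rightarrow>\<^bsub>C\<^esub> Z\<guillemotright>" using C.zero_in_hom X ZO .
    \<comment> \<open>Hom(X,-) is the cokernel of Hom(Z,-) -> Hom(X,-) for the map from
      \<open>X\<close> to a zero object Z; its generator is the identity.\<close>
    have "C.presented (hom_ftor C X) (Zero C X Z) (Ident C X)"
      unfolding C.presented_def
    proof (intro conjI ballI allI impI)
      show "Zero C X Z \<in> Arr C" "is_additive_functor C Ab (hom_ftor C X)"
        "Ident C X \<in> carrier (omap (hom_ftor C X) (Dom C (Zero C X Z)))"
        using z C.hom_ftor_additive[OF X] C.ident[OF X] by (auto simp: in_hom_iff)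
    next
      fix Y u assume "u \<in> carrier (omap (hom_ftor C X) Y)"
      then have u: "\<guillemotleft>u : X \<rightarrow>\<^bsub>C\<^esub> Y\<guillemotright>" by simp
      then show "\<exists>v. \<guillemotleft>v : Dom C (Zero C X Z) \<rightarrow>\<^bsub>C\<^esub> Y\<guillemotright> \<and> u = act (hom_ftor C X) v (Ident C X)"
        using C.act_hom_ftor[OF u C.ident[OF X]] C.ident_right[OF u] z by (auto simp: in_hom_iff)
    next
      fix Y u assume "\<guillemotleft>u : Dom C (Zero C X Z) \<rightarrow>\<^bsub>C\<^esub> Y\<guillemotright>"
      then have u: "\<guillemotleft>u : X \<rightarrow>\<^bsub>C\<^esub> Y\<guillemotright>" using z by (simp add: in_hom_iff)
      have Y: "Y \<in> Obj C" using C.hom_objs[OF u] by simp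
      have "act (hom_ftor C X) u (Ident C X) = u"
        using C.act_hom_ftor[OF u C.ident[OF X]] C.ident_right[OF u] by simp
      moreover have "w \<cdot>\<^bsub>C\<^esub> Zero C X Z = Zero C X Y" if "\<guillemotleft>w : Z \<rightarrow>\<^bsub>C\<^esub> Y\<guillemotright>" for w
        by (rule C.comp_zero[OF that X])
      moreover have "\<guillemotleft>Zero C Z Y : Z \<rightarrow>\<^bsub>C\<^esub> Y\<guillemotright>" by (rule C.zero_in_hom[OF ZO Y])
      moreover have "Cod C (Zero C X Z) = Z" using z by (simp add: in_hom_iff)
      ultimately show "act (hom_ftor C X) u (Ident C X) = \<one>\<^bsub>omap (hom_ftor C X) Y\<^esub> \<longleftrightarrow>
          (\<exists>w. \<guillemotleft>w : Cod C (Zero C X Z) \<rightarrow>\<^bsub>C\<^esub> Y\<guillemotright> \<and> u = w \<cdot>\<^bsub>C\<^esub> Zero C X Z)"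
        by auto
    qed
    then show ?thesis by (rule C.presented_finitely_presented)
  qed
  have om: "omap (delta C' C D) (omap (delta C C' D') F) = dual.\<delta> (\<delta> F)" for F by (simp add: delta_def)
  have h: "is_functor (op C) (AbFun C) (hom_embed C)" by (rule C.hom_embed_functor)
  have d: "is_functor (op (AbFun C)) (AbFun C') (delta C C' D')" "is_functor (op (AbFun C')) (AbFun C) (delta C' C D)"
    using delta_additive_functor dual.delta_additive_functor by (auto simp: is_additive_functor_def)
  have dh: "is_functor (op C) (AbFun C) (delta C' C D \<circ>\<^sub>F delta C C' D' \<circ>\<^sub>F hom_embed C)"
    by (rule is_functor_comp[OF is_functor_comp[OF h is_functor_op[OF d(1), unfolded op_op]] d(2)])
  have "nat_iso (op C) (AbFun C) (hom_embed C) (delta C' C D \<circ>\<^sub>F delta C C' D' \<circ>\<^sub>F hom_embed C) (\<lambda>X. ev (hom_ftor C X))"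
    unfolding nat_iso_def nat_trans_def
  proof (intro conjI ballI allI impI)
    fix X assume "X \<in> Obj (op C)"
    then have X: "X \<in> Obj C" by simp
    show "is_iso (AbFun C) (ev (hom_ftor C X)) (omap (hom_embed C) X)
        (omap (delta C' C D \<circ>\<^sub>F delta C C' D' \<circ>\<^sub>F hom_embed C) X)"
      "ev (hom_ftor C X) \<in> carrier (Hom (AbFun C) (omap (hom_embed C) X)
        (omap (delta C' C D \<circ>\<^sub>F delta C C' D' \<circ>\<^sub>F hom_embed C) X))"
      using ev_iso[OF fp[OF X]] by (auto simp: om is_iso_def hom_embed_def)
  next
    fix X Y f assume "\<guillemotleft>f : X \<rightarrow>\<^bsub>op C\<^esub> Y\<guillemotright>"
    then show "amap (delta C' C D \<circ>\<^sub>F delta C C' D' \<circ>\<^sub>F hom_embed C) f \<cdot>\<^bsub>AbFun C\<^esub> ev (hom_ftor C X) =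
        ev (hom_ftor C Y) \<cdot>\<^bsub>AbFun C\<^esub> amap (hom_embed C) f"
      using ev_natural[OF C.hom_trans_in_hom, of f Y X] by (simp add: hom_embed_def)
  qed
  then show ?thesis
    using nat_iso_inverse[OF C.preadditive_op N.preadditive_axioms h dh] by blast
qed

end

context dual_pair
begin

interpretation dual: dual_pair C' C D' D \<epsilon> \<eta> by (rule dual)

text \<open>The quasi-inverse is \<delta> in the other direction. Both required isomorphisms are
  inverses of evaluation, one for each member of the pair; over the opposite category the unit is
  read backwards.\<close>

lemma delta_equivalence: "is_equivalence (op (fp_cat C)) (fp_cat C') (delta C C' D')"
proof -
  have pre: "preadditive (fp_cat C)" "preadditive (fp_cat C')"
    unfolding fp_cat_def
    by (rule preadditive.preadditive_full_sub[OF C.preadditive_AbFun] preadditive.preadditive_full_sub[OF C'.preadditive_AbFun])+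
  have d: "is_functor (op (fp_cat C)) (fp_cat C') (delta C C' D')" "is_functor (op (fp_cat C')) (fp_cat C) (delta C' C D)"
    using delta_fp_additive dual.delta_fp_additive by (auto simp: is_additive_functor_def)
  have d': "is_functor (fp_cat C) (op (fp_cat C')) (delta C C' D')" "is_functor (fp_cat C') (op (fp_cat C)) (delta C' C D)"
    using is_functor_op[OF d(1)] is_functor_op[OF d(2)] by simp_all
  have "nat_iso (fp_cat C) (fp_cat C) (delta C' C D \<circ>\<^sub>F delta C C' D') id_ftor (\<lambda>F. inv_arr (fp_cat C) (ev F))"
    by (rule nat_iso_inverse[OF pre(1,1) is_functor_id is_functor_comp[OF d'(1) d(2)] ev_nat_iso])
  moreover have "nat_iso (fp_cat C') (fp_cat C') (delta C C' D' \<circ>\<^sub>F delta C' C D) id_ftor (\<lambda>F. inv_arr (fp_cat C') (dual.ev F))"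
    by (rule nat_iso_inverse[OF pre(2,2) is_functor_id is_functor_comp[OF d'(2) d(1)] dual.ev_nat_iso])
  ultimately show ?thesis
    unfolding is_equivalence_def using d(1) d'(2)
    by (intro conjI exI[of _ "delta C' C D"] exI) (simp_all add: nat_iso_op)
qed

lemma delta_exact: "is_exact_functor (op (fp_cat C)) (fp_cat C') (delta C C' D')"
proof -
  have "preadditive (fp_cat C)" "preadditive (fp_cat C')"
    unfolding fp_cat_def
    by (rule preadditive.preadditive_full_sub[OF C.preadditive_AbFun] preadditive.preadditive_full_sub[OF C'.preadditive_AbFun])+
  then show ?thesis
    using exact_equivalence[OF preadditive.preadditive_op _ delta_equivalence delta_fp_additive] by blast
qed

end

section \<open>Triangles are exact\<close>

lemma zero_into: "is_zero C Z \<Longrightarrow> preadditive C \<Longrightarrow> \<guillemotleft>f : X \<rightarrow>\<^bsub>C\<^esub> Z\<guillemotright> \<Longrightarrow> f = Zero C X Z"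
  and zero_from: "is_zero C Z \<Longrightarrow> preadditive C \<Longrightarrow> \<guillemotleft>f : Z \<rightarrow>\<^bsub>C\<^esub> X\<guillemotright> \<Longrightarrow> f = Zero C Z X"
  unfolding is_zero_def using preadditive.zero_in_hom preadditive.hom_objs by metis+

context preadditive
begin

text \<open>Any arrow into or out of \<open>Z\<close> equals its composite with the identity, hence
  is zero.\<close>

lemma is_zeroI:
  assumes Z: "Z \<in> Obj C" and e: "Ident C Z = Zero C Z Z"
  shows "is_zero C Z"
proof -
  have "f = Zero C X Z" if f: "\<guillemotleft>f : X \<rightarrow> Z\<guillemotright>" for f X
    using ident_left[OF f] e zero_comp[OF f Z] by simp
  moreover have "f = Zero C Z X" if f: "\<guillemotleft>f : Z \<rightarrow> X\<guillemotright>" for f X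
    using ident_right[OF f] e comp_zero[OF f Z] by simp
  ultimately show ?thesis
    unfolding is_zero_def using Z zero_in_hom by metis
qed

lemma neg_eq: "\<guillemotleft>f : X \<rightarrow> Y\<guillemotright> \<Longrightarrow> neg C f = inv\<^bsub>Hom C X Y\<^esub> f"
  by (simp add: neg_def in_hom_iff)

lemma neg_in_hom:
  assumes "\<guillemotleft>f : X \<rightarrow> Y\<guillemotright>" shows "\<guillemotleft>neg C f : X \<rightarrow> Y\<guillemotright>"
proof -
  interpret comm_group "Hom C X Y" by (rule comm_group_Hom[OF assms])
  show ?thesis using inv_closed[OF assms] neg_eq[OF assms] by simp
qed

lemma neg_neg:
  assumes "\<guillemotleft>f : X \<rightarrow> Y\<guillemotright>" shows "neg C (neg C f) = f"
proof -
  interpret comm_group "Hom C X Y" by (rule comm_group_Hom[OF assms])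
  show ?thesis using inv_inv[OF assms] neg_eq[OF neg_in_hom[OF assms]] neg_eq[OF assms] by simp
qed

lemma neg_zero:
  assumes "X \<in> Obj C" "Y \<in> Obj C" shows "neg C (Zero C X Y) = Zero C X Y"
proof -
  interpret comm_group "Hom C X Y" by (rule hom_group[OF assms])
  show ?thesis using inv_one neg_eq[OF zero_in_hom[OF assms]] by simp
qed

lemma comp_neg: "\<guillemotleft>f : X \<rightarrow> Y\<guillemotright> \<Longrightarrow> \<guillemotleft>g : Y \<rightarrow> Z\<guillemotright> \<Longrightarrow> g \<cdot> neg C f = neg C (g \<cdot> f)"
  and neg_comp: "\<guillemotleft>f : X \<rightarrow> Y\<guillemotright> \<Longrightarrow> \<guillemotleft>g : Y \<rightarrow> Z\<guillemotright> \<Longrightarrow> neg C g \<cdot> f = neg C (g \<cdot> f)"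
  using group_hom.hom_inv[OF comp_left_hom] group_hom.hom_inv[OF comp_right_hom]
  by (simp_all add: neg_eq[OF comp] neg_eq hom_objs)

lemma add_neg:
  assumes "\<guillemotleft>f : X \<rightarrow> Y\<guillemotright>" shows "f \<boxplus> neg C f = Zero C X Y"
proof -
  interpret comm_group "Hom C X Y" by (rule comm_group_Hom[OF assms])
  show ?thesis using r_inv[OF assms] neg_eq[OF assms] by simp
qed

lemma eq_if_diff_zero:
  assumes f: "\<guillemotleft>f : X \<rightarrow> Y\<guillemotright>" and g: "\<guillemotleft>g : X \<rightarrow> Y\<guillemotright>" and e: "f \<boxplus> neg C g = Zero C X Y"
  shows "f = g"
proof -
  interpret comm_group "Hom C X Y" by (rule comm_group_Hom[OF f])
  have "f \<otimes>\<^bsub>Hom C X Y\<^esub> inv\<^bsub>Hom C X Y\<^esub> g = \<one>\<^bsub>Hom C X Y\<^esub>" using e neg_eq[OF g] by simp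
  then show ?thesis using f g by (metis inv_equality inv_inv inv_closed)
qed

end

section \<open>Weak kernels and weak cokernels in a triangle\<close>

context triangulated
begin

lemma shift_functor: "is_functor T T \<Sigma>"
  using shift_additive by (simp add: is_additive_functor_def)

lemma shift_zero: "X \<in> Obj T \<Longrightarrow> Y \<in> Obj T \<Longrightarrow> amap \<Sigma> (Zero T X Y) = Zero T (omap \<Sigma> X) (omap \<Sigma> Y)"
  by (rule additive_functor_zero[OF preadditive_axioms preadditive_axioms shift_additive])

lemma shift_is_zero:
  assumes Z: "is_zero T Z" shows "is_zero T (omap \<Sigma> Z)"
proof (rule is_zeroI)
  have ZO: "Z \<in> Obj T" using Z by (simp add: is_zero_def)
  show "omap \<Sigma> Z \<in> Obj T" by (rule functor_obj[OF shift_functor ZO])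
  show "Ident T (omap \<Sigma> Z) = Zero T (omap \<Sigma> Z) (omap \<Sigma> Z)"
    using functor_ident[OF shift_functor ZO] shift_zero[OF ZO ZO]
      zero_into[OF Z preadditive_axioms ident[OF ZO]] by simp
qed

text \<open>The identity triangle of \<open>X\<close>, completed by the zero object \<Sigma>Z and
  rotated backwards.\<close>

lemma tri_zero_ident:
  assumes X: "X \<in> Obj T" and Z: "is_zero T Z"
  shows "(Zero T Z X, Ident T X, Zero T X (omap \<Sigma> Z)) \<in> Tri T"
proof -
  have ZO: "Z \<in> Obj T" using Z by (simp add: is_zero_def)
  have S: "omap \<Sigma> Z \<in> Obj T" "omap \<Sigma> X \<in> Obj T" using functor_obj[OF shift_functor] ZO X by auto
  have "(Ident T X, Zero T X (omap \<Sigma> Z), neg T (amap \<Sigma> (Zero T Z X))) \<in> Tri T"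
    using tri_ident[OF X shift_is_zero[OF Z]] shift_zero[OF ZO X] neg_zero[OF S] by simp
  then show ?thesis
    using tri_rotate[OF zero_in_hom[OF ZO X] ident[OF X] zero_in_hom[OF X S(1)]] by simp
qed

context
  fixes f g h X Y Z
  assumes tri: "(f, g, h) \<in> Tri T"
    and f: "\<guillemotleft>f : X \<rightarrow> Y\<guillemotright>" and g: "\<guillemotleft>g : Y \<rightarrow> Z\<guillemotright>" and h: "\<guillemotleft>h : Z \<rightarrow> omap \<Sigma> X\<guillemotright>"
begin

lemma tri_rotated: "(g, h, neg T (amap \<Sigma> f)) \<in> Tri T"
  using tri_rotate[OF f g h] tri by simp

text \<open>Map the identity triangle of \<open>X\<close> to the given one by the identity and
  \<open>f\<close>. The third component starts at a zero object, and \<open>g \<cdot> f\<close>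
  factors through it.\<close>

lemma tri_comp_zero: "g \<cdot> f = Zero T X Z"
proof -
  obtain O' where O': "is_zero T O'" using zero_object by blast
  then have OO: "O' \<in> Obj T" by (simp add: is_zero_def)
  have X: "X \<in> Obj T" and S: "omap \<Sigma> X \<in> Obj T" using hom_objs[OF f] hom_objs[OF h] by auto
  note z = zero_in_hom[OF X OO] and z' = zero_in_hom[OF OO S]
  have "\<exists>c. \<guillemotleft>c : Dom T (Zero T O' (omap \<Sigma> X)) \<rightarrow> Dom T h\<guillemotright> \<and> c \<cdot> Zero T X O' = g \<cdot> f \<and>
      amap \<Sigma> (Ident T X) \<cdot> Zero T O' (omap \<Sigma> X) = h \<cdot> c"
    using tri_morphism[OF tri_ident[OF X O'] tri, of "Ident T X" f] ident[OF X] f g z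
    by (simp add: in_hom_iff)
  then obtain c where c: "\<guillemotleft>c : O' \<rightarrow> Z\<guillemotright>" "c \<cdot> Zero T X O' = g \<cdot> f"
    using z' h by (auto simp: in_hom_iff)
  then show ?thesis using comp_zero[OF c(1) X] by simp
qed

text \<open>Map the given triangle to the one starting with 0 -> W -> W, by zero and
  \<open>t\<close>; the third component is the factorisation.\<close>

lemma tri_weak_cokernel:
  assumes t: "\<guillemotleft>t : Y \<rightarrow> W\<guillemotright>" and tf: "t \<cdot> f = Zero T X W"
  shows "\<exists>c. \<guillemotleft>c : Z \<rightarrow> W\<guillemotright> \<and> t = c \<cdot> g"
proof -
  obtain O' where O': "is_zero T O'" using zero_object by blast
  then have OO: "O' \<in> Obj T" by (simp add: is_zero_def)
  have X: "X \<in> Obj T" and W: "W \<in> Obj T" using hom_objs[OF f] hom_objs[OF t] by auto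
  have S: "omap \<Sigma> O' \<in> Obj T" by (rule functor_obj[OF shift_functor OO])
  note a = zero_in_hom[OF X OO] and b = zero_in_hom[OF OO W] and d = zero_in_hom[OF W S]
  have "t \<cdot> f = Zero T O' W \<cdot> Zero T X O'" using tf comp_zero[OF b X] by simp
  then have "\<exists>c. \<guillemotleft>c : Dom T h \<rightarrow> Dom T (Zero T W (omap \<Sigma> O'))\<guillemotright> \<and> c \<cdot> g = Ident T W \<cdot> t \<and>
      amap \<Sigma> (Zero T X O') \<cdot> h = Zero T W (omap \<Sigma> O') \<cdot> c"
    using a b f g h t ident[OF W]
    by (intro tri_morphism[OF tri tri_zero_ident[OF W O']]) (simp_all add: in_hom_iff)
  then show ?thesis using d h ident_left[OF t] by (auto simp: in_hom_iff)
qed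

text \<open>Map the rotated identity triangle of \<open>W\<close> to the rotated given triangle by
  \<open>a\<close> and zero. The third component is an arrow \<Sigma>W -> \<Sigma>X, which the
  equivalence \<Sigma> desuspends.\<close>

lemma tri_weak_kernel:
  assumes a: "\<guillemotleft>a : W \<rightarrow> Y\<guillemotright>" and ga: "g \<cdot> a = Zero T W Z"
  shows "\<exists>b. \<guillemotleft>b : W \<rightarrow> X\<guillemotright> \<and> a = f \<cdot> b"
proof -
  obtain O' where O': "is_zero T O'" using zero_object by blast
  then have OO: "O' \<in> Obj T" by (simp add: is_zero_def)
  have X: "X \<in> Obj T" and Z: "Z \<in> Obj T" and W: "W \<in> Obj T" using hom_objs[OF f] hom_objs[OF g] hom_objs[OF a] by auto
  have S: "omap \<Sigma> W \<in> Obj T" by (rule functor_obj[OF shift_functor W])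
  let ?i = "neg T (amap \<Sigma> (Ident T W))"
  have Sf: "\<guillemotleft>amap \<Sigma> f : omap \<Sigma> X \<rightarrow> omap \<Sigma> Y\<guillemotright>" and Sa: "\<guillemotleft>amap \<Sigma> a : omap \<Sigma> W \<rightarrow> omap \<Sigma> Y\<guillemotright>"
    using functor_arr[OF shift_functor] f a by auto
  have i: "amap \<Sigma> (Ident T W) = Ident T (omap \<Sigma> W)" by (rule functor_ident[OF shift_functor W])
  have src: "(Zero T W O', Zero T O' (omap \<Sigma> W), ?i) \<in> Tri T"
    using tri_rotate[OF ident[OF W] zero_in_hom[OF W OO] zero_in_hom[OF OO S]] tri_ident[OF W O'] by simp
  have ni: "\<guillemotleft>?i : omap \<Sigma> W \<rightarrow> omap \<Sigma> W\<guillemotright>" using neg_in_hom[OF ident[OF S]] i by simp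
  note wo = zero_in_hom[OF W OO] and oz = zero_in_hom[OF OO Z] and os = zero_in_hom[OF OO S]
  have "Zero T O' Z \<cdot> Zero T W O' = g \<cdot> a" using ga comp_zero[OF oz W] by simp
  then have "\<exists>c. \<guillemotleft>c : Dom T ?i \<rightarrow> Dom T (neg T (amap \<Sigma> f))\<guillemotright> \<and>
      c \<cdot> Zero T O' (omap \<Sigma> W) = h \<cdot> Zero T O' Z \<and> amap \<Sigma> a \<cdot> ?i = neg T (amap \<Sigma> f) \<cdot> c"
    using a g h wo oz os by (intro tri_morphism[OF src tri_rotated]) (simp_all add: in_hom_iff)
  then obtain c where c: "\<guillemotleft>c : omap \<Sigma> W \<rightarrow> omap \<Sigma> X\<guillemotright>" "amap \<Sigma> a \<cdot> ?i = neg T (amap \<Sigma> f) \<cdot> c"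
    using ni neg_in_hom[OF Sf] by (auto simp: in_hom_iff)
  \<comment> \<open>Each of the two rotations introduces a sign, and the signs cancel.\<close>
  have "neg T (amap \<Sigma> a) = neg T (amap \<Sigma> f \<cdot> c)"
    using c(2) comp_neg[OF ident[OF S] Sa] neg_comp[OF c(1) Sf] ident_right[OF Sa] i by simp
  then have e: "amap \<Sigma> a = amap \<Sigma> f \<cdot> c"
    using neg_neg[OF Sa] neg_neg[OF comp[OF c(1) Sf]] by metis
  obtain b where b: "\<guillemotleft>b : W \<rightarrow> X\<guillemotright>" "amap \<Sigma> b = c"
    by (rule equivalence_full[OF preadditive_axioms preadditive_axioms shift_equivalence W X c(1)])
  have "a = f \<cdot> b"
    by (rule equivalence_faithful[OF preadditive_axioms shift_equivalence a comp[OF b(1) f]])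
      (use e b functor_comp[OF shift_functor b(1) f] in simp)
  then show ?thesis using b(1) by blast
qed

end

text \<open>The four exactness conditions are the weak kernel and weak cokernel properties of the
  triangle and of its rotation; the reverse implications hold as consecutive maps compose to
  zero.\<close>

lemma tri_exact_triple:
  assumes tri: "(f, g, h) \<in> Tri T"
    and f: "\<guillemotleft>f : X \<rightarrow> Y\<guillemotright>" and g: "\<guillemotleft>g : Y \<rightarrow> Z\<guillemotright>" and h: "\<guillemotleft>h : Z \<rightarrow> omap \<Sigma> X\<guillemotright>"
  shows "exact_triple T f g h"
proof -
  have Sf: "\<guillemotleft>neg T (amap \<Sigma> f) : omap \<Sigma> X \<rightarrow> omap \<Sigma> Y\<guillemotright>"
    by (rule neg_in_hom[OF functor_arr[OF shift_functor f]])
  note rot = tri_rotated[OF tri f g h]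
  note gf = tri_comp_zero[OF tri f g h] and hg = tri_comp_zero[OF rot g h Sf]
  have objs: "X \<in> Obj T" "Y \<in> Obj T" using hom_objs[OF f] by auto
  have cgf: "(c \<cdot> g) \<cdot> f = Zero T X W" if c: "\<guillemotleft>c : Z \<rightarrow> W\<guillemotright>" for c W
    using assoc[OF f g c] gf comp_zero[OF c objs(1)] by simp
  have dhg: "(d \<cdot> h) \<cdot> g = Zero T Y W" if d: "\<guillemotleft>d : omap \<Sigma> X \<rightarrow> W\<guillemotright>" for d W
    using assoc[OF g h d] hg comp_zero[OF d objs(2)] by simp
  have gfb: "g \<cdot> (f \<cdot> b) = Zero T W Z" if b: "\<guillemotleft>b : W \<rightarrow> X\<guillemotright>" for b W
    using assoc[OF b f g] gf zero_comp[OF b] hom_objs[OF g] by simp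
  have hgb: "h \<cdot> (g \<cdot> b) = Zero T W (omap \<Sigma> X)" if b: "\<guillemotleft>b : W \<rightarrow> Y\<guillemotright>" for b W
    using assoc[OF b g h] hg zero_comp[OF b] hom_objs[OF h] by simp
  have frame: "Dom T f = X" "Cod T f = Y" "Dom T g = Y" "Cod T g = Z" "Dom T h = Z" "Cod T h = omap \<Sigma> X"
    "f \<in> Arr T" "g \<in> Arr T" "h \<in> Arr T"
    using f g h by (auto simp: in_hom_iff)
  show ?thesis
    unfolding exact_triple_def frame
    using frame cgf dhg gfb hgb tri_weak_cokernel[OF tri f g h] tri_weak_cokernel[OF rot g h Sf]
      tri_weak_kernel[OF tri f g h] tri_weak_kernel[OF rot g h Sf] by auto
qed

end


section \<open>Compact objects\<close>

text \<open>The sum is first cut down to the finite support of \<open>f\<close>, where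
  \<open>h\<close> commutes with it. The support of the image family may be smaller, which only
  removes trivial terms.\<close>

lemma hom_gfinprod:
  assumes G: "comm_group G" and H: "comm_group H" and h: "h \<in> hom G H"
    and f: "f \<in> I \<rightarrow> carrier G" and fin: "finite {i \<in> I. f i \<noteq> \<one>\<^bsub>G\<^esub>}"
  shows "h (gfinprod G f I) = gfinprod H (\<lambda>i. h (f i)) I"
proof -
  interpret G: comm_group G by fact
  interpret H: comm_group H by fact
  interpret group_hom G H h by unfold_locales (rule h)
  have fp: "h (finprod G f S) = finprod H (\<lambda>i. h (f i)) S" if "finite S" "S \<subseteq> I" for S
    using that
  proof (induction S rule: finite_induct)
    case (insert i S)
    have "f \<in> S \<rightarrow> carrier G" "f i \<in> carrier G" using insert f by auto
    moreover from this have "(\<lambda>i. h (f i)) \<in> S \<rightarrow> carrier H" by (auto simp: Pi_iff)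
    ultimately show ?case using insert by simp
  qed simp
  let ?S = "{i \<in> I. f i \<noteq> \<one>\<^bsub>G\<^esub>}"
  have hf: "(\<lambda>i. h (f i)) \<in> I \<rightarrow> carrier H" using f by (auto simp: Pi_iff)
  have "h (gfinprod G f I) = finprod H (\<lambda>i. h (f i)) ?S"
    using fp[OF fin] fin by (simp add: gfinprod_def)
  also have "\<dots> = gfinprod H (\<lambda>i. h (f i)) ?S"
    using fin hf by (intro H.gfinprod_eq_finprod[symmetric]) auto
  also have "\<dots> = gfinprod H (\<lambda>i. h (f i)) I"
    using hf by (intro H.gfinprod_mono_neutral_cong_left) auto
  finally show ?thesis .
qed

lemma (in comm_group) gfinprod_single:
  assumes "j \<in> I" "f j \<in> carrier G" "\<And>i. i \<in> I \<Longrightarrow> i \<noteq> j \<Longrightarrow> f i = \<one>"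
  shows "gfinprod G f I = f j"
proof -
  have "f \<in> I \<rightarrow> carrier G" using assms by (metis Pi_I one_closed)
  then have "gfinprod G f I = gfinprod G f {j}"
    using assms by (intro gfinprod_mono_neutral_cong_right) auto
  also have "\<dots> = f j" using assms(2) by (subst gfinprod_eq_finprod) auto
  finally show ?thesis .
qed

text \<open>A map into a coproduct factors through a finite subcoproduct.  This formulation involves no sums.\<close>

definition finitely_supported ::
    "('o, 'a, 'm) cat_scheme \<Rightarrow> 'i set \<Rightarrow> ('i \<Rightarrow> 'o) \<Rightarrow> 'o \<Rightarrow> ('i \<Rightarrow> 'a) \<Rightarrow> 'a \<Rightarrow> bool" where
  "finitely_supported C I X P \<iota> f \<longleftrightarrow> (\<exists>F\<subseteq>I. finite F \<and>
     (\<forall>Y h. \<guillemotleft>h : P \<rightarrow>\<^bsub>C\<^esub> Y\<guillemotright> \<and> (\<forall>i\<in>F. h \<cdot>\<^bsub>C\<^esub> \<iota> i = Zero C (X i) Y) \<longrightarrow> h \<cdot>\<^bsub>C\<^esub> f = Zero C (Dom C f) Y))"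

section \<open>Coproducts and arrows of finite support\<close>

context preadditive
begin

context
  fixes I :: "'i set" and X P \<iota>
  assumes cop: "is_coproduct C I X P \<iota>"
begin

lemma coproduct_inj: "i \<in> I \<Longrightarrow> \<guillemotleft>\<iota> i : X i \<rightarrow> P\<guillemotright>"
  using cop by (simp add: is_coproduct_def)

lemma coproduct_lift:
  assumes "Y \<in> Obj C" "\<And>i. i \<in> I \<Longrightarrow> \<guillemotleft>f i : X i \<rightarrow> Y\<guillemotright>"
  obtains h where "\<guillemotleft>h : P \<rightarrow> Y\<guillemotright>" "\<And>i. i \<in> I \<Longrightarrow> h \<cdot> \<iota> i = f i"
  using cop assms unfolding is_coproduct_def by blast

lemma coproduct_eqI:
  assumes g: "\<guillemotleft>g : P \<rightarrow> Y\<guillemotright>" and h: "\<guillemotleft>h : P \<rightarrow> Y\<guillemotright>" and e: "\<And>i. i \<in> I \<Longrightarrow> g \<cdot> \<iota> i = h \<cdot> \<iota> i"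
  shows "g = h"
proof -
  have "\<exists>!k. \<guillemotleft>k : P \<rightarrow> Y\<guillemotright> \<and> (\<forall>i\<in>I. k \<cdot> \<iota> i = g \<cdot> \<iota> i)"
    using cop hom_objs[OF g] comp[OF coproduct_inj g] unfolding is_coproduct_def by simp
  then obtain k where "\<And>l. \<guillemotleft>l : P \<rightarrow> Y\<guillemotright> \<Longrightarrow> (\<forall>i\<in>I. l \<cdot> \<iota> i = g \<cdot> \<iota> i) \<Longrightarrow> l = k"
    by (elim ex1E) blast
  from this[OF g] this[OF h] show ?thesis using e by simp
qed

text \<open>The endomorphism is the projection of the coproduct onto the summands in
  \<open>F\<close>. It comes from the universal property, being the injection on \<open>F\<close>
  and zero elsewhere, so that no addition of arrows occurs.\<close>

lemma coproduct_truncation: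
  assumes "F \<subseteq> I"
  obtains e where "\<guillemotleft>e : P \<rightarrow> P\<guillemotright>" "\<forall>i\<in>F. e \<cdot> \<iota> i = \<iota> i"
    "\<forall>Y h. \<guillemotleft>h : P \<rightarrow> Y\<guillemotright> \<and> (\<forall>i\<in>F. h \<cdot> \<iota> i = Zero C (X i) Y) \<longrightarrow> h \<cdot> e = Zero C P Y"
proof -
  have P: "P \<in> Obj C" using cop by (simp add: is_coproduct_def)
  have X: "X i \<in> Obj C" if "i \<in> I" for i using hom_objs[OF coproduct_inj[OF that]] by simp
  obtain e where e: "\<guillemotleft>e : P \<rightarrow> P\<guillemotright>" "\<And>i. i \<in> I \<Longrightarrow> e \<cdot> \<iota> i = (if i \<in> F then \<iota> i else Zero C (X i) P)"
    by (rule coproduct_lift[OF P, of "\<lambda>i. if i \<in> F then \<iota> i else Zero C (X i) P"])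
      (use coproduct_inj zero_in_hom P X in auto)
  have "h \<cdot> e = Zero C P Y" if h: "\<guillemotleft>h : P \<rightarrow> Y\<guillemotright>" and k: "\<And>i. i \<in> F \<Longrightarrow> h \<cdot> \<iota> i = Zero C (X i) Y" for Y h
  proof (rule coproduct_eqI[OF comp[OF e(1) h]])
    have Y: "Y \<in> Obj C" using hom_objs[OF h] by simp
    show "\<guillemotleft>Zero C P Y : P \<rightarrow> Y\<guillemotright>" by (rule zero_in_hom[OF P Y])
    show "(h \<cdot> e) \<cdot> \<iota> i = Zero C P Y \<cdot> \<iota> i" if i: "i \<in> I" for i
      using assoc[OF coproduct_inj[OF i] e(1) h] e(2)[OF i] k[of i] comp_zero[OF h X[OF i]]
        zero_comp[OF coproduct_inj[OF i] Y] by simp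
  qed
  moreover have "e \<cdot> \<iota> i = \<iota> i" if "i \<in> F" for i using e(2) that assms by auto
  ultimately show thesis using that e(1) by blast
qed

lemma coproduct_projection:
  assumes j: "j \<in> I"
  obtains \<pi> where "\<guillemotleft>\<pi> : P \<rightarrow> X j\<guillemotright>" "\<pi> \<cdot> \<iota> j = Ident C (X j)" "\<And>i. i \<in> I \<Longrightarrow> i \<noteq> j \<Longrightarrow> \<pi> \<cdot> \<iota> i = Zero C (X i) (X j)"
proof -
  have X: "X i \<in> Obj C" if "i \<in> I" for i using hom_objs[OF coproduct_inj[OF that]] by simp
  obtain \<pi> where "\<guillemotleft>\<pi> : P \<rightarrow> X j\<guillemotright>" "\<And>i. i \<in> I \<Longrightarrow> \<pi> \<cdot> \<iota> i = (if i = j then Ident C (X j) else Zero C (X i) (X j))"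
    by (rule coproduct_lift[OF X[OF j], of "\<lambda>i. if i = j then Ident C (X j) else Zero C (X i) (X j)"])
      (use ident zero_in_hom X j in auto)
  then show thesis using that j by simp
qed

text \<open>The canonical map is always an injective homomorphism, since projections recover the
  coordinates; only surjectivity is at stake. A sum with finitely many nonzero components is
  finitely supported, and conversely a finitely supported arrow equals its truncation to finitely
  many summands.\<close>

lemma coproduct_sum_iso_iff:
  assumes K: "K \<in> Obj C"
  shows "(\<lambda>x. gfinprod (Hom C K P) (\<lambda>i. \<iota> i \<cdot> x i) I) \<in> iso (sum_group I (\<lambda>i. Hom C K (X i))) (Hom C K P)
     \<longleftrightarrow> (\<forall>f. \<guillemotleft>f : K \<rightarrow> P\<guillemotright> \<longrightarrow> finitely_supported C I X P \<iota> f)"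
proof -
  have P: "P \<in> Obj C" using cop by (simp add: is_coproduct_def)
  have X: "X i \<in> Obj C" if "i \<in> I" for i using hom_objs[OF coproduct_inj[OF that]] by simp
  have grpX: "comm_group (Hom C K (X i))" if "i \<in> I" for i using hom_group K X that by blast
  interpret KP: comm_group "Hom C K P" by (rule hom_group[OF K P])
  let ?s = "\<lambda>x. gfinprod (Hom C K P) (\<lambda>i. \<iota> i \<cdot> x i) I"
  let ?S = "sum_group I (\<lambda>i. Hom C K (X i))"
  have carr: "carrier ?S = {x \<in> \<Pi>\<^sub>E i\<in>I. carrier (Hom C K (X i)). finite {i \<in> I. x i \<noteq> Zero C K (X i)}}"
    using carrier_sum_group[of I "\<lambda>i. Hom C K (X i)"] grpX by (simp add: comm_group_def)
  have hom: "?s \<in> hom ?S (Hom C K P)"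
    using group_hom.homh[OF comp_left_hom[OF coproduct_inj K]] grpX
    by (intro KP.hom_group_sum[where f = "\<lambda>i g. \<iota> i \<cdot> g"]) (auto simp: comm_group_def)
  have elem: "(\<lambda>i. \<iota> i \<cdot> x i) \<in> I \<rightarrow> carrier (Hom C K P)" "finite {i \<in> I. \<iota> i \<cdot> x i \<noteq> \<one>\<^bsub>Hom C K P\<^esub>}"
    "\<And>i. i \<in> I \<Longrightarrow> \<guillemotleft>x i : K \<rightarrow> X i\<guillemotright>"
    if x: "x \<in> carrier ?S" for x
  proof -
    show xi: "\<guillemotleft>x i : K \<rightarrow> X i\<guillemotright>" if "i \<in> I" for i using x that by (auto simp: carr)
    show "(\<lambda>i. \<iota> i \<cdot> x i) \<in> I \<rightarrow> carrier (Hom C K P)" using comp[OF xi coproduct_inj] by blast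
    have "finite {i \<in> I. x i \<noteq> Zero C K (X i)}" using x by (simp add: carr)
    then show "finite {i \<in> I. \<iota> i \<cdot> x i \<noteq> \<one>\<^bsub>Hom C K P\<^esub>}"
      by (rule rev_finite_subset) (use comp_zero[OF coproduct_inj K] in auto)
  qed
  have push: "h \<cdot> ?s x = gfinprod (Hom C K Y) (\<lambda>i. h \<cdot> (\<iota> i \<cdot> x i)) I"
    if x: "x \<in> carrier ?S" and h: "\<guillemotleft>h : P \<rightarrow> Y\<guillemotright>" for x h Y
    using hom_gfinprod[OF KP.comm_group_axioms hom_group group_hom.homh[OF comp_left_hom[OF h K]] elem(1,2)[OF x]]
      K hom_objs[OF h] by simp
  have inj: "inj_on ?s (carrier ?S)"
  proof (rule inj_onI)
    fix x y assume x: "x \<in> carrier ?S" and y: "y \<in> carrier ?S" and e: "?s x = ?s y"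
    \<comment> \<open>Applying the projection to the sum leaves only the \<open>j\<close>-th
      term.\<close>
    have coord: "\<pi> \<cdot> ?s z = z j"
      if z: "z \<in> carrier ?S" and j: "j \<in> I" and p: "\<guillemotleft>\<pi> : P \<rightarrow> X j\<guillemotright>" "\<pi> \<cdot> \<iota> j = Ident C (X j)"
        "\<And>i. i \<in> I \<Longrightarrow> i \<noteq> j \<Longrightarrow> \<pi> \<cdot> \<iota> i = Zero C (X i) (X j)" for z j \<pi>
    proof -
      interpret KX: comm_group "Hom C K (X j)" by (rule grpX[OF j])
      have s: "\<pi> \<cdot> (\<iota> i \<cdot> z i) = (\<pi> \<cdot> \<iota> i) \<cdot> z i" if "i \<in> I" for i
        using assoc[OF elem(3)[OF z that] coproduct_inj[OF that] p(1)] by simp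
      have "gfinprod (Hom C K (X j)) (\<lambda>i. \<pi> \<cdot> (\<iota> i \<cdot> z i)) I = \<pi> \<cdot> (\<iota> j \<cdot> z j)"
      proof (rule KX.gfinprod_single[OF j])
        show "\<guillemotleft>\<pi> \<cdot> (\<iota> j \<cdot> z j) : K \<rightarrow> X j\<guillemotright>"
          by (rule comp[OF comp[OF elem(3)[OF z j] coproduct_inj[OF j]] p(1)])
        show "\<pi> \<cdot> (\<iota> i \<cdot> z i) = \<one>\<^bsub>Hom C K (X j)\<^esub>" if "i \<in> I" "i \<noteq> j" for i
          using s[OF that(1)] p(3)[OF that] zero_comp[OF elem(3)[OF z that(1)] X[OF j]] by simp
      qed
      then show ?thesis
        using push[OF z p(1)] s[OF j] p(2) ident_left[OF elem(3)[OF z j]] by simp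
    qed
    have "x j = y j" if j: "j \<in> I" for j
    proof (rule coproduct_projection[OF j])
      fix \<pi> assume p: "\<guillemotleft>\<pi> : P \<rightarrow> X j\<guillemotright>" "\<pi> \<cdot> \<iota> j = Ident C (X j)"
        "\<And>i. i \<in> I \<Longrightarrow> i \<noteq> j \<Longrightarrow> \<pi> \<cdot> \<iota> i = Zero C (X i) (X j)"
      show ?thesis using coord[OF x j p] coord[OF y j p] e by simp
    qed
    moreover have "x \<in> extensional I" "y \<in> extensional I" using x y by (auto simp: carr PiE_def)
    ultimately show "x = y" by (rule extensionalityI[rotated 2])
  qed
  have supp_sum: "finitely_supported C I X P \<iota> (?s x)" if x: "x \<in> carrier ?S" for x
  proof -
    let ?F = "{i \<in> I. x i \<noteq> Zero C K (X i)}"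
    have dom: "Dom C (?s x) = K" using KP.gfinprod_closed[OF elem(1)[OF x]] by (simp add: in_hom_iff)
    have "h \<cdot> ?s x = Zero C K Y" if h: "\<guillemotleft>h : P \<rightarrow> Y\<guillemotright>" and k: "\<forall>i\<in>?F. h \<cdot> \<iota> i = Zero C (X i) Y" for h Y
    proof -
      have Y: "Y \<in> Obj C" using hom_objs[OF h] by simp
      interpret KY: comm_group "Hom C K Y" by (rule hom_group[OF K Y])
      have "h \<cdot> (\<iota> i \<cdot> x i) = \<one>\<^bsub>Hom C K Y\<^esub>" if i: "i \<in> I" for i
      proof (cases "i \<in> ?F")
        case True
        then show ?thesis
          using k assoc[OF elem(3)[OF x i] coproduct_inj[OF i] h] zero_comp[OF elem(3)[OF x i] Y] by simp
      next
        case False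
        then show ?thesis using i comp_zero[OF coproduct_inj[OF i] K] comp_zero[OF h K] by simp
      qed
      then have "gfinprod (Hom C K Y) (\<lambda>i. h \<cdot> (\<iota> i \<cdot> x i)) I = \<one>\<^bsub>Hom C K Y\<^esub>"
        by (simp add: gfinprod_def cong: conj_cong)
      then show ?thesis using push[OF x h] by simp
    qed
    moreover have "finite ?F" using x by (simp add: carr)
    ultimately show ?thesis
      unfolding finitely_supported_def dom by (intro exI[of _ ?F]) auto
  qed
  have surj: "f \<in> ?s ` carrier ?S" if f: "\<guillemotleft>f : K \<rightarrow> P\<guillemotright>" and fs: "finitely_supported C I X P \<iota> f" for f
  proof -
    obtain F where F: "F \<subseteq> I" "finite F" and kill: "\<And>Y h. \<guillemotleft>h : P \<rightarrow> Y\<guillemotright> \<Longrightarrow>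
        (\<And>i. i \<in> F \<Longrightarrow> h \<cdot> \<iota> i = Zero C (X i) Y) \<Longrightarrow> h \<cdot> f = Zero C K Y"
      using fs f unfolding finitely_supported_def by (auto simp: in_hom_iff)
    have "\<forall>j\<in>I. \<exists>\<pi>. \<guillemotleft>\<pi> : P \<rightarrow> X j\<guillemotright> \<and> \<pi> \<cdot> \<iota> j = Ident C (X j) \<and>
        (\<forall>i\<in>I. i \<noteq> j \<longrightarrow> \<pi> \<cdot> \<iota> i = Zero C (X i) (X j))"
      using coproduct_projection by metis
    then obtain \<pi> where p: "\<And>j. j \<in> I \<Longrightarrow> \<guillemotleft>\<pi> j : P \<rightarrow> X j\<guillemotright>" "\<And>j. j \<in> I \<Longrightarrow> \<pi> j \<cdot> \<iota> j = Ident C (X j)"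
      "\<And>j i. j \<in> I \<Longrightarrow> i \<in> I \<Longrightarrow> i \<noteq> j \<Longrightarrow> \<pi> j \<cdot> \<iota> i = Zero C (X i) (X j)"
      by metis
    interpret PP: comm_group "Hom C P P" by (rule hom_group[OF P P])
    \<comment> \<open>The truncation to \<open>F\<close> written as a sum over projections, since
      here the components of \<open>f\<close> have to be exhibited.\<close>
    let ?e = "gfinprod (Hom C P P) (\<lambda>i. \<iota> i \<cdot> \<pi> i) F"
    have ip: "\<guillemotleft>\<iota> i \<cdot> \<pi> i : P \<rightarrow> P\<guillemotright>" if "i \<in> F" for i using comp[OF p(1) coproduct_inj] F(1) that by blast
    have ipF: "(\<lambda>i. \<iota> i \<cdot> \<pi> i) \<in> F \<rightarrow> carrier (Hom C P P)" using ip by blast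
    have e: "\<guillemotleft>?e : P \<rightarrow> P\<guillemotright>" by (rule PP.gfinprod_closed[OF ipF])
    have e\<iota>: "?e \<cdot> \<iota> j = \<iota> j" if j: "j \<in> F" for j
    proof -
      have jI: "j \<in> I" using j F(1) by blast
      interpret XP: comm_group "Hom C (X j) P" by (rule comm_group_Hom[OF coproduct_inj[OF jI]])
      have s: "(\<iota> i \<cdot> \<pi> i) \<cdot> \<iota> j = \<iota> i \<cdot> (\<pi> i \<cdot> \<iota> j)" if "i \<in> F" for i
        using assoc[OF coproduct_inj[OF jI] p(1) coproduct_inj] that F(1) by blast
      have "?e \<cdot> \<iota> j = gfinprod (Hom C (X j) P) (\<lambda>i. (\<iota> i \<cdot> \<pi> i) \<cdot> \<iota> j) F"
        using hom_gfinprod[OF PP.comm_group_axioms XP.comm_group_axioms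
          group_hom.homh[OF comp_right_hom[OF coproduct_inj[OF jI] P]] ipF] F(2) by simp
      also have "\<dots> = (\<iota> j \<cdot> \<pi> j) \<cdot> \<iota> j"
      proof (rule XP.gfinprod_single[OF j])
        show "\<guillemotleft>(\<iota> j \<cdot> \<pi> j) \<cdot> \<iota> j : X j \<rightarrow> P\<guillemotright>" by (rule comp[OF coproduct_inj[OF jI] ip[OF j]])
        show "(\<iota> i \<cdot> \<pi> i) \<cdot> \<iota> j = \<one>\<^bsub>Hom C (X j) P\<^esub>" if i: "i \<in> F" "i \<noteq> j" for i
        proof -
          have iI: "i \<in> I" using i F(1) by blast
          show ?thesis using s[OF i(1)] p(3)[OF iI jI] i(2) comp_zero[OF coproduct_inj[OF iI] X[OF jI]] by simp
        qed
      qed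
      also have "\<dots> = \<iota> j" using s[OF j] p(2)[OF jI] ident_right[OF coproduct_inj[OF jI]] by simp
      finally show ?thesis .
    qed
    \<comment> \<open>\<open>?d\<close> kills the summands in \<open>F\<close>, hence kills
      \<open>f\<close>; so \<open>f\<close> equals its truncation
      \<open>?e \<cdot> f\<close>.\<close>
    let ?d = "Ident C P \<boxplus> neg C ?e"
    have d: "\<guillemotleft>?d : P \<rightarrow> P\<guillemotright>" by (rule add_in_hom[OF ident[OF P] neg_in_hom[OF e]])
    have "?d \<cdot> \<iota> i = Zero C (X i) P" if i: "i \<in> F" for i
    proof -
      have \<iota>: "\<guillemotleft>\<iota> i : X i \<rightarrow> P\<guillemotright>" using coproduct_inj i F(1) by blast
      show ?thesis
        using distrib_right[OF \<iota> ident[OF P] neg_in_hom[OF e]] neg_comp[OF \<iota> e] e\<iota>[OF i] ident_left[OF \<iota>]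
          add_neg[OF \<iota>] by simp
    qed
    then have "?d \<cdot> f = Zero C K P" by (rule kill[OF d])
    then have "f \<boxplus> neg C (?e \<cdot> f) = Zero C K P"
      using distrib_right[OF f ident[OF P] neg_in_hom[OF e]] neg_comp[OF f e] ident_left[OF f] by simp
    then have fe: "f = ?e \<cdot> f" by (rule eq_if_diff_zero[OF f comp[OF f e]])
    \<comment> \<open>The coordinates of \<open>f\<close> on \<open>F\<close> and zero on the rest
      of \<open>I\<close>; \<open>undefined\<close> outside \<open>I\<close> is the default value of
      extensional functions.\<close>
    define x where "x i = (if i \<in> I then if i \<in> F then \<pi> i \<cdot> f else Zero C K (X i) else undefined)" for i
    have x: "x \<in> carrier ?S"
    proof -
      have "{i \<in> I. x i \<noteq> Zero C K (X i)} \<subseteq> F" by (auto simp: x_def)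
      moreover have "x \<in> (\<Pi>\<^sub>E i\<in>I. carrier (Hom C K (X i)))"
        using comp[OF f p(1)] zero_in_hom[OF K X] by (auto simp: x_def)
      ultimately show ?thesis using F(2) finite_subset by (auto simp: carr)
    qed
    have "?e \<cdot> f = gfinprod (Hom C K P) (\<lambda>i. (\<iota> i \<cdot> \<pi> i) \<cdot> f) F"
      using hom_gfinprod[OF PP.comm_group_axioms KP.comm_group_axioms
        group_hom.homh[OF comp_right_hom[OF f P]] ipF] F(2) by simp
    also have "\<dots> = ?s x"
    proof (rule KP.gfinprod_mono_neutral_cong_left[OF F(1)])
      show "\<iota> i \<cdot> x i = \<one>\<^bsub>Hom C K P\<^esub>" if "i \<in> I - F" for i
        using that comp_zero[OF coproduct_inj K] by (simp add: x_def)
      show "(\<iota> i \<cdot> \<pi> i) \<cdot> f = \<iota> i \<cdot> x i" if i: "i \<in> F" for i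
      proof -
        have iI: "i \<in> I" using i F(1) by blast
        show ?thesis using assoc[OF f p(1)[OF iI] coproduct_inj[OF iI]] i iI by (simp add: x_def)
      qed
      show "(\<lambda>i. \<iota> i \<cdot> x i) \<in> I \<rightarrow> carrier (Hom C K P)" by (rule elem(1)[OF x])
    qed
    finally show ?thesis by (intro image_eqI[OF trans[OF fe] x])
  qed
  show ?thesis
  proof
    assume "?s \<in> iso ?S (Hom C K P)"
    then have "?s ` carrier ?S = carrier (Hom C K P)" by (simp add: iso_def bij_betw_def)
    then have onto: "carrier (Hom C K P) = ?s ` carrier ?S" by (rule sym)
    show "\<forall>f. \<guillemotleft>f : K \<rightarrow> P\<guillemotright> \<longrightarrow> finitely_supported C I X P \<iota> f"
      unfolding onto
    proof (intro allI impI)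
      fix f assume "f \<in> ?s ` carrier ?S"
      then show "finitely_supported C I X P \<iota> f" by (rule imageE) (simp only: supp_sum)
    qed
  next
    assume r: "\<forall>f. \<guillemotleft>f : K \<rightarrow> P\<guillemotright> \<longrightarrow> finitely_supported C I X P \<iota> f"
    have "?s ` carrier ?S \<subseteq> carrier (Hom C K P)" using hom by (auto simp: hom_def)
    moreover have "carrier (Hom C K P) \<subseteq> ?s ` carrier ?S"
    proof
      fix f assume f: "\<guillemotleft>f : K \<rightarrow> P\<guillemotright>"
      show "f \<in> ?s ` carrier ?S" by (rule surj[OF f r[rule_format, OF f]])
    qed
    ultimately show "?s \<in> iso ?S (Hom C K P)"
      using hom inj by (simp add: iso_def bij_betw_def)
  qed
qed

end

end


text \<open>Turns compactness into a condition on single arrows, free of sums of groups, which can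
  be moved along a triangle.\<close>

lemma (in preadditive) is_compact_iff:
  fixes K :: 'o
  shows "is_compact C K \<longleftrightarrow> K \<in> Obj C \<and> (\<forall>(I :: 'a set) X P \<iota> f. small TYPE('a) I \<and>
    is_coproduct C I X P \<iota> \<and> \<guillemotleft>f : K \<rightarrow> P\<guillemotright> \<longrightarrow> finitely_supported C I X P \<iota> f)"
proof (cases "K \<in> Obj C")
  case True
  have "small TYPE('a) I \<and> (\<forall>i\<in>I. X i \<in> Obj C) \<and> is_coproduct C I X P \<iota> \<longleftrightarrow>
      small TYPE('a) I \<and> is_coproduct C I X P \<iota>" for I :: "'a set" and X P \<iota>
    using hom_objs[OF coproduct_inj, of I X P \<iota>] by auto
  moreover have "(small TYPE('a) I \<and> is_coproduct C I X P \<iota> \<longrightarrow>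
       (\<lambda>x. gfinprod (Hom C K P) (\<lambda>i. \<iota> i \<cdot> x i) I) \<in> iso (sum_group I (\<lambda>i. Hom C K (X i))) (Hom C K P)) \<longleftrightarrow>
      (\<forall>f. small TYPE('a) I \<and> is_coproduct C I X P \<iota> \<and> \<guillemotleft>f : K \<rightarrow> P\<guillemotright> \<longrightarrow> finitely_supported C I X P \<iota> f)"
    for I :: "'a set" and X P \<iota>
    by (cases "is_coproduct C I X P \<iota>"; cases "small TYPE('a) I") (simp_all add: coproduct_sum_iso_iff[OF _ True])
  ultimately show ?thesis
    unfolding is_compact_def using True by simp
qed (simp add: is_compact_def)

context preadditive
begin

lemma compactI:
  assumes "K \<in> Obj C"
    and "\<And>(I :: 'a set) X P \<iota> f. small TYPE('a) I \<Longrightarrow> is_coproduct C I X P \<iota> \<Longrightarrow> \<guillemotleft>f : K \<rightarrow> P\<guillemotright> \<Longrightarrow>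
      \<exists>F\<subseteq>I. finite F \<and> (\<forall>Y h. \<guillemotleft>h : P \<rightarrow> Y\<guillemotright> \<and> (\<forall>i\<in>F. h \<cdot> \<iota> i = Zero C (X i) Y) \<longrightarrow> h \<cdot> f = Zero C K Y)"
  shows "is_compact C K"
  unfolding is_compact_iff
proof (intro conjI allI impI; (elim conjE)?)
  show "finitely_supported C I X P \<iota> f"
    if "small TYPE('a) I" "is_coproduct C I X P \<iota>" "\<guillemotleft>f : K \<rightarrow> P\<guillemotright>" for I :: "'a set" and X P \<iota> f
  proof -
    have "Dom C f = K" using that(3) by (simp add: in_hom_iff)
    then show ?thesis unfolding finitely_supported_def using assms(2)[OF that] by simp
  qed
qed (rule assms(1))

lemma compactE:
  fixes I :: "'a set"
  assumes "is_compact C K" "small TYPE('a) I" "is_coproduct C I X P \<iota>" "\<guillemotleft>f : K \<rightarrow> P\<guillemotright>"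
  obtains F where "F \<subseteq> I" "finite F"
    "\<forall>Y h. \<guillemotleft>h : P \<rightarrow> Y\<guillemotright> \<and> (\<forall>i\<in>F. h \<cdot> \<iota> i = Zero C (X i) Y) \<longrightarrow> h \<cdot> f = Zero C K Y"
proof -
  have "finitely_supported C I X P \<iota> f" using assms unfolding is_compact_iff by blast
  moreover have "Dom C f = K" using assms(4) by (simp add: in_hom_iff)
  ultimately show thesis using that unfolding finitely_supported_def by metis
qed

lemma compact_obj: "is_compact C K \<Longrightarrow> K \<in> Obj C"
  by (simp add: is_compact_def)

text \<open>The empty set supports every arrow out of a zero object.\<close>

lemma zero_compact:
  assumes Z: "is_zero C Z" shows "is_compact C Z"
proof (rule compactI)
  show "Z \<in> Obj C" using Z by (simp add: is_zero_def)
  fix I :: "'a set" and X P \<iota> f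
  assume f: "\<guillemotleft>f : Z \<rightarrow> P\<guillemotright>"
  have "h \<cdot> f = Zero C Z Y" if "\<guillemotleft>h : P \<rightarrow> Y\<guillemotright>" for h Y
    by (rule zero_from[OF Z preadditive_axioms comp[OF f that]])
  then show "\<exists>F\<subseteq>I. finite F \<and> (\<forall>Y h. \<guillemotleft>h : P \<rightarrow> Y\<guillemotright> \<and> (\<forall>i\<in>F. h \<cdot> \<iota> i = Zero C (X i) Y) \<longrightarrow> h \<cdot> f = Zero C Z Y)"
    by (intro exI[of _ "{}"]) auto
qed

text \<open>An arrow out of \<open>M\<close> is determined by its restrictions along
  \<open>i\<close> and \<open>j\<close>; the union of their supports supports it.\<close>

lemma biproduct_compact:
  assumes B: "is_biproduct C K L M" and K: "is_compact C K" and L: "is_compact C L"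
  shows "is_compact C M"
proof -
  obtain i j p q where i: "\<guillemotleft>i : K \<rightarrow> M\<guillemotright>" and j: "\<guillemotleft>j : L \<rightarrow> M\<guillemotright>" and p: "\<guillemotleft>p : M \<rightarrow> K\<guillemotright>" and q: "\<guillemotleft>q : M \<rightarrow> L\<guillemotright>"
    and sum: "(i \<cdot> p) \<boxplus> (j \<cdot> q) = Ident C M"
    using B unfolding is_biproduct_def by blast
  show ?thesis
  proof (rule compactI)
    show M: "M \<in> Obj C" using hom_objs[OF i] by simp
    fix I :: "'a set" and X P \<iota> f
    assume sm: "small TYPE('a) I" and cop: "is_coproduct C I X P \<iota>" and f: "\<guillemotleft>f : M \<rightarrow> P\<guillemotright>"
    obtain F where F: "F \<subseteq> I" "finite F"
      "\<forall>Y h. \<guillemotleft>h : P \<rightarrow> Y\<guillemotright> \<and> (\<forall>i\<in>F. h \<cdot> \<iota> i = Zero C (X i) Y) \<longrightarrow> h \<cdot> (f \<cdot> i) = Zero C K Y"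
      by (rule compactE[OF K sm cop comp[OF i f]])
    obtain G where G: "G \<subseteq> I" "finite G"
      "\<forall>Y h. \<guillemotleft>h : P \<rightarrow> Y\<guillemotright> \<and> (\<forall>i\<in>G. h \<cdot> \<iota> i = Zero C (X i) Y) \<longrightarrow> h \<cdot> (f \<cdot> j) = Zero C L Y"
      by (rule compactE[OF L sm cop comp[OF j f]])
    have "h \<cdot> f = Zero C M Y" if h: "\<guillemotleft>h : P \<rightarrow> Y\<guillemotright>" and k: "\<forall>i\<in>F \<union> G. h \<cdot> \<iota> i = Zero C (X i) Y" for h Y
    proof -
      have Y: "Y \<in> Obj C" using hom_objs[OF h] by simp
      note hf = comp[OF f h]
      have hfi: "(h \<cdot> f) \<cdot> i = Zero C K Y" and hfj: "(h \<cdot> f) \<cdot> j = Zero C L Y"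
        using F(3)[THEN spec, THEN spec, THEN mp, OF conjI, OF h] G(3)[THEN spec, THEN spec, THEN mp, OF conjI, OF h] k assoc[OF i f h] assoc[OF j f h] by auto
      have "h \<cdot> f = (h \<cdot> f) \<cdot> ((i \<cdot> p) \<boxplus> (j \<cdot> q))" using sum ident_right[OF hf] by simp
      also have "\<dots> = Zero C M Y"
        using distrib_left[OF comp[OF p i] comp[OF q j] hf] assoc[OF p i hf] assoc[OF q j hf] hfi hfj
          zero_comp[OF p Y] zero_comp[OF q Y] add_zero[OF zero_in_hom[OF M Y]] by simp
      finally show ?thesis .
    qed
    then show "\<exists>F\<subseteq>I. finite F \<and> (\<forall>Y h. \<guillemotleft>h : P \<rightarrow> Y\<guillemotright> \<and> (\<forall>i\<in>F. h \<cdot> \<iota> i = Zero C (X i) Y) \<longrightarrow> h \<cdot> f = Zero C M Y)"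
      using F(1,2) G(1,2) by (intro exI[of _ "F \<union> G"]) auto
  qed
qed

end

text \<open>The inverse \<open>G\<close> of the shift carries a coproduct to a coproduct, and \<open>Hom(\<Sigma>K, P) \<cong> Hom(K, GP)\<close>.\<close>

context triangulated
begin

lemma shift_compact:
  assumes K: "is_compact T K"
  shows "is_compact T (omap \<Sigma> K)"
proof -
  note pre = preadditive_axioms
  have KO: "K \<in> Obj T" by (rule compact_obj[OF K])
  obtain G \<eta> \<epsilon> where G: "is_functor T T G" and eta: "nat_iso T T id_ftor (G \<circ>\<^sub>F \<Sigma>) \<eta>"
    and eps: "nat_iso T T (\<Sigma> \<circ>\<^sub>F G) id_ftor \<epsilon>"
    using shift_equivalence unfolding is_equivalence_def by blast
  have eqG: "is_equivalence T T G" by (rule equivalence_sym[OF pre pre shift_functor G eta eps])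
  have eta_iso: "is_iso T (\<eta> X) X (omap G (omap \<Sigma> X))" if "X \<in> Obj T" for X
    using eta that by (simp add: nat_iso_def)
  have eta_hom: "\<guillemotleft>\<eta> X : X \<rightarrow> omap G (omap \<Sigma> X)\<guillemotright>" if "X \<in> Obj T" for X
    using eta_iso[OF that] by (simp add: is_iso_def)
  \<comment> \<open>The quasi-inverse is known only as a functor. That it preserves zero maps
    follows from \<Sigma>, since \<Sigma>G is isomorphic to the identity.\<close>
  have G_zero: "amap G (Zero T X Y) = Zero T (omap G X) (omap G Y)" if X: "X \<in> Obj T" and Y: "Y \<in> Obj T" for X Y
  proof (rule equivalence_faithful[OF pre shift_equivalence])
    have GX: "omap G X \<in> Obj T" "omap G Y \<in> Obj T" using functor_obj[OF G] X Y by auto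
    show "\<guillemotleft>amap G (Zero T X Y) : omap G X \<rightarrow> omap G Y\<guillemotright>" by (rule functor_arr[OF G zero_in_hom[OF X Y]])
    then have g: "\<guillemotleft>amap \<Sigma> (amap G (Zero T X Y)) : omap \<Sigma> (omap G X) \<rightarrow> omap \<Sigma> (omap G Y)\<guillemotright>"
      by (rule functor_arr[OF shift_functor])
    show "\<guillemotleft>Zero T (omap G X) (omap G Y) : omap G X \<rightarrow> omap G Y\<guillemotright>" by (rule zero_in_hom[OF GX])
    have eY: "is_iso T (\<epsilon> Y) (omap \<Sigma> (omap G Y)) Y" and eX: "\<guillemotleft>\<epsilon> X : omap \<Sigma> (omap G X) \<rightarrow> X\<guillemotright>"
      using eps X Y by (auto simp: nat_iso_def nat_trans_def)
    then have eY': "\<guillemotleft>\<epsilon> Y : omap \<Sigma> (omap G Y) \<rightarrow> Y\<guillemotright>" by (simp add: is_iso_def)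
    have S: "omap \<Sigma> (omap G X) \<in> Obj T" "omap \<Sigma> (omap G Y) \<in> Obj T" using functor_obj[OF shift_functor] GX by auto
    have "Zero T X Y \<cdot> \<epsilon> X = \<epsilon> Y \<cdot> amap \<Sigma> (amap G (Zero T X Y))"
      using eps zero_in_hom[OF X Y] by (auto simp: nat_iso_def nat_trans_def)
    then have "\<epsilon> Y \<cdot> amap \<Sigma> (amap G (Zero T X Y)) = \<epsilon> Y \<cdot> Zero T (omap \<Sigma> (omap G X)) (omap \<Sigma> (omap G Y))"
      using zero_comp[OF eX Y] comp_zero[OF eY' S(1)] by simp
    then show "amap \<Sigma> (amap G (Zero T X Y)) = amap \<Sigma> (Zero T (omap G X) (omap G Y))"
      using iso_cancel_left[OF eY g zero_in_hom[OF S]] shift_zero[OF GX] by simp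
  qed
  \<comment> \<open>Arrows GP -> Y correspond to arrows P -> \<Sigma>Y through
    \<open>\<eta> Y\<close> and fullness of \<open>G\<close>, so the universal property of
    \<open>P\<close> transfers.\<close>
  have G_cop: "is_coproduct T I (\<lambda>i. omap G (X i)) (omap G P) (\<lambda>i. amap G (\<iota> i))"
    if cop: "is_coproduct T I X P \<iota>" for I :: "'a set" and X P \<iota>
    unfolding is_coproduct_def
  proof (intro conjI ballI allI impI)
    have P: "P \<in> Obj T" using cop by (simp add: is_coproduct_def)
    note inj = coproduct_inj[OF cop]
    show "omap G P \<in> Obj T" by (rule functor_obj[OF G P])
    show Gi: "\<guillemotleft>amap G (\<iota> i) : omap G (X i) \<rightarrow> omap G P\<guillemotright>" if "i \<in> I" for i by (rule functor_arr[OF G inj[OF that]])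
    fix Y f assume Y: "Y \<in> Obj T" and f: "\<forall>i\<in>I. \<guillemotleft>f i : omap G (X i) \<rightarrow> Y\<guillemotright>"
    have SY: "omap \<Sigma> Y \<in> Obj T" by (rule functor_obj[OF shift_functor Y])
    have "\<forall>i\<in>I. \<exists>k. \<guillemotleft>k : X i \<rightarrow> omap \<Sigma> Y\<guillemotright> \<and> amap G k = \<eta> Y \<cdot> f i"
    proof
      fix i assume i: "i \<in> I"
      have "\<guillemotleft>\<eta> Y \<cdot> f i : omap G (X i) \<rightarrow> omap G (omap \<Sigma> Y)\<guillemotright>" using f i comp[OF _ eta_hom[OF Y]] by blast
      then show "\<exists>k. \<guillemotleft>k : X i \<rightarrow> omap \<Sigma> Y\<guillemotright> \<and> amap G k = \<eta> Y \<cdot> f i"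
        using equivalence_full[OF pre pre eqG _ SY] hom_objs[OF inj[OF i]] by metis
    qed
    then obtain k where k: "\<And>i. i \<in> I \<Longrightarrow> \<guillemotleft>k i : X i \<rightarrow> omap \<Sigma> Y\<guillemotright>" "\<And>i. i \<in> I \<Longrightarrow> amap G (k i) = \<eta> Y \<cdot> f i"
      by metis
    obtain m where m: "\<guillemotleft>m : P \<rightarrow> omap \<Sigma> Y\<guillemotright>" "\<And>i. i \<in> I \<Longrightarrow> m \<cdot> \<iota> i = k i"
      using coproduct_lift[OF cop SY k(1)] by metis
    have Gm: "\<guillemotleft>amap G m : omap G P \<rightarrow> omap G (omap \<Sigma> Y)\<guillemotright>" by (rule functor_arr[OF G m(1)])
    note v = inv_arr[OF eta_iso[OF Y]]
    show "\<exists>!h. \<guillemotleft>h : omap G P \<rightarrow> Y\<guillemotright> \<and> (\<forall>i\<in>I. h \<cdot> amap G (\<iota> i) = f i)"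
    proof (rule ex1I)
      have "(inv_arr T (\<eta> Y) \<cdot> amap G m) \<cdot> amap G (\<iota> i) = f i" if i: "i \<in> I" for i
      proof -
        have fi: "\<guillemotleft>f i : omap G (X i) \<rightarrow> Y\<guillemotright>" using f i by blast
        have "(inv_arr T (\<eta> Y) \<cdot> amap G m) \<cdot> amap G (\<iota> i) = inv_arr T (\<eta> Y) \<cdot> (\<eta> Y \<cdot> f i)"
          using assoc[OF Gi[OF i] Gm v(1)] functor_comp[OF G inj[OF i] m(1)] m(2)[OF i] k(2)[OF i] by simp
        also have "\<dots> = f i"
          using assoc[OF fi eta_hom[OF Y] v(1)] v(2) ident_left[OF fi] by simp
        finally show ?thesis .
      qed
      then show "\<guillemotleft>inv_arr T (\<eta> Y) \<cdot> amap G m : omap G P \<rightarrow> Y\<guillemotright> \<and>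
          (\<forall>i\<in>I. (inv_arr T (\<eta> Y) \<cdot> amap G m) \<cdot> amap G (\<iota> i) = f i)"
        using comp[OF Gm v(1)] by blast
    next
      fix h assume h: "\<guillemotleft>h : omap G P \<rightarrow> Y\<guillemotright> \<and> (\<forall>i\<in>I. h \<cdot> amap G (\<iota> i) = f i)"
      then have hh: "\<guillemotleft>h : omap G P \<rightarrow> Y\<guillemotright>" by simp
      obtain n where n: "\<guillemotleft>n : P \<rightarrow> omap \<Sigma> Y\<guillemotright>" "amap G n = \<eta> Y \<cdot> h"
        by (rule equivalence_full[OF pre pre eqG P SY comp[OF hh eta_hom[OF Y]]])
      have "n \<cdot> \<iota> i = m \<cdot> \<iota> i" if i: "i \<in> I" for i
      proof (rule equivalence_faithful[OF pre eqG comp[OF inj[OF i] n(1)] comp[OF inj[OF i] m(1)]])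
        show "amap G (n \<cdot> \<iota> i) = amap G (m \<cdot> \<iota> i)"
          using functor_comp[OF G inj[OF i] n(1)] n(2) assoc[OF Gi[OF i] hh eta_hom[OF Y]] h i m(2)[OF i] k(2)[OF i]
          by simp
      qed
      then have "n = m" by (rule coproduct_eqI[OF cop n(1) m(1)])
      then have "amap G m = \<eta> Y \<cdot> h" using n(2) by simp
      then show "h = inv_arr T (\<eta> Y) \<cdot> amap G m"
        using assoc[OF hh eta_hom[OF Y] v(1)] v(2) ident_left[OF hh] by simp
    qed
  qed
  show ?thesis
  proof (rule compactI)
    show SK: "omap \<Sigma> K \<in> Obj T" by (rule functor_obj[OF shift_functor KO])
    fix I :: "'a set" and X P \<iota> f
    assume sm: "small TYPE('a) I" and cop: "is_coproduct T I X P \<iota>" and f: "\<guillemotleft>f : omap \<Sigma> K \<rightarrow> P\<guillemotright>"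
    have Gf: "\<guillemotleft>amap G f : omap G (omap \<Sigma> K) \<rightarrow> omap G P\<guillemotright>" by (rule functor_arr[OF G f])
    \<comment> \<open>Compactness of \<open>K\<close> is applied to the arrow K -> GP adjoint to
      \<open>f\<close>; the finite set so obtained also supports \<open>f\<close>.\<close>
    obtain F where F: "F \<subseteq> I" "finite F"
      "\<forall>Y h. \<guillemotleft>h : omap G P \<rightarrow> Y\<guillemotright> \<and> (\<forall>i\<in>F. h \<cdot> amap G (\<iota> i) = Zero T (omap G (X i)) Y) \<longrightarrow> h \<cdot> (amap G f \<cdot> \<eta> K) = Zero T K Y"
      by (rule compactE[OF K sm G_cop[OF cop] comp[OF eta_hom[OF KO] Gf]])
    have "h \<cdot> f = Zero T (omap \<Sigma> K) Y" if h: "\<guillemotleft>h : P \<rightarrow> Y\<guillemotright>" and k: "\<forall>i\<in>F. h \<cdot> \<iota> i = Zero T (X i) Y" for h Y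
    proof (rule equivalence_faithful[OF pre eqG comp[OF f h]])
      have Y: "Y \<in> Obj T" using hom_objs[OF h] by simp
      have GY: "omap G Y \<in> Obj T" "omap G (omap \<Sigma> K) \<in> Obj T" using functor_obj[OF G] Y SK by auto
      have Gh: "\<guillemotleft>amap G h : omap G P \<rightarrow> omap G Y\<guillemotright>" by (rule functor_arr[OF G h])
      show "\<guillemotleft>Zero T (omap \<Sigma> K) Y : omap \<Sigma> K \<rightarrow> Y\<guillemotright>" by (rule zero_in_hom[OF SK Y])
      have "\<forall>i\<in>F. amap G h \<cdot> amap G (\<iota> i) = Zero T (omap G (X i)) (omap G Y)"
      proof
        fix i assume i: "i \<in> F"
        then have \<iota>: "\<guillemotleft>\<iota> i : X i \<rightarrow> P\<guillemotright>" using F(1) coproduct_inj[OF cop] by blast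
        show "amap G h \<cdot> amap G (\<iota> i) = Zero T (omap G (X i)) (omap G Y)"
          using functor_comp[OF G \<iota> h] k i G_zero[OF _ Y] hom_objs[OF \<iota>] by simp
      qed
      then have "(amap G h \<cdot> amap G f) \<cdot> \<eta> K = Zero T (omap G (omap \<Sigma> K)) (omap G Y) \<cdot> \<eta> K"
        using F(3)[THEN spec, THEN spec, THEN mp, OF conjI, OF Gh] assoc[OF eta_hom[OF KO] Gf Gh] zero_comp[OF eta_hom[OF KO] GY(1)] by simp
      then have "amap G h \<cdot> amap G f = Zero T (omap G (omap \<Sigma> K)) (omap G Y)"
        by (rule iso_cancel_right[OF eta_iso[OF KO] comp[OF Gf Gh] zero_in_hom[OF GY(2,1)]])
      then show "amap G (h \<cdot> f) = amap G (Zero T (omap \<Sigma> K) Y)"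
        using functor_comp[OF G f h] G_zero[OF SK Y] by simp
    qed
    then show "\<exists>F\<subseteq>I. finite F \<and> (\<forall>Y h. \<guillemotleft>h : P \<rightarrow> Y\<guillemotright> \<and> (\<forall>i\<in>F. h \<cdot> \<iota> i = Zero T (X i) Y) \<longrightarrow> h \<cdot> f = Zero T (omap \<Sigma> K) Y)"
      using F(1,2) by (intro exI[of _ F]) auto
  qed
qed

text \<open>The restriction of \<open>t\<close> to \<open>L\<close> is supported on a finite set.
  With these summands projected away, the arrow vanishes on \<open>L\<close> and therefore factors
  through \<Sigma>K, whose compactness supplies a second finite set; the union supports
  \<open>t\<close>.\<close>

lemma cone_compact:
  assumes tri: "(f, g, h) \<in> Tri T"
    and f: "\<guillemotleft>f : K \<rightarrow> L\<guillemotright>" and g: "\<guillemotleft>g : L \<rightarrow> M\<guillemotright>" and h: "\<guillemotleft>h : M \<rightarrow> omap \<Sigma> K\<guillemotright>"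
    and K: "is_compact T K" and L: "is_compact T L"
  shows "is_compact T M"
proof (rule compactI)
  show M: "M \<in> Obj T" using hom_objs[OF g] by simp
  have LO: "L \<in> Obj T" by (rule compact_obj[OF L])
  fix I :: "'a set" and X P \<iota> t
  assume sm: "small TYPE('a) I" and cop: "is_coproduct T I X P \<iota>" and t: "\<guillemotleft>t : M \<rightarrow> P\<guillemotright>"
  have P: "P \<in> Obj T" using cop by (simp add: is_coproduct_def)
  obtain F where F: "F \<subseteq> I" "finite F"
    "\<forall>Y k. \<guillemotleft>k : P \<rightarrow> Y\<guillemotright> \<and> (\<forall>i\<in>F. k \<cdot> \<iota> i = Zero T (X i) Y) \<longrightarrow> k \<cdot> (t \<cdot> g) = Zero T L Y"
    by (rule compactE[OF L sm cop comp[OF g t]])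
  obtain e where e: "\<guillemotleft>e : P \<rightarrow> P\<guillemotright>" "\<forall>i\<in>F. e \<cdot> \<iota> i = \<iota> i"
    "\<forall>Y k. \<guillemotleft>k : P \<rightarrow> Y\<guillemotright> \<and> (\<forall>i\<in>F. k \<cdot> \<iota> i = Zero T (X i) Y) \<longrightarrow> k \<cdot> e = Zero T P Y"
    by (rule coproduct_truncation[OF cop F(1)])
  \<comment> \<open>Complementary to the truncation: \<open>?d\<close> vanishes on the summands in
    \<open>F\<close>, and a map \<open>k\<close> that vanishes on them satisfies
    \<open>k \<cdot> ?d = k\<close>.\<close>
  let ?d = "Ident T P \<boxplus> neg T e"
  note ne = neg_in_hom[OF e(1)]
  have d: "\<guillemotleft>?d : P \<rightarrow> P\<guillemotright>" by (rule add_in_hom[OF ident[OF P] ne])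
  have "\<forall>i\<in>F. ?d \<cdot> \<iota> i = Zero T (X i) P"
  proof
    fix i assume i: "i \<in> F"
    have \<iota>: "\<guillemotleft>\<iota> i : X i \<rightarrow> P\<guillemotright>" using coproduct_inj[OF cop] i F(1) by blast
    show "?d \<cdot> \<iota> i = Zero T (X i) P"
      using distrib_right[OF \<iota> ident[OF P] ne] neg_comp[OF \<iota> e(1)] e(2) i ident_left[OF \<iota>] add_neg[OF \<iota>] by simp
  qed
  then have "(?d \<cdot> t) \<cdot> g = Zero T L P"
    using F(3)[THEN spec, THEN spec, THEN mp, OF conjI, OF d] assoc[OF g t d] by simp
  then obtain w where w: "\<guillemotleft>w : omap \<Sigma> K \<rightarrow> P\<guillemotright>" "?d \<cdot> t = w \<cdot> h"
    using tri_weak_cokernel[OF tri_rotated[OF tri f g h] g h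
      neg_in_hom[OF functor_arr[OF shift_functor f]] comp[OF t d]] by blast
  obtain G where G: "G \<subseteq> I" "finite G"
    "\<forall>Y k. \<guillemotleft>k : P \<rightarrow> Y\<guillemotright> \<and> (\<forall>i\<in>G. k \<cdot> \<iota> i = Zero T (X i) Y) \<longrightarrow> k \<cdot> w = Zero T (omap \<Sigma> K) Y"
    by (rule compactE[OF shift_compact[OF K] sm cop w(1)])
  have "k \<cdot> t = Zero T M Y" if k: "\<guillemotleft>k : P \<rightarrow> Y\<guillemotright>" and z: "\<forall>i\<in>F \<union> G. k \<cdot> \<iota> i = Zero T (X i) Y" for k Y
  proof -
    have Y: "Y \<in> Obj T" using hom_objs[OF k] by simp
    have "k \<cdot> ?d = k"
      using distrib_left[OF ident[OF P] ne k] comp_neg[OF e(1) k] e(3)[THEN spec, THEN spec, THEN mp, OF conjI, OF k] z ident_right[OF k]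
        neg_zero[OF P Y] add_zero[OF k] by simp
    then have "k \<cdot> t = k \<cdot> (w \<cdot> h)" using assoc[OF t d k] w(2) by simp
    also have "\<dots> = Zero T M Y"
      using assoc[OF h w(1) k] G(3)[THEN spec, THEN spec, THEN mp, OF conjI, OF k] z zero_comp[OF h Y] by simp
    finally show ?thesis .
  qed
  then show "\<exists>F\<subseteq>I. finite F \<and> (\<forall>Y k. \<guillemotleft>k : P \<rightarrow> Y\<guillemotright> \<and> (\<forall>i\<in>F. k \<cdot> \<iota> i = Zero T (X i) Y) \<longrightarrow> k \<cdot> t = Zero T M Y)"
    using F(1,2) G(1,2) by (intro exI[of _ "F \<union> G"]) auto
qed

end

lemma in_hom_compacts:
  "f \<in> carrier (Hom (compacts T) X Y) \<longleftrightarrow> \<guillemotleft>f : X \<rightarrow>\<^bsub>T\<^esub> Y\<guillemotright> \<and> is_compact T X \<and> is_compact T Y"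
  by (simp add: compacts_def in_hom_full_sub)

lemma Obj_compacts: "X \<in> Obj (compacts T) \<longleftrightarrow> is_compact T X"
  by (auto simp: compacts_def is_compact_def)

lemma compacts_simps [simp]:
  "Dom (compacts T) = Dom T" "Cod (compacts T) = Cod T" "Ident (compacts T) = Ident T"
  "Comp (compacts T) = Comp T" "Add (compacts T) = Add T" "Zero (compacts T) = Zero T"
  by (simp_all add: compacts_def)

text \<open>Zero objects, biproducts and cones are formed in \<open>T\<close> and stay compact;
  their defining equations and factorisations are inherited by the full subcategory.\<close>

lemma (in compactly_generated) compacts_small_triangle_category:
  assumes U: "universe TYPE('u)"
  shows "small_triangle_category (compacts T)"
proof -
  have pre: "preadditive (compacts T)" unfolding compacts_def by (rule preadditive_full_sub)
  show ?thesis
  proof (intro small_triangle_category.intro locally_small_category.intro additive_category.intro pre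
      locally_small_category_axioms.intro additive_category_axioms.intro small_triangle_category_axioms.intro U)
    fix X Y assume X: "X \<in> Obj (compacts T)" and Y: "Y \<in> Obj (compacts T)"
    then have c: "is_compact T X" "is_compact T Y" by (simp_all add: Obj_compacts)
    have "carrier (Hom (compacts T) X Y) = carrier (Hom T X Y)"
      using c by (auto simp: in_hom_compacts)
    then show "small TYPE('u) (carrier (Hom (compacts T) X Y))"
      using locally_small[OF compact_obj[OF c(1)] compact_obj[OF c(2)]] by simp
    obtain M where M: "is_biproduct T X Y M" using biproducts[OF compact_obj[OF c(1)] compact_obj[OF c(2)]] by blast
    have "is_compact T M" by (rule biproduct_compact[OF M c])
    then have "is_biproduct (compacts T) X Y M"
      using M c unfolding is_biproduct_def by (simp add: in_hom_compacts)
    then show "\<exists>M. is_biproduct (compacts T) X Y M" by blast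
  next
    obtain Z where Z: "is_zero T Z" using zero_object by blast
    have "is_zero (compacts T) Z"
      using Z zero_compact[OF Z] compact_obj unfolding is_zero_def by (simp add: Obj_compacts in_hom_compacts)
    then show "\<exists>Z. is_zero (compacts T) Z" by blast
  next
    have "isomorphic (compacts T) K K'" if "isomorphic T K K'" "is_compact T K" "is_compact T K'" for K K'
      using that unfolding isomorphic_def is_iso_def by (simp add: in_hom_compacts)
    then show "\<exists>S\<subseteq>Obj (compacts T). small TYPE('u) S \<and> (\<forall>K\<in>Obj (compacts T). \<exists>K'\<in>S. isomorphic (compacts T) K K')"
      using compacts_essentially_small Obj_compacts by (metis subsetD)
  next
    fix f assume "f \<in> Arr (compacts T)"
    then have "f \<in> Arr T" and K: "is_compact T (Dom T f)" and L: "is_compact T (Cod T f)"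
      by (auto simp: compacts_def full_sub_def)
    \<comment> \<open>The last two objects of the triangle are compact by closure under cones and
      shifts, and factorisations between compact objects lie in the full subcategory.\<close>
    obtain g h where tri: "(f, g, h) \<in> Tri T" using tri_complete[OF \<open>f \<in> Arr T\<close>] by blast
    obtain X Y Z where s: "\<guillemotleft>f : X \<rightarrow> Y\<guillemotright>" "\<guillemotleft>g : Y \<rightarrow> Z\<guillemotright>" "\<guillemotleft>h : Z \<rightarrow> omap \<Sigma> X\<guillemotright>" using tri_shape[OF tri] by blast
    have c: "is_compact T X" "is_compact T Y" using K L s by (auto simp: in_hom_iff)
    have c': "is_compact T Z" "is_compact T (omap \<Sigma> X)"
      using cone_compact[OF tri s c] shift_compact[OF c(1)] by auto
    have "g \<in> Arr (compacts T)" "h \<in> Arr (compacts T)"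
      using s c c' by (auto simp: in_hom_iff compacts_def full_sub_def)
    then have "exact_triple (compacts T) f g h"
      using tri_exact_triple[OF tri s] s c c' \<open>f \<in> Arr (compacts T)\<close> unfolding exact_triple_def
      by (simp add: in_hom_iff[of _ T] in_hom_compacts)
    then show "\<exists>g h. exact_triple (compacts T) f g h" by blast
  qed
qed

theorem theorem6p13:
  fixes T :: "('t, 'u) tricat" and U :: "('s, 'u) tricat"
    and Q\<^sub>T D\<^sub>T :: "('t, 'u, 's, 'u) ftor" and Q\<^sub>U D\<^sub>U :: "('s, 'u, 't, 'u) ftor"
    and \<delta>\<^sub>T :: "(('t, 'u) abftor, ('t, 'u) abtrans, ('s, 'u) abftor, ('s, 'u) abtrans) ftor"
    and \<delta>\<^sub>U :: "(('s, 'u) abftor, ('s, 'u) abtrans, ('t, 'u) abftor, ('t, 'u) abtrans) ftor"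
  assumes "universe TYPE('u)"
    and "agj_duality_triple T U Q\<^sub>T Q\<^sub>U D\<^sub>T D\<^sub>U"
  defines "\<delta>\<^sub>T \<equiv> delta (compacts T) (compacts U) D\<^sub>U"
    and "\<delta>\<^sub>U \<equiv> delta (compacts U) (compacts T) D\<^sub>T"
  shows "is_functor (op (AbFun (compacts T))) (AbFun (compacts U)) \<delta>\<^sub>T \<and>
    is_functor (op (AbFun (compacts U))) (AbFun (compacts T)) \<delta>\<^sub>U \<and>
    (\<exists>\<alpha>. nat_iso (compacts T) (AbFun (compacts U))
           (\<delta>\<^sub>T \<circ>\<^sub>F hom_embed (compacts T)) (hom_embed (compacts U) \<circ>\<^sub>F D\<^sub>T) \<alpha>) \<and>
    (\<exists>\<beta>. nat_iso (op (compacts T)) (AbFun (compacts T))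
           (\<delta>\<^sub>U \<circ>\<^sub>F \<delta>\<^sub>T \<circ>\<^sub>F hom_embed (compacts T)) (hom_embed (compacts T)) \<beta>) \<and>
    is_equivalence (op (fp_cat (compacts T))) (fp_cat (compacts U)) \<delta>\<^sub>T \<and>
    is_exact_functor (op (fp_cat (compacts T))) (fp_cat (compacts U)) \<delta>\<^sub>T"
proof -
  interpret agj_duality_triple T U Q\<^sub>T Q\<^sub>U D\<^sub>T D\<^sub>U by fact
  obtain \<eta> \<epsilon> where
    "nat_iso (compacts T) (compacts T) id_ftor (D\<^sub>U \<circ>\<^sub>F D\<^sub>T) \<eta>"
    "nat_iso (compacts U) (compacts U) id_ftor (D\<^sub>T \<circ>\<^sub>F D\<^sub>U) \<epsilon>"
    "\<forall>X\<in>Obj (compacts T). amap D\<^sub>T (\<eta> X) \<cdot>\<^bsub>U\<^esub> \<epsilon> (omap D\<^sub>T X) = Ident U (omap D\<^sub>T X)"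
    "\<forall>Y\<in>Obj (compacts U). amap D\<^sub>U (\<epsilon> Y) \<cdot>\<^bsub>T\<^esub> \<eta> (omap D\<^sub>U Y) = Ident T (omap D\<^sub>U Y)"
    using D_adjoint_equivalence by blast
  \<comment> \<open>The adjoint equivalence on the two categories of compact objects is exactly the
    data of a dual pair.\<close>
  then have dp: "dual_pair (compacts T) (compacts U) D\<^sub>T D\<^sub>U \<eta> \<epsilon>"
    using T.compacts_small_triangle_category[OF assms(1)] U.compacts_small_triangle_category[OF assms(1)] D_functor
    by (intro dual_pair.intro dual_pair_axioms.intro) simp_all
  interpret dual_pair "compacts T" "compacts U" D\<^sub>T D\<^sub>U \<eta> \<epsilon> by (rule dp)
  \<comment> \<open>The functor in the reverse direction comes from the dual pair with the roles of
    \<open>T\<close> and \<open>U\<close> exchanged.\<close>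
  show ?thesis
    unfolding \<delta>\<^sub>T_def \<delta>\<^sub>U_def
    using delta_additive_functor dual_pair.delta_additive_functor[OF dual] delta_hom_iso delta_hom_double_dual
      delta_equivalence delta_exact
    by (simp add: is_additive_functor_def)
qed

end
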